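(* Let $G$ be a torus with Lie algebra $\mathfrak g$ and integral lattice $\mathbb Z_G\subset\mathfrak g$. Let $u_1,\dots,u_N\in\mathbb Z_G$ be primitive vectors spanning $\mathfrak g$ over $\mathbb R$, let $\lambda_1,\dots,\lambda_N\in\mathbb R$, and let $P=\{\eta\in\mathfrak g^*\mid \langle\eta,u_j\rangle-\lambda_j\ge 0,\ 1\le j\le N\}$. Assume that $P$ has non-empty interior and that the collection of inequalities defining $P$ is minimal (dropping any one of them gives a strictly bigger set). Let $F\subset P$ be a face whose interior is $$\mathring F=\bigcap_{j\notin I}\{\eta\mid\langle\eta,u_j\rangle-\lambda_j>0\}\cap\bigcap_{j\in I}\{\eta\mid\langle\eta,u_j\rangle-\lambda_j=0\}$$ for a nonempty subset $I\subset\{1,\dots,N\}$, and assume $0\in\mathring F$. Let $\phi_P:M_P\to\mathfrak g^*$ be the Kähler quotient of $\mathbb C^N$ and its moment map described in the context, let $M_{\mathring F}:=\phi_P^{-1}(\mathring F)$, and let $v_j=u_j|_{\mathring F}$, where $u_j$ is regarded as the function $\eta\mapsto\langle\eta,u_j\rangle$ on $\mathfrak g^*$. Then the Kähler form $\omega_F$ on $M_{\mathring F}$ is $$\omega_F=\sqrt{-1}\,\partial\bar\partial\,(\phi_P|_{M_{\mathring F}})^*\Big(\sum_{j\notin I}\big(\lambda_j\log(v_j-\lambda_j)+v_j\big)\Big).$$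
   Context: Construction of $M_P$. Let $A:\mathbb R^N\to\mathfrak g$ be the linear map with $A(e_i)=u_i$ ($e_i$ the standard basis, $e_i^*$ the dual basis of $(\mathbb R^N)^*$). It maps $\mathbb Z^N$ into $\mathbb Z_G$ and induces a surjective homomorphism $\bar A:\mathbb T^N=\mathbb R^N/\mathbb Z^N\to\mathfrak g/\mathbb Z_G=G$. Let $K=\ker\bar A$, a compact abelian (possibly disconnected) group with Lie algebra $\mathfrak k=\ker A$, let $B:\mathfrak k\to\mathbb R^N$ be the inclusion, and let $A^*,B^*$ be the dual maps. Put $\lambda=\sum_i\lambda_ie_i^*$, $\nu=B^*(-\lambda)\in\mathfrak k^*$, and let $\iota_\lambda:\mathfrak g^*\to(\mathbb R^N)^*$, $\iota_\lambda(\ell)=-\lambda+A^*(\ell)$, an affine embedding with image $(B^* )^{-1}(\nu)$. Equip $\mathbb C^N$ with the flat Kähler form $\sqrt{-1}\sum_j dz_j\wedge d\bar z_j=\sqrt{-1}\,\partial\bar\partial\|z\|^2$ and the standard $\mathbb T^N$-action, with moment map normalized as $\phi(z)=\sum_j|z_j|^2e_j^*$. The $K$-moment map is $\phi_K=B^*\circ\phi$. Set $M_P:=\phi_K^{-1}(\nu)/K$, on which $G=\mathbb T^N/K$ acts. One has $\phi(\phi_K^{-1}(\nu))=\iota_\lambda(P)$. The restriction of $\phi$ to $\phi_K^{-1}(\nu)$ descends to $\bar\phi:M_P\to\iota_\lambda(\mathfrak g^* )$, and $\phi_P:=\iota_\lambda^{-1}\circ\bar\phi:M_P\to\mathfrak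 g^*$ is the moment map, with image $P$. Kähler structure on $M_{\mathring F}$. Let $\mathring V_I=\{z\in\mathbb C^N\mid z_j=0\Leftrightarrow j\in I\}$, a Kähler submanifold of $\mathbb C^N$, and $\mathbb T^N_I=\{a\in\mathbb T^N\mid a_j=1\text{ for }j\notin I\}$. The group $K_I=K/(K\cap\mathbb T^N_I)$ acts freely on $\mathring V_I$, and $M_{\mathring F}=\phi_P^{-1}(\mathring F)=(\phi_K^{-1}(\nu)\cap\mathring V_I)/K$ is the regular Kähler quotient of $\mathring V_I$ (with the form induced from $\mathbb C^N$) by $K_I$. It carries the usual reduced complex structure and reduced Kähler form $\omega_F$ (its pullback to $\phi_K^{-1}(\nu)\cap\mathring V_I$ is the restriction of the flat Kähler form). *)

theory Defs
  imports "HOL-Analysis.Analysis"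
begin

text \<open>
  Conventions.  The torus \<open>G\<close> is \<open>\<gg>/\<int>\<^sub>G\<close>, where \<open>\<gg>\<close> is a Euclidean space \<open>'g\<close> (only its
  vector space structure and topology are used) and \<open>\<int>\<^sub>G\<close> is a full lattice \<open>L\<close> in it.
  Dual spaces are spaces of bounded linear functionals; \<open>N\<close> is the cardinality of the finite
  index type \<open>'n\<close>.  The arguments \<open>L\<close>, \<open>u\<close>, \<open>lam\<close>, \<open>I\<close> are the data \<open>\<int>\<^sub>G\<close>,
  \<open>(u\<^sub>j)\<close>, \<open>(\<lambda>\<^sub>j)\<close>, \<open>I\<close> throughout.
\<close>

section \<open>Lattice and polyhedron\<close>

definition full_lattice :: "'g::euclidean_space set \<Rightarrow> bool" where
  "full_lattice L \<longleftrightarrow>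
     (\<exists>b. independent b \<and> span b = UNIV \<and>
          L = range (\<lambda>c :: 'g \<Rightarrow> int. \<Sum>v\<in>b. real_of_int (c v) *\<^sub>R v))"

definition primitive_vector :: "'g::euclidean_space set \<Rightarrow> 'g \<Rightarrow> bool" where
  "primitive_vector L x \<longleftrightarrow>
     x \<in> L \<and> (\<forall>y\<in>L. \<forall>k::int. x = real_of_int k *\<^sub>R y \<longrightarrow> k = 1 \<or> k = -1)"

definition moment_polyhedron ::
  "('n \<Rightarrow> 'g::euclidean_space) \<Rightarrow> ('n \<Rightarrow> real) \<Rightarrow> ('g \<Rightarrow>\<^sub>L real) set" where
  "moment_polyhedron u lam = {\<eta>. \<forall>j. blinfun_apply \<eta> (u j) - lam j \<ge> 0}"

definition open_face ::
  "('n \<Rightarrow> 'g::euclidean_space) \<Rightarrow> ('n \<Rightarrow> real) \<Rightarrow> 'n set \<Rightarrow> ('g \<Rightarrow>\<^sub>L real) set" where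
  "open_face u lam I =
     (\<Inter>j\<in>-I. {\<eta>. blinfun_apply \<eta> (u j) - lam j > 0}) \<inter>
     (\<Inter>j\<in>I. {\<eta>. blinfun_apply \<eta> (u j) - lam j = 0})"

section \<open>The space \<open>M\<^sub>P\<close> and its moment map\<close>

definition A_map :: "('n::finite \<Rightarrow> 'g::euclidean_space) \<Rightarrow> (real^'n) \<Rightarrow>\<^sub>L 'g" where
  "A_map u = Blinfun (\<lambda>t. \<Sum>j\<in>UNIV. t $ j *\<^sub>R u j)"

definition A_dual ::
  "('n::finite \<Rightarrow> 'g::euclidean_space) \<Rightarrow> ('g \<Rightarrow>\<^sub>L real) \<Rightarrow> ((real^'n) \<Rightarrow>\<^sub>L real)" where
  "A_dual u \<eta> = \<eta> o\<^sub>L A_map u"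

definition lie_k :: "('n::finite \<Rightarrow> 'g::euclidean_space) \<Rightarrow> (real^'n) set" where
  "lie_k u = {t. blinfun_apply (A_map u) t = 0}"

text \<open>The torus \<open>\<real>\<^sup>N/\<int>\<^sup>N\<close> is identified with the vectors all of whose entries have
  modulus 1; \<open>K\<close> is the kernel of the map to \<open>\<gg>/\<int>\<^sub>G\<close> induced by \<open>A\<close>.\<close>

definition torus_exp :: "real^'n \<Rightarrow> complex^'n" where
  "torus_exp t = (\<chi> j. cis (2 * pi * t $ j))"

definition group_K ::
  "'g::euclidean_space set \<Rightarrow> ('n::finite \<Rightarrow> 'g) \<Rightarrow> (complex^'n) set" where
  "group_K L u = torus_exp ` {t. blinfun_apply (A_map u) t \<in> L}"

definition act :: "complex^'n \<Rightarrow> complex^'n \<Rightarrow> complex^'n" where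
  "act a z = (\<chi> j. a $ j * z $ j)"

definition dual_basis :: "'n::finite \<Rightarrow> ((real^'n) \<Rightarrow>\<^sub>L real)" where
  "dual_basis j = Blinfun (\<lambda>t. t $ j)"

definition lam_vec :: "('n::finite \<Rightarrow> real) \<Rightarrow> ((real^'n) \<Rightarrow>\<^sub>L real)" where
  "lam_vec lam = (\<Sum>j\<in>UNIV. lam j *\<^sub>R dual_basis j)"

definition phi :: "complex^'n::finite \<Rightarrow> ((real^'n) \<Rightarrow>\<^sub>L real)" where
  "phi z = (\<Sum>j\<in>UNIV. (cmod (z $ j))\<^sup>2 *\<^sub>R dual_basis j)"

text \<open>The dual of the subspace \<open>\<kk>\<close> is not a type; its elements are functions restricted
  to \<open>\<kk>\<close> (with value \<open>undefined\<close> outside).\<close>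

definition B_dual ::
  "('n::finite \<Rightarrow> 'g::euclidean_space) \<Rightarrow> ((real^'n) \<Rightarrow>\<^sub>L real) \<Rightarrow> (real^'n \<Rightarrow> real)" where
  "B_dual u \<alpha> = restrict (blinfun_apply \<alpha>) (lie_k u)"

definition level_set ::
  "('n::finite \<Rightarrow> 'g::euclidean_space) \<Rightarrow> ('n \<Rightarrow> real) \<Rightarrow> (complex^'n) set" where
  "level_set u lam = {z. B_dual u (phi z) = B_dual u (- lam_vec lam)}"

definition K_orbit ::
  "'g::euclidean_space set \<Rightarrow> ('n::finite \<Rightarrow> 'g) \<Rightarrow> complex^'n \<Rightarrow> (complex^'n) set" where
  "K_orbit L u z = (\<lambda>a. act a z) ` group_K L u"

definition M_P ::
  "'g::euclidean_space set \<Rightarrow> ('n::finite \<Rightarrow> 'g) \<Rightarrow> ('n \<Rightarrow> real) \<Rightarrow> (complex^'n) set set" where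
  "M_P L u lam = K_orbit L u ` level_set u lam"

definition iota ::
  "('n::finite \<Rightarrow> 'g::euclidean_space) \<Rightarrow> ('n \<Rightarrow> real) \<Rightarrow> ('g \<Rightarrow>\<^sub>L real) \<Rightarrow> ((real^'n) \<Rightarrow>\<^sub>L real)" where
  "iota u lam \<eta> = - lam_vec lam + A_dual u \<eta>"

definition phi_bar :: "(complex^'n::finite) set \<Rightarrow> ((real^'n) \<Rightarrow>\<^sub>L real)" where
  "phi_bar p = the_elem (phi ` p)"

definition phi_P ::
  "('n::finite \<Rightarrow> 'g::euclidean_space) \<Rightarrow> ('n \<Rightarrow> real) \<Rightarrow> (complex^'n) set \<Rightarrow> ('g \<Rightarrow>\<^sub>L real)" where
  "phi_P u lam p = inv (iota u lam) (phi_bar p)"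

definition M_face ::
  "'g::euclidean_space set \<Rightarrow> ('n::finite \<Rightarrow> 'g) \<Rightarrow> ('n \<Rightarrow> real) \<Rightarrow> 'n set
     \<Rightarrow> (complex^'n) set set" where
  "M_face L u lam I = {p \<in> M_P L u lam. phi_P u lam p \<in> open_face u lam I}"

section \<open>Tangent vectors, complex structure and Kaehler form of the quotient\<close>

definition stratum :: "'n set \<Rightarrow> (complex^'n) set" where
  "stratum I = {z. \<forall>j. z $ j = 0 \<longleftrightarrow> j \<in> I}"

definition Z_face ::
  "('n::finite \<Rightarrow> 'g::euclidean_space) \<Rightarrow> ('n \<Rightarrow> real) \<Rightarrow> 'n set \<Rightarrow> (complex^'n) set" where
  "Z_face u lam I = level_set u lam \<inter> stratum I"

text \<open>Tangent space of an embedded submanifold: velocities of curves in it.\<close>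

definition tangent_space :: "'a::real_normed_vector set \<Rightarrow> 'a \<Rightarrow> 'a set" where
  "tangent_space S z =
     {v. \<exists>c :: real \<Rightarrow> 'a. c 0 = z \<and> (\<forall>t. c t \<in> S) \<and> (c has_vector_derivative v) (at 0)}"

definition vertical_space ::
  "('n::finite \<Rightarrow> 'g::euclidean_space) \<Rightarrow> complex^'n \<Rightarrow> (complex^'n) set" where
  "vertical_space u z =
     (\<lambda>t. \<chi> j. 2 * complex_of_real pi * \<i> * complex_of_real (t $ j) * z $ j) ` lie_k u"

definition horizontal_space ::
  "('n::finite \<Rightarrow> 'g::euclidean_space) \<Rightarrow> ('n \<Rightarrow> real) \<Rightarrow> 'n set
     \<Rightarrow> complex^'n \<Rightarrow> (complex^'n) set" where
  "horizontal_space u lam I z =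
     {h \<in> tangent_space (Z_face u lam I) z. \<forall>y\<in>vertical_space u z. h \<bullet> y = 0}"

text \<open>With \<open>\<pi>\<close> the projection of \<open>Z_face\<close> onto its quotient by \<open>K\<close>, the tangent vector
  \<open>d\<pi>(z, v)\<close> of the quotient is represented by the set of all \<open>(z', v')\<close> with
  \<open>d\<pi>(z', v') = d\<pi>(z, v)\<close>.  In particular, tangent vectors at different points are different.\<close>

definition dproj ::
  "'g::euclidean_space set \<Rightarrow> ('n::finite \<Rightarrow> 'g) \<Rightarrow> complex^'n \<Rightarrow> complex^'n
     \<Rightarrow> ((complex^'n) \<times> (complex^'n)) set" where
  "dproj L u z v =
     {(act a z, act a v + y) | a y. a \<in> group_K L u \<and> y \<in> vertical_space u (act a z)}"

definition quotient_tangent ::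
  "'g::euclidean_space set \<Rightarrow> ('n::finite \<Rightarrow> 'g) \<Rightarrow> ('n \<Rightarrow> real) \<Rightarrow> 'n set
     \<Rightarrow> (complex^'n) set \<Rightarrow> ((complex^'n) \<times> (complex^'n)) set set" where
  "quotient_tangent L u lam I p =
     {dproj L u z v | z v. z \<in> p \<and> v \<in> tangent_space (Z_face u lam I) z}"

text \<open>The reduced complex structure is the one for which \<open>d\<pi>\<close> is complex linear on
  horizontal spaces.\<close>

definition reduced_J ::
  "'g::euclidean_space set \<Rightarrow> ('n::finite \<Rightarrow> 'g) \<Rightarrow> ('n \<Rightarrow> real) \<Rightarrow> 'n set
     \<Rightarrow> ((complex^'n) \<times> (complex^'n)) set \<Rightarrow> ((complex^'n) \<times> (complex^'n)) set" where
  "reduced_J L u lam I X =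
     (THE Y. \<exists>z h. (z, h) \<in> X \<and> h \<in> horizontal_space u lam I z \<and> Y = dproj L u z (\<i> *s h))"

definition wedge :: "('a \<Rightarrow> complex) \<Rightarrow> ('a \<Rightarrow> complex) \<Rightarrow> 'a \<Rightarrow> 'a \<Rightarrow> complex" where
  "wedge \<alpha> \<beta> v w = \<alpha> v * \<beta> w - \<alpha> w * \<beta> v"

definition flat_form :: "complex^'n::finite \<Rightarrow> complex^'n \<Rightarrow> complex" where
  "flat_form v w = \<i> * (\<Sum>j\<in>UNIV. wedge (\<lambda>x. x $ j) (\<lambda>x. cnj (x $ j)) v w)"

text \<open>The form on the quotient whose pullback under \<open>\<pi>\<close> is the restriction of the flat form.\<close>

definition reduced_form ::
  "((complex^'n::finite) \<times> (complex^'n)) set \<Rightarrow> ((complex^'n) \<times> (complex^'n)) set \<Rightarrow> complex" where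
  "reduced_form X Y = (THE r. \<exists>z v w. (z, v) \<in> X \<and> (z, w) \<in> Y \<and> r = flat_form v w)"

section \<open>Holomorphic coordinates and the operator \<open>\<partial>\<partial>bar\<close> on the quotient\<close>

text \<open>The dimension of the quotient depends on \<open>I\<close>, so it cannot be a type.  As model spaces
  we use the coordinate subspaces \<open>\<complex>\<^sup>B\<close> of \<open>\<complex>\<^sup>N\<close>, where \<open>B\<close> is a set of indices; every
  dimension from \<open>0\<close> to \<open>N\<close> occurs.\<close>

definition coord_space :: "'n set \<Rightarrow> (complex^'n) set" where
  "coord_space B = {w. \<forall>j. j \<notin> B \<longrightarrow> w $ j = 0}"

definition C2_on ::
  "'a::real_normed_vector set \<Rightarrow> ('a \<Rightarrow> 'b::real_normed_vector) \<Rightarrow> bool" where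
  "C2_on W f \<longleftrightarrow>
     (\<exists>(D :: 'a \<Rightarrow> 'a \<Rightarrow>\<^sub>L 'b) (D2 :: 'a \<Rightarrow> 'a \<Rightarrow>\<^sub>L 'a \<Rightarrow>\<^sub>L 'b).
        (\<forall>x\<in>W. (f has_derivative blinfun_apply (D x)) (at x within W)) \<and>
        (\<forall>x\<in>W. (D has_derivative blinfun_apply (D2 x)) (at x within W)) \<and>
        continuous_on W D2)"

definition dir_deriv ::
  "('a::real_vector \<Rightarrow> 'b::real_normed_vector) \<Rightarrow> 'a \<Rightarrow> 'a \<Rightarrow> 'b" where
  "dir_deriv f x v = vector_derivative (\<lambda>t::real. f (x + t *\<^sub>R v)) (at 0)"

text \<open>The differential of \<open>\<pi> \<circ> s\<close>.\<close>

definition dchart ::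
  "'g::euclidean_space set \<Rightarrow> ('n::finite \<Rightarrow> 'g) \<Rightarrow> (complex^'n \<Rightarrow> complex^'n)
     \<Rightarrow> complex^'n \<Rightarrow> complex^'n \<Rightarrow> ((complex^'n) \<times> (complex^'n)) set" where
  "dchart L u s w \<xi> = dproj L u (s w) (dir_deriv s w \<xi>)"

text \<open>A holomorphic chart of the quotient is given by its inverse, a map from an open subset \<open>W\<close>
  of \<open>\<complex>\<^sup>B\<close> to the quotient, and this inverse is given by a lift \<open>s\<close> to \<open>Z_face\<close>: the
  inverse is \<open>\<pi> \<circ> s\<close>.  It is injective, its differentials are isomorphisms and they are complex
  linear for the reduced complex structure.  Since \<open>\<pi>\<close> is a principal bundle, every
  holomorphic chart has such lifts locally.  It does not matter that
  lifts are only required to be twice continuously differentiable: by the Cauchy-Riemann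
  equations \<open>\<pi> \<circ> s\<close> is nevertheless holomorphic.\<close>

definition holomorphic_chart ::
  "'g::euclidean_space set \<Rightarrow> ('n::finite \<Rightarrow> 'g) \<Rightarrow> ('n \<Rightarrow> real) \<Rightarrow> 'n set
     \<Rightarrow> 'n set \<Rightarrow> (complex^'n) set \<Rightarrow> (complex^'n \<Rightarrow> complex^'n) \<Rightarrow> bool" where
  "holomorphic_chart L u lam I B W s \<longleftrightarrow>
     openin (top_of_set (coord_space B)) W \<and>
     s ` W \<subseteq> Z_face u lam I \<and>
     C2_on W s \<and>
     inj_on (\<lambda>w. K_orbit L u (s w)) W \<and>
     (\<forall>w\<in>W. bij_betw (dchart L u s w) (coord_space B)
              (quotient_tangent L u lam I (K_orbit L u (s w)))) \<and>
     (\<forall>w\<in>W. \<forall>\<xi>\<in>coord_space B.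
        dchart L u s w (\<i> *s \<xi>) = reduced_J L u lam I (dchart L u s w \<xi>))"

text \<open>Wirtinger derivatives.  For \<open>a \<in> B\<close> they only use values of \<open>g\<close> on \<open>\<complex>\<^sup>B\<close>.\<close>

definition d_w :: "'n::finite \<Rightarrow> (complex^'n \<Rightarrow> complex) \<Rightarrow> complex^'n \<Rightarrow> complex" where
  "d_w a g w = (dir_deriv g w (axis a 1) - \<i> * dir_deriv g w (axis a \<i>)) / 2"

definition d_wbar :: "'n::finite \<Rightarrow> (complex^'n \<Rightarrow> complex) \<Rightarrow> complex^'n \<Rightarrow> complex" where
  "d_wbar a g w = (dir_deriv g w (axis a 1) + \<i> * dir_deriv g w (axis a \<i>)) / 2"

definition ddbar_coord ::
  "'n::finite set \<Rightarrow> (complex^'n \<Rightarrow> complex) \<Rightarrow> complex^'n \<Rightarrow> complex^'n \<Rightarrow> complex^'n \<Rightarrow> complex" where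
  "ddbar_coord B g w \<xi> \<eta> =
     (\<Sum>a\<in>B. \<Sum>b\<in>B. d_w a (d_wbar b g) w * wedge (\<lambda>x. x $ a) (\<lambda>x. cnj (x $ b)) \<xi> \<eta>)"

text \<open>The value of \<open>\<partial>\<partial>bar f\<close> on two tangent vectors at the same point is the value of its
  coordinate expression, in any holomorphic chart around that point.\<close>

definition ddbar ::
  "'g::euclidean_space set \<Rightarrow> ('n::finite \<Rightarrow> 'g) \<Rightarrow> ('n \<Rightarrow> real) \<Rightarrow> 'n set
     \<Rightarrow> ((complex^'n) set \<Rightarrow> complex)
     \<Rightarrow> ((complex^'n) \<times> (complex^'n)) set \<Rightarrow> ((complex^'n) \<times> (complex^'n)) set \<Rightarrow> complex" where
  "ddbar L u lam I f X Y =
     (THE r. \<exists>B W s w \<xi> \<eta>.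
        holomorphic_chart L u lam I B W s \<and> w \<in> W \<and>
        \<xi> \<in> coord_space B \<and> \<eta> \<in> coord_space B \<and>
        dchart L u s w \<xi> = X \<and> dchart L u s w \<eta> = Y \<and>
        r = ddbar_coord B (\<lambda>x. f (K_orbit L u (s x))) w \<xi> \<eta>)"

end

theory Submission
  imports Defs
begin

text \<open>
  Let \<open>Z\<close> be the part of the level set in the stratum of \<open>I\<close>, let \<open>s\<close> be a lift to \<open>Z\<close> of a
  holomorphic chart of the quotient, and let \<open>F(z) = \<Sum> (\<lambda>\<^sub>j log |z\<^sub>j|\<^sup>2 + |z\<^sub>j|\<^sup>2)\<close>, summed over
  \<open>j \<notin> I\<close>.  On \<open>Z\<close> the moment map gives \<open>v\<^sub>j - \<lambda>\<^sub>j = |z\<^sub>j|\<^sup>2\<close>, so that up to a constant the function in question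
  is \<open>F \<circ> s\<close> in the chart (\<open>phi_P_orbit\<close>).  On the stratum \<open>log |z\<^sub>j|\<^sup>2\<close> is pluriharmonic, hence
  \<open>\<i> \<partial>\<partial>bar F\<close> is the flat form.  The lift \<open>s\<close> is not holomorphic, but its differential is complex linear up to
  vectors in \<open>V + \<i> V\<close>, where \<open>V\<close> is the space of orbit directions (\<open>D_i\<close>).  The
  function \<open>F\<close> is chosen such that its holomorphic differential \<open>\<partial>F = \<Sum> (cnj z\<^sub>j + \<lambda>\<^sub>j/z\<^sub>j) dz\<^sub>j\<close> vanishes
  on \<open>V\<close> at the points of \<open>Z\<close>: on an orbit direction \<open>\<i> t\<^sub>j z\<^sub>j\<close> it is \<open>\<i> \<Sum> t\<^sub>j (|z\<^sub>j|\<^sup>2 + \<lambda>\<^sub>j)\<close>, which is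
  zero by the equations of the level set (\<open>dF_vertical\<close>).  Therefore the pullback \<open>\<theta> = s\<^sup>* \<partial>F\<close> is of type
  \<open>(1,0)\<close> and equals \<open>\<partial>(F \<circ> s)\<close>, and its exterior derivative is the pullback of \<open>d \<partial>F\<close>, the flat form up to a factor
  (\<open>beta_antisymmetrized\<close>).  The flat form restricted to \<open>Z\<close> ignores orbit directions, so this is of
  type \<open>(1,1)\<close>, and comparing types gives the formula (\<open>ddbar_coord_eq\<close>).

  The operator \<open>\<partial>\<partial>bar\<close> is the common value in all charts, so a chart around every point is needed as well
  (\<open>holomorphic_chart_exists\<close>).  In logarithmic coordinates the complexification of \<open>K\<close> acts on the stratum by
  translations by the complexification of a real subspace.  A coordinate subspace \<open>\<complex>\<^sup>B\<close> complementary to it is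
  a holomorphic slice, and its points are moved into the level set by a real translation, found from a
  convex problem by the inverse function theorem (\<open>slice_map\<close>).  Nearby points of the slice lie in different \<open>K\<close>-orbits
  because the lattice is discrete modulo the span of the \<open>u\<^sub>j\<close> with \<open>j \<in> I\<close>
  (\<open>lattice_discrete_mod_face\<close>).
\<close>

section \<open>Twice continuously differentiable maps\<close>

lemma mixed_difference_quotient:
  fixes f f1 f12 :: "real \<Rightarrow> real \<Rightarrow> real"
  assumes h: "0 < h"
    and d1: "\<And>s t. 0 \<le> s \<Longrightarrow> s \<le> h \<Longrightarrow> 0 \<le> t \<Longrightarrow> t \<le> h \<Longrightarrow> ((\<lambda>s. f s t) has_real_derivative f1 s t) (at s)"
    and d12: "\<And>s t. 0 \<le> s \<Longrightarrow> s \<le> h \<Longrightarrow> 0 \<le> t \<Longrightarrow> t \<le> h \<Longrightarrow> ((\<lambda>t. f1 s t) has_real_derivative f12 s t) (at t)"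
  obtains s t where "0 < s" "s < h" "0 < t" "t < h"
    "f h h - f h 0 - f 0 h + f 0 0 = h * h * f12 s t"
proof -
  have "\<exists>s>0. s < h \<and> (f h h - f h 0) - (f 0 h - f 0 0) = (h - 0) * (f1 s h - f1 s 0)"
    using h by (intro MVT2) (auto intro!: DERIV_diff d1)
  then obtain s where s: "0 < s" "s < h" "(f h h - f h 0) - (f 0 h - f 0 0) = h * (f1 s h - f1 s 0)"
    by auto
  have "\<exists>t>0. t < h \<and> f1 s h - f1 s 0 = (h - 0) * f12 s t"
    using h s by (intro MVT2) (auto intro!: d12)
  then obtain t where t: "0 < t" "t < h" "f1 s h - f1 s 0 = h * f12 s t" by auto
  show ?thesis using that[of s t] s t by (simp add: algebra_simps)
qed

text \<open>Schwarz's theorem: both mixed partial derivatives are limits of the same second difference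
  quotient \<open>(f h h - f h 0 - f 0 h + f 0 0) / h\<^sup>2\<close>.\<close>

lemma mixed_partials_equal:
  fixes f f1 f2 f12 f21 :: "real \<Rightarrow> real \<Rightarrow> real"
  assumes \<delta>: "0 < \<delta>"
    and d1: "\<And>s t. \<bar>s\<bar> < \<delta> \<Longrightarrow> \<bar>t\<bar> < \<delta> \<Longrightarrow> ((\<lambda>s. f s t) has_real_derivative f1 s t) (at s)"
    and d2: "\<And>s t. \<bar>s\<bar> < \<delta> \<Longrightarrow> \<bar>t\<bar> < \<delta> \<Longrightarrow> ((\<lambda>t. f s t) has_real_derivative f2 s t) (at t)"
    and d12: "\<And>s t. \<bar>s\<bar> < \<delta> \<Longrightarrow> \<bar>t\<bar> < \<delta> \<Longrightarrow> ((\<lambda>t. f1 s t) has_real_derivative f12 s t) (at t)"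
    and d21: "\<And>s t. \<bar>s\<bar> < \<delta> \<Longrightarrow> \<bar>t\<bar> < \<delta> \<Longrightarrow> ((\<lambda>s. f2 s t) has_real_derivative f21 s t) (at s)"
    and c12: "isCont (\<lambda>p. f12 (fst p) (snd p)) (0, 0)"
    and c21: "isCont (\<lambda>p. f21 (fst p) (snd p)) (0, 0)"
  shows "f12 0 0 = f21 0 0"
proof (rule ccontr)
  define e where "e = \<bar>f12 0 0 - f21 0 0\<bar> / 2"
  assume "f12 0 0 \<noteq> f21 0 0"
  then have e: "e > 0" by (simp add: e_def)
  obtain d where d: "d > 0" "\<And>p. dist p (0,0) < d \<Longrightarrow> dist (f12 (fst p) (snd p)) (f12 0 0) < e"
    using c12 e unfolding continuous_at_eps_delta by force
  obtain d' where d': "d' > 0" "\<And>p. dist p (0,0) < d' \<Longrightarrow> dist (f21 (fst p) (snd p)) (f21 0 0) < e"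
    using c21 e unfolding continuous_at_eps_delta by force
  define h where "h = min (min d d') \<delta> / 2"
  have h: "0 < h" "h < \<delta>" "2 * h \<le> d" "2 * h \<le> d'"
    using d d' \<delta> by (auto simp: h_def)
  have near: "dist (s, t) (0, 0) < 2 * h" if "0 < s" "s < h" "0 < t" "t < h" for s t :: real
  proof -
    have "dist (s, t) (0, 0) \<le> \<bar>s\<bar> + \<bar>t\<bar>"
      by (simp add: dist_Pair_Pair dist_real_def sqrt_sum_squares_le_sum_abs)
    with that show ?thesis by simp
  qed
  obtain s t where st: "0 < s" "s < h" "0 < t" "t < h" "f h h - f h 0 - f 0 h + f 0 0 = h * h * f12 s t"
    using h by (rule_tac mixed_difference_quotient[of h f f1 f12]) (auto intro!: d1 d12)
  obtain s' t' where st': "0 < s'" "s' < h" "0 < t'" "t' < h" "f h h - f 0 h - f h 0 + f 0 0 = h * h * f21 t' s'"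
    using h by (rule_tac mixed_difference_quotient[of h "\<lambda>s t. f t s" "\<lambda>s t. f2 t s" "\<lambda>s t. f21 t s"]) (auto intro!: d2 d21)
  have "h * h * f12 s t = h * h * f21 t' s'" using st(5) st'(5) by linarith
  then have "f12 s t = f21 t' s'" using h by simp
  moreover have "\<bar>f12 s t - f12 0 0\<bar> < e" using d(2)[of "(s,t)"] near[OF st(1-4)] h by (simp add: dist_real_def)
  moreover have "\<bar>f21 t' s' - f21 0 0\<bar> < e" using d'(2)[of "(t',s')"] near[of t' s'] st' h by (simp add: dist_real_def)
  ultimately have "\<bar>f12 0 0 - f21 0 0\<bar> < e + e" by (smt (verit))
  then show False by (simp add: e_def)
qed

lemma C2_onI:
  fixes D :: "'a::real_normed_vector \<Rightarrow> 'a \<Rightarrow>\<^sub>L 'b::real_normed_vector"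
  assumes "\<And>x. x \<in> W \<Longrightarrow> (f has_derivative blinfun_apply (D x)) (at x within W)"
    and "\<And>x. x \<in> W \<Longrightarrow> (D has_derivative blinfun_apply (E x)) (at x within W)"
    and "continuous_on W E"
  shows "C2_on W f"
  using assms unfolding C2_on_def by blast

lemma C2_onE:
  fixes f :: "'a::real_normed_vector \<Rightarrow> 'b::real_normed_vector"
  assumes "C2_on W f"
  obtains D :: "'a \<Rightarrow> 'a \<Rightarrow>\<^sub>L 'b" and E where
    "\<And>x. x \<in> W \<Longrightarrow> (f has_derivative blinfun_apply (D x)) (at x within W)"
    "\<And>x. x \<in> W \<Longrightarrow> (D has_derivative blinfun_apply (E x)) (at x within W)"
    "continuous_on W E" "continuous_on W f" "continuous_on W D"
proof -
  obtain D :: "'a \<Rightarrow> 'a \<Rightarrow>\<^sub>L 'b" and E where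
    D: "\<forall>x\<in>W. (f has_derivative blinfun_apply (D x)) (at x within W)" and
    E: "\<forall>x\<in>W. (D has_derivative blinfun_apply (E x)) (at x within W)" and
    cE: "continuous_on W E"
    using assms unfolding C2_on_def by blast
  have "continuous_on W f" "continuous_on W D"
    using D E by (auto simp: continuous_on_eq_continuous_within intro: has_derivative_continuous)
  with D E cE that show ?thesis by blast
qed

lemma C2_on_bounded_linear:
  assumes "bounded_linear f"
  shows "C2_on W f"
proof (rule C2_onI[where D = "\<lambda>_. Blinfun f" and E = "\<lambda>_. 0"])
  show "(f has_derivative blinfun_apply (Blinfun f)) (at x within W)" for x
    using assms by (simp add: bounded_linear_Blinfun_apply bounded_linear_imp_has_derivative)
  show "((\<lambda>_. Blinfun f) has_derivative blinfun_apply 0) (at x within W)" for x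
    by (simp add: zero_blinfun.rep_eq)
qed auto

lemma C2_on_add:
  assumes "C2_on W f" "C2_on W g"
  shows "C2_on W (\<lambda>x. f x + g x)"
proof -
  obtain D E where f: "\<And>x. x \<in> W \<Longrightarrow> (f has_derivative blinfun_apply (D x)) (at x within W)"
    "\<And>x. x \<in> W \<Longrightarrow> (D has_derivative blinfun_apply (E x)) (at x within W)"
    "continuous_on W E" "continuous_on W f" "continuous_on W D"
    by (rule C2_onE[OF assms(1)]) blast
  obtain D' E' where g: "\<And>x. x \<in> W \<Longrightarrow> (g has_derivative blinfun_apply (D' x)) (at x within W)"
    "\<And>x. x \<in> W \<Longrightarrow> (D' has_derivative blinfun_apply (E' x)) (at x within W)"
    "continuous_on W E'" "continuous_on W g" "continuous_on W D'"
    by (rule C2_onE[OF assms(2)]) blast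
  show ?thesis
    by (rule C2_onI[where D = "\<lambda>x. D x + D' x" and E = "\<lambda>x. E x + E' x"])
      (auto simp: plus_blinfun.rep_eq intro!: has_derivative_add f g continuous_on_add)
qed

lemma C2_on_compose:
  fixes f :: "'a::real_normed_vector \<Rightarrow> 'b::real_normed_vector" and g :: "'b \<Rightarrow> 'c::real_normed_vector"
  assumes "C2_on V g" "C2_on W f" "f ` W \<subseteq> V"
  shows "C2_on W (\<lambda>x. g (f x))"
proof -
  obtain D E where f: "\<And>x. x \<in> W \<Longrightarrow> (f has_derivative blinfun_apply (D x)) (at x within W)"
    "\<And>x. x \<in> W \<Longrightarrow> (D has_derivative blinfun_apply (E x)) (at x within W)"
    "continuous_on W E" "continuous_on W f" "continuous_on W D"
    by (rule C2_onE[OF assms(2)]) blast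
  obtain D' E' where g: "\<And>x. x \<in> V \<Longrightarrow> (g has_derivative blinfun_apply (D' x)) (at x within V)"
    "\<And>x. x \<in> V \<Longrightarrow> (D' has_derivative blinfun_apply (E' x)) (at x within V)"
    "continuous_on V E'" "continuous_on V g" "continuous_on V D'"
    by (rule C2_onE[OF assms(1)]) blast
  have chain: "((\<lambda>x. k (f x)) has_derivative (\<lambda>v. k' (D x v))) (at x within W)"
    if "x \<in> W" "(k has_derivative k') (at (f x) within V)" for k :: "'b \<Rightarrow> 'z::real_normed_vector" and k' x
    using has_derivative_in_compose[OF f(1) has_derivative_subset[OF that(2) assms(3)]] that(1) by simp
  interpret c: bounded_bilinear "(o\<^sub>L) :: 'b \<Rightarrow>\<^sub>L 'c \<Rightarrow> 'a \<Rightarrow>\<^sub>L 'b \<Rightarrow> 'a \<Rightarrow>\<^sub>L 'c"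
    by (rule bounded_bilinear_blinfun_compose)
  define F where "F x = D' (f x) o\<^sub>L D x" for x
  define F2 where "F2 x = (c.prod_left (D x) o\<^sub>L (E' (f x) o\<^sub>L D x))
      + (c.prod_right (D' (f x)) o\<^sub>L E x)" for x
  show ?thesis
  proof (rule C2_onI[where D = F and E = F2])
    fix x assume x: "x \<in> W"
    then have fx: "f x \<in> V" using assms(3) by blast
    show "((\<lambda>x. g (f x)) has_derivative blinfun_apply (F x)) (at x within W)"
      using chain[OF x g(1)[OF fx]] by (simp add: F_def blinfun_compose.rep_eq o_def)
    have *: "blinfun_apply (F2 x) = (\<lambda>h. (D' (f x) o\<^sub>L E x h) + (E' (f x) (D x h) o\<^sub>L D x))"
      by (auto simp: fun_eq_iff F2_def plus_blinfun.rep_eq c.prod_left.rep_eq c.prod_right.rep_eq)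
    show "(F has_derivative blinfun_apply (F2 x)) (at x within W)"
      unfolding F_def[abs_def] *
      by (rule bounded_bilinear.FDERIV[OF bounded_bilinear_blinfun_compose chain[OF x g(2)[OF fx]] f(2)[OF x]])
  next
    have "continuous_on W (\<lambda>x. E' (f x))" "continuous_on W (\<lambda>x. D' (f x))"
      by (auto intro!: continuous_on_compose2[OF g(3) f(4)] continuous_on_compose2[OF g(5) f(4)] assms(3))
    then show "continuous_on W F2"
      unfolding F2_def[abs_def] by (intro continuous_intros f(3,5))
  qed
qed

text \<open>For instance an exponential: it solves a linear differential equation, so that its
  derivatives are again expressed by itself.\<close>

lemma C2_on_linear_ode:
  fixes e :: "'a::real_normed_vector \<Rightarrow> 'b::real_normed_vector"
  assumes M: "bounded_linear M"
    and e: "\<And>x. (e has_derivative blinfun_apply (M (e x))) (at x)"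
  shows "C2_on W e"
proof (rule C2_onI[where D = "\<lambda>x. M (e x)" and E = "\<lambda>x. Blinfun M o\<^sub>L M (e x)"])
  have contE: "continuous_on W e"
    by (intro continuous_at_imp_continuous_on ballI has_derivative_continuous[OF e])
  show "(e has_derivative blinfun_apply (M (e x))) (at x within W)" for x
    by (rule has_derivative_at_withinI[OF e])
  show "((\<lambda>x. M (e x)) has_derivative blinfun_apply (Blinfun M o\<^sub>L M (e x))) (at x within W)" for x
    using bounded_linear.has_derivative[OF M has_derivative_at_withinI[OF e], of x W]
    by (simp add: blinfun_compose.rep_eq o_def bounded_linear_Blinfun_apply[OF M])
  show "continuous_on W (\<lambda>x. Blinfun M o\<^sub>L M (e x))"
    by (rule bounded_linear.continuous_on[OF bounded_linear_compose[OF
          bounded_bilinear.bounded_linear_right[OF bounded_bilinear_blinfun_compose] M] contE])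
qed

text \<open>Everything follows from the identity \<open>H y - H x = - H y (M y - M x) H x\<close>: it bounds \<open>H\<close> near \<open>x\<close>, then
  it shows that \<open>H\<close> is continuous, and then it identifies the derivative.\<close>

lemma has_derivative_blinfun_inverse:
  fixes M H :: "'a::real_normed_vector \<Rightarrow> 'b::real_normed_vector \<Rightarrow>\<^sub>L 'b"
  assumes HM: "\<And>y. H y o\<^sub>L M y = id_blinfun" and MH: "\<And>y. M y o\<^sub>L H y = id_blinfun"
    and M: "(M has_derivative M') (at x)"
  shows "(H has_derivative (\<lambda>v. - (H x o\<^sub>L M' v o\<^sub>L H x))) (at x)"
proof -
  interpret c: bounded_bilinear "(o\<^sub>L) :: 'b \<Rightarrow>\<^sub>L 'b \<Rightarrow> _" by (rule bounded_bilinear_blinfun_compose)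
  have assoc: "a o\<^sub>L (b o\<^sub>L d) = (a o\<^sub>L b) o\<^sub>L d" for a b d :: "'b \<Rightarrow>\<^sub>L 'b"
    by (rule blinfun_eqI) simp
  have idl: "id_blinfun o\<^sub>L a = a" "a o\<^sub>L id_blinfun = a" for a :: "'b \<Rightarrow>\<^sub>L 'b"
    by (auto intro: blinfun_eqI)
  have diff: "H y - H x = - (H y o\<^sub>L (M y - M x) o\<^sub>L H x)" for y
    by (simp add: c.diff_left c.diff_right HM MH idl assoc[symmetric])
  have contM: "(M \<longlongrightarrow> M x) (at x)" using has_derivative_continuous[OF M] by (simp add: continuous_at isCont_def)
  have small: "\<forall>\<^sub>F y in at x. norm (M y - M x) * norm (H x) < 1 / 2"
  proof -
    have "((\<lambda>y. norm (M y - M x) * norm (H x)) \<longlongrightarrow> norm (M x - M x) * norm (H x)) (at x)"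
      by (intro tendsto_intros contM)
    then show ?thesis by (rule order_tendstoD(2)) simp
  qed
  have bound: "\<forall>\<^sub>F y in at x. norm (H y) \<le> 2 * norm (H x)"
    using small
  proof eventually_elim
    case (elim y)
    have "norm (H y) \<le> norm (H x) + norm (H y - H x)"
      by (metis add.commute diff_add_cancel norm_triangle_ineq)
    also have "norm (H y - H x) \<le> norm (H y) * norm (M y - M x) * norm (H x)"
      unfolding diff norm_minus_cancel
      by (meson mult_right_mono norm_blinfun_compose norm_ge_zero order_trans)
    also have "\<dots> \<le> norm (H y) * (1 / 2)"
      using mult_left_mono[OF less_imp_le[OF elim] norm_ge_zero[of "H y"]] by (simp only: mult.assoc)
    finally show ?case by simp
  qed
  have contH: "((\<lambda>y. H y) \<longlongrightarrow> H x) (at x)"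
  proof (rule LIM_zero_cancel, rule Lim_null_comparison)
    show "\<forall>\<^sub>F y in at x. norm (H y - H x) \<le> 2 * norm (H x) * norm (M y - M x) * norm (H x)"
      using bound
    proof eventually_elim
      case (elim y)
      have "norm (H y - H x) \<le> norm (H y) * norm (M y - M x) * norm (H x)"
        unfolding diff norm_minus_cancel
        by (meson mult_right_mono norm_blinfun_compose norm_ge_zero order_trans)
      also have "\<dots> \<le> 2 * norm (H x) * norm (M y - M x) * norm (H x)"
        using elim by (intro mult_right_mono) auto
      finally show ?case .
    qed
    have "((\<lambda>y. 2 * norm (H x) * norm (M y - M x) * norm (H x)) \<longlongrightarrow> 2 * norm (H x) * norm (M x - M x) * norm (H x)) (at x)"
      by (intro tendsto_intros contM)
    then show "((\<lambda>y. 2 * norm (H x) * norm (M y - M x) * norm (H x)) \<longlongrightarrow> 0) (at x)" by simp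
  qed
  have bl: "bounded_linear M'" using M by (rule has_derivative_bounded_linear)
  define N where "N y = inverse (norm (y - x)) *\<^sub>R (M y - M x - M' (y - x))" for y
  have N: "(N \<longlongrightarrow> 0) (at x)"
    using M unfolding N_def[abs_def] has_derivative_at_within by (simp add: inverse_eq_divide)
  obtain C where C: "\<And>v. norm (M' v) \<le> norm v * C" using bl bounded_linear.bounded by blast
  show ?thesis
    unfolding has_derivative_at_within
  proof (intro conjI)
    show "bounded_linear (\<lambda>v. - (H x o\<^sub>L M' v o\<^sub>L H x))"
      by (intro bounded_linear_minus bounded_linear_compose[OF c.bounded_linear_left]
           bounded_linear_compose[OF c.bounded_linear_right] bl)
    have eq: "(H y - H x - - (H x o\<^sub>L M' (y - x) o\<^sub>L H x)) /\<^sub>R norm (y - x)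
       = - (H y o\<^sub>L N y o\<^sub>L H x) - ((H y - H x) o\<^sub>L (inverse (norm (y - x)) *\<^sub>R M' (y - x)) o\<^sub>L H x)" for y
    proof -
      have "H y - H x - - (H x o\<^sub>L M' (y - x) o\<^sub>L H x)
        = - (H y o\<^sub>L (M y - M x - M' (y - x)) o\<^sub>L H x) - ((H y - H x) o\<^sub>L M' (y - x) o\<^sub>L H x)"
        using diff[of y] by (simp add: c.add_left c.add_right c.diff_left c.diff_right algebra_simps)
      then show ?thesis
        unfolding N_def c.scaleR_left c.scaleR_right
        by (simp only: scaleR_diff_right scaleR_minus_right)
    qed
    have A: "((\<lambda>y. - (H y o\<^sub>L N y o\<^sub>L H x)) \<longlongrightarrow> 0) (at x)"
    proof -
      have "((\<lambda>y. - (H y o\<^sub>L N y o\<^sub>L H x)) \<longlongrightarrow> - (H x o\<^sub>L 0 o\<^sub>L H x)) (at x)"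
        by (intro tendsto_intros contH N c.tendsto)
      then show ?thesis by simp
    qed
    have B: "((\<lambda>y. (H y - H x) o\<^sub>L (inverse (norm (y - x)) *\<^sub>R M' (y - x)) o\<^sub>L H x) \<longlongrightarrow> 0) (at x)"
    proof (rule Lim_null_comparison)
      show "\<forall>\<^sub>F y in at x. norm ((H y - H x) o\<^sub>L (inverse (norm (y - x)) *\<^sub>R M' (y - x)) o\<^sub>L H x)
          \<le> norm (H y - H x) * \<bar>C\<bar> * norm (H x)"
      proof (rule always_eventually, rule allI)
        fix y
        have "norm (inverse (norm (y - x)) *\<^sub>R M' (y - x)) \<le> \<bar>C\<bar>"
        proof (cases "y = x")
          case False
          have "norm (M' (y - x)) \<le> norm (y - x) * \<bar>C\<bar>"
            using C[of "y - x"] by (meson abs_ge_self mult_left_mono norm_ge_zero order_trans)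
          then show ?thesis using False by (simp add: field_simps)
        qed (use linear_0[OF bounded_linear.linear[OF bl]] in simp)
        then show "norm ((H y - H x) o\<^sub>L (inverse (norm (y - x)) *\<^sub>R M' (y - x)) o\<^sub>L H x)
          \<le> norm (H y - H x) * \<bar>C\<bar> * norm (H x)"
          by (meson mult_left_mono mult_right_mono norm_blinfun_compose norm_ge_zero order_trans)
      qed
      have "((\<lambda>y. norm (H y - H x) * \<bar>C\<bar> * norm (H x)) \<longlongrightarrow> norm (H x - H x) * \<bar>C\<bar> * norm (H x)) (at x)"
        by (intro tendsto_intros contH)
      then show "((\<lambda>y. norm (H y - H x) * \<bar>C\<bar> * norm (H x)) \<longlongrightarrow> 0) (at x)" by simp
    qed
    show "((\<lambda>y. (H y - H x - - (H x o\<^sub>L M' (y - x) o\<^sub>L H x)) /\<^sub>R norm (y - x)) \<longlongrightarrow> 0) (at x)"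
      unfolding eq using tendsto_diff[OF A B] by simp
  qed
qed

text \<open>The inverse function theorem for a globally injective map; openness of the image is
  invariance of domain, and the derivative of the inverse is \<open>H \<circ> inv \<Phi>\<close> where \<open>H y\<close> is the inverse
  of the derivative at \<open>y\<close>.\<close>

lemma inverse_of_injective_C2_map:
  fixes \<Phi> :: "'a::euclidean_space \<Rightarrow> 'a"
  assumes C2: "C2_on UNIV \<Phi>" and inj: "inj \<Phi>"
    and D: "\<And>y. (\<Phi> has_derivative D y) (at y)"
    and D0: "\<And>y v. D y v = 0 \<Longrightarrow> v = 0"
  obtains H where "open (range \<Phi>)" "C2_on (range \<Phi>) (inv \<Phi>)"
    "\<And>y. (inv \<Phi> has_derivative H y) (at (\<Phi> y))" "\<And>y v. D y (H y v) = v"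
proof -
  obtain D' E where D': "\<And>y. y \<in> UNIV \<Longrightarrow> (\<Phi> has_derivative blinfun_apply (D' y)) (at y)"
    and E: "\<And>y. y \<in> UNIV \<Longrightarrow> (D' has_derivative blinfun_apply (E y)) (at y)"
    and cE: "continuous_on UNIV E" and c\<Phi>: "continuous_on UNIV \<Phi>" and cD: "continuous_on UNIV D'"
    by (rule C2_onE[OF C2]) blast
  have eq: "blinfun_apply (D' y) = D y" for y
    using has_derivative_unique[OF D' D] by simp
  have "\<exists>h. linear h \<and> (\<forall>x. h (D y x) = x) \<and> (\<forall>x. D y (h x) = x)" for y
  proof (rule linear_injective_isomorphism)
    show lin: "linear (D y)" using D has_derivative_linear by blast
    show "inj (D y)" using D0 linear_injective_0[OF lin] by blast
  qed simp
  then obtain h where h: "\<And>y. linear (h y)" "\<And>y x. h y (D y x) = x" "\<And>y x. D y (h y x) = x"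
    by metis
  define H where "H y = Blinfun (h y)" for y
  have H: "blinfun_apply (H y) = h y" for y
    using h(1) by (simp add: H_def bounded_linear_Blinfun_apply linear_conv_bounded_linear)
  have op: "open (range \<Phi>)"
    using invariance_of_domain[OF c\<Phi> _ inj] by simp
  have G: "(inv \<Phi> has_derivative h y) (at (\<Phi> y))" for y
    by (rule has_derivative_inverse_on[where S = UNIV and f = \<Phi> and f' = D and g = "inv \<Phi>" and g' = h])
      (use inj D h(3) in \<open>auto simp: fun_eq_iff\<close>)
  interpret c: bounded_bilinear "(o\<^sub>L) :: 'a \<Rightarrow>\<^sub>L 'a \<Rightarrow> 'a \<Rightarrow>\<^sub>L 'a \<Rightarrow> 'a \<Rightarrow>\<^sub>L 'a"
    by (rule bounded_bilinear_blinfun_compose)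
  define E2 where "E2 y = - (c.prod_left (H y) o\<^sub>L (c.prod_right (H y) o\<^sub>L E y))" for y
  have E2: "blinfun_apply (E2 y) = (\<lambda>v. - (H y o\<^sub>L E y v o\<^sub>L H y))" for y
    by (simp add: fun_eq_iff E2_def uminus_blinfun.rep_eq c.prod_left.rep_eq c.prod_right.rep_eq)
  have dH: "(H has_derivative blinfun_apply (E2 y)) (at y)" for y
    unfolding E2
    by (rule has_derivative_blinfun_inverse[of H D'])
      (auto intro!: blinfun_eqI E simp: H eq h)
  have cH: "continuous_on UNIV H"
    by (intro continuous_at_imp_continuous_on ballI has_derivative_continuous[OF dH])
  have cE2: "continuous_on UNIV E2"
    unfolding E2_def[abs_def] by (intro continuous_intros cE cH)
  have cG: "continuous_on (range \<Phi>) (inv \<Phi>)"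
    by (intro continuous_at_imp_continuous_on) (auto intro: has_derivative_continuous[OF G])
  have "C2_on (range \<Phi>) (inv \<Phi>)"
  proof (rule C2_onI[where D = "\<lambda>x. H (inv \<Phi> x)" and E = "\<lambda>x. E2 (inv \<Phi> x) o\<^sub>L H (inv \<Phi> x)"])
    fix x assume "x \<in> range \<Phi>"
    then obtain y where y: "x = \<Phi> y" "inv \<Phi> x = y" using inj by auto
    show "(inv \<Phi> has_derivative blinfun_apply (H (inv \<Phi> x))) (at x within range \<Phi>)"
      using G[of y] unfolding y(2) H by (simp add: y(1) has_derivative_at_withinI)
    show "((\<lambda>x. H (inv \<Phi> x)) has_derivative blinfun_apply (E2 (inv \<Phi> x) o\<^sub>L H (inv \<Phi> x)))
        (at x within range \<Phi>)"
    proof (rule has_derivative_at_withinI)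
      show "((\<lambda>x. H (inv \<Phi> x)) has_derivative blinfun_apply (E2 (inv \<Phi> x) o\<^sub>L H (inv \<Phi> x))) (at x)"
        using diff_chain_at[OF G[of y], of H "blinfun_apply (E2 y)"] dH[of y] inj
        by (simp add: y o_def blinfun_compose.rep_eq H)
    qed
  next
    have "continuous_on (range \<Phi>) (\<lambda>x. H (inv \<Phi> x))" "continuous_on (range \<Phi>) (\<lambda>x. E2 (inv \<Phi> x))"
      by (auto intro!: continuous_on_compose2[OF cH cG] continuous_on_compose2[OF cE2 cG])
    then show "continuous_on (range \<Phi>) (\<lambda>x. E2 (inv \<Phi> x) o\<^sub>L H (inv \<Phi> x))"
      by (intro continuous_intros)
  qed
  with op G h(3) that show ?thesis by blast
qed

section \<open>The level set and its tangent spaces\<close>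

lemma has_derivative_vecI:
  fixes f :: "'a::real_normed_vector \<Rightarrow> 'b::euclidean_space ^ 'n"
  assumes "\<And>i. ((\<lambda>x. f x $ i) has_derivative (\<lambda>h. f' h $ i)) (at a within S)"
  shows "(f has_derivative f') (at a within S)"
proof -
  have "((\<lambda>x. f x \<bullet> b) has_derivative (\<lambda>h. f' h \<bullet> b)) (at a within S)" if "b \<in> Basis" for b
  proof -
    from that obtain i c where b: "b = axis i c" by (auto simp: Basis_vec_def)
    show ?thesis unfolding b inner_axis by (intro derivative_intros assms)
  qed
  then show ?thesis by (subst has_derivative_componentwise_within) auto
qed

lemma has_vector_derivative_vecI:
  fixes f :: "real \<Rightarrow> 'b::euclidean_space ^ 'n"
  assumes "\<And>i. ((\<lambda>x. f x $ i) has_vector_derivative f' $ i) (at a within S)"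
  shows "(f has_vector_derivative f') (at a within S)"
  using assms unfolding has_vector_derivative_def by (intro has_derivative_vecI) simp

lemma A_map_apply:
  fixes u :: "'n::finite \<Rightarrow> 'g::euclidean_space"
  shows "blinfun_apply (A_map u) t = (\<Sum>j\<in>UNIV. t $ j *\<^sub>R u j)"
proof -
  have "bounded_linear (\<lambda>t :: real^'n. \<Sum>j\<in>UNIV. t $ j *\<^sub>R u j)"
    by (intro bounded_linear_sum bounded_linear_scaleR_const bounded_linear_vec_nth)
  then show ?thesis by (simp add: A_map_def bounded_linear_Blinfun_apply)
qed

lemma lam_vec_apply: "blinfun_apply (lam_vec lam) t = (\<Sum>j\<in>UNIV. lam j * t $ j)"
  by (simp add: lam_vec_def dual_basis_def blinfun.sum_left blinfun.scaleR_left
      bounded_linear_Blinfun_apply bounded_linear_vec_nth)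

lemma phi_apply: "blinfun_apply (phi z) t = (\<Sum>j\<in>UNIV. (cmod (z $ j))\<^sup>2 * t $ j)"
  by (simp add: phi_def dual_basis_def blinfun.sum_left blinfun.scaleR_left
      bounded_linear_Blinfun_apply bounded_linear_vec_nth)

lemma subspace_lie_k: "subspace (lie_k u)"
  by (auto simp: subspace_def lie_k_def blinfun.bilinear_simps)

lemma level_set_iff:
  "z \<in> level_set u lam \<longleftrightarrow> (\<forall>t\<in>lie_k u. (\<Sum>j\<in>UNIV. ((cmod (z $ j))\<^sup>2 + lam j) * t $ j) = 0)"
proof -
  have "z \<in> level_set u lam \<longleftrightarrow> (\<forall>t\<in>lie_k u. blinfun_apply (phi z) t = blinfun_apply (- lam_vec lam) t)"
    unfolding level_set_def B_dual_def by (auto simp: restrict_def fun_eq_iff)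
  also have "\<dots> \<longleftrightarrow> (\<forall>t\<in>lie_k u. (\<Sum>j\<in>UNIV. ((cmod (z $ j))\<^sup>2 + lam j) * t $ j) = 0)"
    by (simp only: phi_apply lam_vec_apply uminus_blinfun.rep_eq distrib_right sum.distrib eq_neg_iff_add_eq_0)
  finally show ?thesis .
qed

text \<open>On the stratum of \<open>I\<close> only the coordinates outside \<open>I\<close> are visible, and there \<open>K\<close> acts through
  \<open>K/(K \<inter> \<T>\<^sub>I)\<close>.  Adding the whole Lie algebra of \<open>\<T>\<^sub>I\<close> to \<open>\<kk>\<close> changes none of the conditions
  below and makes them conditions on a subspace of \<open>\<real>\<^sup>N\<close> that contains \<open>\<real>\<^sup>I\<close>.\<close>

definition lie_kI :: "('n::finite \<Rightarrow> 'g::euclidean_space) \<Rightarrow> 'n set \<Rightarrow> (real^'n) set" where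
  "lie_kI u I = {t. \<exists>t'\<in>lie_k u. \<forall>j. j \<notin> I \<longrightarrow> t $ j = t' $ j}"

lemma subspace_lie_kI: "subspace (lie_kI u I)"
  unfolding subspace_def
proof (intro conjI ballI allI)
  show "0 \<in> lie_kI u I"
    using subspace_0[OF subspace_lie_k[of u]] by (auto simp: lie_kI_def intro!: bexI[of _ 0])
  fix x y assume "x \<in> lie_kI u I" "y \<in> lie_kI u I"
  then obtain x' y' where "x' \<in> lie_k u" "y' \<in> lie_k u" "\<forall>j. j \<notin> I \<longrightarrow> x $ j = x' $ j" "\<forall>j. j \<notin> I \<longrightarrow> y $ j = y' $ j"
    by (auto simp: lie_kI_def)
  then show "x + y \<in> lie_kI u I"
    by (auto simp: lie_kI_def intro!: bexI[of _ "x' + y'"] subspace_add[OF subspace_lie_k])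
next
  fix c x assume "x \<in> lie_kI u I"
  then obtain x' where "x' \<in> lie_k u" "\<forall>j. j \<notin> I \<longrightarrow> x $ j = x' $ j" by (auto simp: lie_kI_def)
  then show "c *\<^sub>R x \<in> lie_kI u I"
    by (auto simp: lie_kI_def intro!: bexI[of _ "c *\<^sub>R x'"] subspace_scale[OF subspace_lie_k])
qed

lemma lie_k_subset_lie_kI: "t \<in> lie_k u \<Longrightarrow> t \<in> lie_kI u I"
  by (auto simp: lie_kI_def)

lemma axis_in_lie_kI: "j \<in> I \<Longrightarrow> axis j c \<in> lie_kI u I"
  using subspace_0[OF subspace_lie_k[of u]] by (auto simp: lie_kI_def axis_def intro!: bexI[of _ 0])

lemma ball_lie_kI_iff:
  assumes "\<And>j. j \<in> I \<Longrightarrow> c j = (0::real)"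
  shows "(\<forall>t\<in>lie_kI u I. (\<Sum>j\<in>UNIV. c j * t $ j) = 0) \<longleftrightarrow> (\<forall>t\<in>lie_k u. (\<Sum>j\<in>UNIV. c j * t $ j) = 0)"
proof (intro iffI ballI)
  fix t assume "\<forall>t\<in>lie_k u. (\<Sum>j\<in>UNIV. c j * t $ j) = 0" "t \<in> lie_kI u I"
  then obtain t' where t': "(\<Sum>j\<in>UNIV. c j * t' $ j) = 0" "\<forall>j. j \<notin> I \<longrightarrow> t $ j = t' $ j"
    by (auto simp: lie_kI_def)
  have "(\<Sum>j\<in>UNIV. c j * t $ j) = (\<Sum>j\<in>UNIV. c j * t' $ j)"
    using t'(2) assms by (intro sum.cong refl) (metis mult_zero_left)
  with t'(1) show "(\<Sum>j\<in>UNIV. c j * t $ j) = 0" by simp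
qed (auto simp: lie_k_subset_lie_kI)

lemma Z_face_iff:
  assumes "\<forall>j\<in>I. lam j = 0"
  shows "z \<in> Z_face u lam I \<longleftrightarrow>
    (\<forall>j. z $ j = 0 \<longleftrightarrow> j \<in> I) \<and> (\<forall>t\<in>lie_kI u I. (\<Sum>j\<in>UNIV. ((cmod (z $ j))\<^sup>2 + lam j) * t $ j) = 0)"
proof (cases "\<forall>j. z $ j = 0 \<longleftrightarrow> j \<in> I")
  case True
  show ?thesis
    using True assms
    by (simp add: Z_face_def stratum_def level_set_iff)
      (rule ball_lie_kI_iff[symmetric]; simp add: assms)
qed (auto simp: Z_face_def stratum_def)

lemma vertical_space_iff:
  assumes "\<forall>j\<in>I. z $ j = 0"
  shows "y \<in> vertical_space u z \<longleftrightarrow> (\<exists>t\<in>lie_kI u I. \<forall>j. y $ j = \<i> * of_real (t $ j) * z $ j)"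
proof
  assume "y \<in> vertical_space u z"
  then obtain t where t: "t \<in> lie_k u" "y = (\<chi> j. 2 * complex_of_real pi * \<i> * complex_of_real (t $ j) * z $ j)"
    by (auto simp: vertical_space_def)
  then show "\<exists>t\<in>lie_kI u I. \<forall>j. y $ j = \<i> * of_real (t $ j) * z $ j"
    by (intro bexI[of _ "(2 * pi) *\<^sub>R t"]) (auto intro!: lie_k_subset_lie_kI subspace_scale[OF subspace_lie_k])
next
  assume "\<exists>t\<in>lie_kI u I. \<forall>j. y $ j = \<i> * of_real (t $ j) * z $ j"
  then obtain t t' where t: "\<forall>j. y $ j = \<i> * of_real (t $ j) * z $ j" "t' \<in> lie_k u" "\<forall>j. j \<notin> I \<longrightarrow> t $ j = t' $ j"
    by (auto simp: lie_kI_def)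
  have "y $ j = 2 * complex_of_real pi * \<i> * complex_of_real (((1 / (2 * pi)) *\<^sub>R t') $ j) * z $ j" for j
    using t assms by (cases "j \<in> I") auto
  then have "y = (\<chi> j. 2 * complex_of_real pi * \<i> * complex_of_real (((1 / (2 * pi)) *\<^sub>R t') $ j) * z $ j)"
    by (simp add: vec_eq_iff)
  moreover have "(1 / (2 * pi)) *\<^sub>R t' \<in> lie_k u"
    using t by (intro subspace_scale[OF subspace_lie_k])
  ultimately show "y \<in> vertical_space u z" unfolding vertical_space_def by blast
qed

lemma subspace_vertical_space:
  fixes z :: "complex^'n::finite"
  shows "subspace (vertical_space u z)"
proof -
  have "linear (\<lambda>t :: real^'n. \<chi> j. 2 * complex_of_real pi * \<i> * complex_of_real (t $ j) * z $ j)"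
    by (rule linearI) (simp_all add: vec_eq_iff algebra_simps complex_eq_iff)
  then show ?thesis unfolding vertical_space_def
    using subspace_lie_k by (rule linear_subspace_image)
qed

lemma tangent_Z_face_subset:
  assumes lam: "\<forall>j\<in>I. lam j = 0" and v: "v \<in> tangent_space (Z_face u lam I) z"
  shows "(\<forall>j\<in>I. v $ j = 0) \<and> (\<forall>t\<in>lie_kI u I. (\<Sum>j\<in>UNIV. (z $ j \<bullet> v $ j) * t $ j) = 0)"
proof -
  obtain c where c: "c 0 = z" "\<And>s. c s \<in> Z_face u lam I" "(c has_vector_derivative v) (at 0)"
    using v by (auto simp: tangent_space_def)
  have d: "((\<lambda>s. c s $ j) has_vector_derivative v $ j) (at 0)" for j
    using bounded_linear.has_vector_derivative[OF bounded_linear_vec_nth c(3)] .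
  show ?thesis
  proof (intro conjI ballI)
    fix j assume "j \<in> I"
    then have "c s $ j = 0" for s using c(2)[of s] by (simp add: Z_face_def stratum_def)
    then have "((\<lambda>s. c s $ j) has_vector_derivative 0) (at 0)" by simp
    then show "v $ j = 0" by (rule vector_derivative_unique_at[OF d])
  next
    fix t assume t: "t \<in> lie_kI u I"
    define m where "m s = (\<Sum>j\<in>UNIV. ((c s $ j \<bullet> c s $ j) + lam j) * t $ j)" for s
    have "m s = 0" for s
      using c(2)[of s] t unfolding Z_face_iff[OF lam] m_def by (simp add: power2_norm_eq_inner)
    then have "(m has_vector_derivative 0) (at 0)" by (simp add: ext[of m "\<lambda>_. 0"])
    moreover have "(m has_vector_derivative (\<Sum>j\<in>UNIV. 2 * (z $ j \<bullet> v $ j) * t $ j)) (at 0)"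
    proof -
      have "((\<lambda>s. c s $ j \<bullet> c s $ j) has_real_derivative 2 * (z $ j \<bullet> v $ j)) (at 0)" for j
        using bounded_bilinear.has_vector_derivative[OF bounded_bilinear_inner d[of j] d[of j]]
        by (simp add: c(1) inner_commute has_real_derivative_iff_has_vector_derivative)
      then show ?thesis
        unfolding m_def has_real_derivative_iff_has_vector_derivative[symmetric]
        by (intro DERIV_sum DERIV_cmult_right) (auto intro!: derivative_eq_intros)
    qed
    ultimately have "(\<Sum>j\<in>UNIV. 2 * (z $ j \<bullet> v $ j) * t $ j) = 0"
      using vector_derivative_unique_at by blast
    then show "(\<Sum>j\<in>UNIV. (z $ j \<bullet> v $ j) * t $ j) = 0"
      by (simp add: mult.assoc sum_distrib_left[symmetric])
  qed
qed

text \<open>Conversely, a tangent vector \<open>v\<^sub>j = (\<rho>\<^sub>j + \<i> \<theta>\<^sub>j) z\<^sub>j\<close> is the velocity of a curve along which the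
  moment map is affine.\<close>

lemma tangent_Z_face_supset:
  assumes lam: "\<forall>j\<in>I. lam j = 0" and z: "z \<in> Z_face u lam I"
    and v0: "\<And>j. j \<in> I \<Longrightarrow> v $ j = 0"
    and vk: "\<And>t. t \<in> lie_kI u I \<Longrightarrow> (\<Sum>j\<in>UNIV. (z $ j \<bullet> v $ j) * t $ j) = 0"
  shows "v \<in> tangent_space (Z_face u lam I) z"
proof -
  have z0: "z $ j = 0 \<longleftrightarrow> j \<in> I" for j using z by (simp add: Z_face_iff[OF lam])
  have zm: "(\<Sum>j\<in>UNIV. ((cmod (z $ j))\<^sup>2 + lam j) * t $ j) = 0" if "t \<in> lie_kI u I" for t
    using z that by (simp add: Z_face_iff[OF lam])
  define \<rho> \<theta> where "\<rho> j = Re (v $ j / z $ j)" and "\<theta> j = Im (v $ j / z $ j)" for j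
  have vz: "v $ j = z $ j * Complex (\<rho> j) (\<theta> j)" for j
    using z0 v0 by (cases "j \<in> I") (auto simp: \<rho>_def \<theta>_def complex_eq_iff)
  have inner: "z $ j \<bullet> v $ j = (cmod (z $ j))\<^sup>2 * \<rho> j" for j
    unfolding vz cmod_power2 by (simp add: inner_complex_def algebra_simps power2_eq_square)
  \<comment> \<open>small enough for \<open>1 + 2 s \<rho>\<^sub>j\<close> to be positive when \<open>|s| < \<delta>\<close>\<close>
  define \<delta> where "\<delta> = 1 / (1 + 2 * (\<Sum>j\<in>UNIV. \<bar>\<rho> j\<bar>))"
  have sum0: "0 \<le> (\<Sum>j\<in>UNIV. \<bar>\<rho> j\<bar>)" by (simp add: sum_nonneg)
  then have \<delta>: "\<delta> > 0" by (simp add: \<delta>_def add_pos_nonneg)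
  have pos: "1 + 2 * s * \<rho> j > 0" if "\<bar>s\<bar> < \<delta>" for s j
  proof -
    have "\<bar>2 * s * \<rho> j\<bar> = 2 * \<bar>s\<bar> * \<bar>\<rho> j\<bar>" by (simp add: abs_mult)
    also have "\<dots> \<le> \<bar>s\<bar> * (2 * (\<Sum>j\<in>UNIV. \<bar>\<rho> j\<bar>))"
      using member_le_sum[of j UNIV "\<lambda>j. \<bar>\<rho> j\<bar>"] by (simp add: mult_left_mono)
    also have "\<dots> \<le> \<bar>s\<bar> * (1 + 2 * (\<Sum>j\<in>UNIV. \<bar>\<rho> j\<bar>))" by (simp add: mult_left_mono)
    also have "\<dots> < 1" using that sum0 by (simp add: \<delta>_def field_simps)
    finally show ?thesis by linarith
  qed
  define c where "c s = (\<chi> j. z $ j * (of_real (sqrt (1 + 2 * s * \<rho> j)) * cis (s * \<theta> j)))" for s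
  define c' where "c' s = (if \<bar>s\<bar> < \<delta> then c s else z)" for s
  have norm: "(cmod (c s $ j))\<^sup>2 = (cmod (z $ j))\<^sup>2 * (1 + 2 * s * \<rho> j)" if "\<bar>s\<bar> < \<delta>" for s j
    using pos[OF that, of j] by (simp add: c_def norm_mult power_mult_distrib)
  have in_Z: "c s \<in> Z_face u lam I" if s: "\<bar>s\<bar> < \<delta>" for s
    unfolding Z_face_iff[OF lam]
  proof (intro conjI allI ballI)
    show "c s $ j = 0 \<longleftrightarrow> j \<in> I" for j
      using norm[OF s, of j] pos[OF s, of j] z0[of j] by (metis mult_eq_0_iff norm_eq_zero order_less_irrefl power_eq_0_iff zero_neq_numeral pos2)
    fix t assume t: "t \<in> lie_kI u I"
    have "(\<Sum>j\<in>UNIV. ((cmod (c s $ j))\<^sup>2 + lam j) * t $ j)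
      = (\<Sum>j\<in>UNIV. ((cmod (z $ j))\<^sup>2 + lam j) * t $ j) + 2 * s * (\<Sum>j\<in>UNIV. (z $ j \<bullet> v $ j) * t $ j)"
      unfolding sum_distrib_left sum.distrib[symmetric]
      by (intro sum.cong refl) (simp add: norm[OF s] inner algebra_simps)
    then show "(\<Sum>j\<in>UNIV. ((cmod (c s $ j))\<^sup>2 + lam j) * t $ j) = 0"
      using zm[OF t] vk[OF t] by simp
  qed
  have "(c has_vector_derivative v) (at 0)"
  proof (rule has_vector_derivative_vecI)
    fix j
    have r: "((\<lambda>s. sqrt (1 + 2 * s * \<rho> j)) has_real_derivative \<rho> j) (at 0)"
      by (auto intro!: derivative_eq_intros)
    have r': "((\<lambda>s. complex_of_real (sqrt (1 + 2 * s * \<rho> j))) has_vector_derivative of_real (\<rho> j)) (at 0)"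
      using has_vector_derivative_of_real[OF r] .
    have e: "((\<lambda>s. cis (s * \<theta> j)) has_vector_derivative \<i> * of_real (\<theta> j)) (at 0)"
    proof -
      have "((\<lambda>s. s * \<theta> j) has_derivative (\<lambda>s. s * \<theta> j)) (at 0)"
        by (auto intro!: derivative_eq_intros)
      from has_derivative_cis[OF this]
      show ?thesis unfolding has_vector_derivative_def
        by (rule has_derivative_eq_rhs) (auto simp: fun_eq_iff scaleR_conv_of_real)
    qed
    show "((\<lambda>s. c s $ j) has_vector_derivative v $ j) (at 0)"
      using has_vector_derivative_mult_right[OF has_vector_derivative_mult[OF r' e], of "z $ j"]
      by (simp add: c_def vz Complex_eq add.commute)
  qed
  then have "(c' has_vector_derivative v) (at 0)"
    by (rule has_vector_derivative_transform_within_open[of _ _ _ "{-\<delta><..<\<delta>}"])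
      (use \<delta> in \<open>auto simp: c'_def\<close>)
  moreover have "c' s \<in> Z_face u lam I" for s using in_Z z by (simp add: c'_def)
  moreover have "c' 0 = z" by (simp add: c'_def c_def vec_eq_iff)
  ultimately show ?thesis unfolding tangent_space_def by blast
qed

lemma tangent_Z_face_iff:
  assumes "\<forall>j\<in>I. lam j = 0" "z \<in> Z_face u lam I"
  shows "v \<in> tangent_space (Z_face u lam I) z \<longleftrightarrow>
    (\<forall>j\<in>I. v $ j = 0) \<and> (\<forall>t\<in>lie_kI u I. (\<Sum>j\<in>UNIV. (z $ j \<bullet> v $ j) * t $ j) = 0)"
proof
  assume "v \<in> tangent_space (Z_face u lam I) z"
  then show "(\<forall>j\<in>I. v $ j = 0) \<and> (\<forall>t\<in>lie_kI u I. (\<Sum>j\<in>UNIV. (z $ j \<bullet> v $ j) * t $ j) = 0)"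
    by (rule tangent_Z_face_subset[rotated]) (rule assms)
qed (use assms in \<open>auto intro!: tangent_Z_face_supset\<close>)

section \<open>The group and the reduced Kaehler structure\<close>

lemma full_lattice_subgroup:
  assumes "full_lattice L"
  shows "0 \<in> L" "x \<in> L \<Longrightarrow> y \<in> L \<Longrightarrow> x + y \<in> L" "x \<in> L \<Longrightarrow> - x \<in> L"
proof -
  obtain b where L: "L = range (\<lambda>c :: 'a \<Rightarrow> int. \<Sum>v\<in>b. real_of_int (c v) *\<^sub>R v)"
    using assms by (auto simp: full_lattice_def)
  show "0 \<in> L" unfolding L by (rule range_eqI[of _ _ "\<lambda>_. 0"]) simp
  show "- x \<in> L" if "x \<in> L"
  proof -
    from that obtain c where "x = (\<Sum>v\<in>b. real_of_int (c v) *\<^sub>R v)" by (auto simp: L)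
    then show ?thesis unfolding L
      by (intro range_eqI[of _ _ "\<lambda>v. - c v"]) (simp add: sum_negf)
  qed
  show "x + y \<in> L" if "x \<in> L" "y \<in> L"
  proof -
    from that obtain c d where "x = (\<Sum>v\<in>b. real_of_int (c v) *\<^sub>R v)" "y = (\<Sum>v\<in>b. real_of_int (d v) *\<^sub>R v)"
      by (auto simp: L)
    then show ?thesis unfolding L
      by (intro range_eqI[of _ _ "\<lambda>v. c v + d v"]) (simp add: scaleR_left_distrib sum.distrib)
  qed
qed

lemma act_nth [simp]: "act a z $ j = a $ j * z $ j"
  by (simp add: act_def)

lemma act_act: "act a (act b z) = act (act a b) z"
  by (simp add: vec_eq_iff)

lemma act_add: "act a (v + w) = act a v + act a w"
  by (simp add: vec_eq_iff distrib_left)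

lemma act_diff: "act a (v - w) = act a v - act a w"
  by (simp add: vec_eq_iff algebra_simps)

lemma group_K_norm: "a \<in> group_K L u \<Longrightarrow> cmod (a $ j) = 1"
  by (auto simp: group_K_def torus_exp_def)

lemma one_in_group_K:
  assumes "full_lattice L"
  shows "1 \<in> group_K L u"
  unfolding group_K_def
  by (rule image_eqI[of _ _ 0])
    (auto simp: torus_exp_def vec_eq_iff blinfun.bilinear_simps full_lattice_subgroup[OF assms])

lemma act_one [simp]: "act 1 z = z"
  by (simp add: vec_eq_iff)

lemma act_in_group_K:
  assumes L: "full_lattice L" and "a \<in> group_K L u" "b \<in> group_K L u"
  shows "act a b \<in> group_K L u"
proof -
  from assms obtain s t where st: "a = torus_exp s" "b = torus_exp t" "A_map u s \<in> L" "A_map u t \<in> L"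
    by (auto simp: group_K_def)
  show ?thesis unfolding group_K_def
    by (rule image_eqI[of _ _ "s + t"])
      (auto simp: st torus_exp_def vec_eq_iff cis_mult distrib_left blinfun.bilinear_simps
        intro!: full_lattice_subgroup[OF L])
qed

lemma group_K_inverse:
  assumes L: "full_lattice L" and "a \<in> group_K L u"
  obtains b where "b \<in> group_K L u" "act b a = 1"
proof -
  from assms obtain s where s: "a = torus_exp s" "A_map u s \<in> L"
    by (auto simp: group_K_def)
  have "torus_exp (- s) \<in> group_K L u" unfolding group_K_def
    by (rule imageI) (auto simp: s blinfun.bilinear_simps intro!: full_lattice_subgroup[OF L])
  moreover have "act (torus_exp (- s)) a = 1"
    by (simp add: s torus_exp_def vec_eq_iff cis_mult)
  ultimately show ?thesis using that by blast
qed

lemma mem_K_orbit_self: "full_lattice L \<Longrightarrow> z \<in> K_orbit L u z"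
  unfolding K_orbit_def by (rule image_eqI[OF _ one_in_group_K]) simp_all

lemma act_Z_face:
  assumes "a \<in> group_K L u" "\<forall>j\<in>I. lam j = 0" "z \<in> Z_face u lam I"
  shows "act a z \<in> Z_face u lam I"
proof -
  have n: "cmod (a $ j) = 1" for j using assms(1) by (rule group_K_norm)
  then have "a $ j \<noteq> 0" for j by (metis norm_zero zero_neq_one)
  with n assms(3) show ?thesis
    by (simp add: Z_face_iff[OF assms(2)] norm_mult)
qed

lemma inner_mult_unit: "cmod a = 1 \<Longrightarrow> (a * x) \<bullet> (a * y) = x \<bullet> y"
proof -
  assume a: "cmod a = 1"
  have "(a * x) \<bullet> (a * y) = Re (cnj (a * x) * (a * y))"
    by (simp add: inner_complex_def algebra_simps)
  also have "cnj (a * x) * (a * y) = (a * cnj a) * (cnj x * y)" by (simp add: algebra_simps)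
  also have "\<dots> = cnj x * y" using a by (simp add: complex_norm_square[symmetric])
  also have "Re (cnj x * y) = x \<bullet> y" by (simp add: inner_complex_def)
  finally show ?thesis .
qed

lemma act_tangent:
  assumes "a \<in> group_K L u" "\<forall>j\<in>I. lam j = 0" "z \<in> Z_face u lam I"
    and "v \<in> tangent_space (Z_face u lam I) z"
  shows "act a v \<in> tangent_space (Z_face u lam I) (act a z)"
  using assms(4)
  by (simp add: tangent_Z_face_iff[OF assms(2,3)] tangent_Z_face_iff[OF assms(2) act_Z_face[OF assms(1-3)]]
      inner_mult_unit[OF group_K_norm[OF assms(1)]])

lemma act_vertical: "y \<in> vertical_space u z \<Longrightarrow> act a y \<in> vertical_space u (act a z)"
  by (auto simp: vertical_space_def vec_eq_iff intro!: bexI)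

lemma vertical_vanishes: "y \<in> vertical_space u z \<Longrightarrow> z $ j = 0 \<Longrightarrow> y $ j = 0"
  by (auto simp: vertical_space_def)

text \<open>\<open>K\<close> need not act freely on a stratum, but the stabilizer of a point acts trivially on the vectors
  tangent to the stratum.\<close>

lemma act_stabilizer:
  assumes "\<forall>j. z $ j = 0 \<longrightarrow> v $ j = 0" "act a z = act b z"
  shows "act a v = act b v"
  unfolding vec_eq_iff
proof
  fix j show "act a v $ j = act b v $ j"
    using spec[OF assms(1), of j] arg_cong[OF assms(2), of "\<lambda>x. x $ j"] by auto
qed

lemma mem_dproj_iff:
  "(z', v') \<in> dproj L u z v \<longleftrightarrow>
    (\<exists>a\<in>group_K L u. z' = act a z \<and> v' - act a v \<in> vertical_space u z')"
  unfolding dproj_def by (auto simp: algebra_simps) (metis add_diff_cancel_left' diff_add_cancel add.commute)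

text \<open>Two representatives of a tangent vector of the quotient define the same set, because \<open>K\<close> is a group
  and acts compatibly on the spaces of vertical vectors.\<close>

lemma dproj_eqI:
  assumes L: "full_lattice L" and "(z', v') \<in> dproj L u z v"
  shows "dproj L u z' v' = dproj L u z v"
proof -
  have sub: "dproj L u z' v' \<subseteq> dproj L u z v" if in_dproj: "(z', v') \<in> dproj L u z v" for z v z' v'
  proof
    fix p assume p: "p \<in> dproj L u z' v'"
    obtain x w where pxw: "p = (x, w)" by (cases p)
    obtain a where a: "a \<in> group_K L u" "z' = act a z" "v' - act a v \<in> vertical_space u z'"
      using in_dproj by (auto simp: mem_dproj_iff)
    obtain b where b: "b \<in> group_K L u" "x = act b z'" "w - act b v' \<in> vertical_space u x"
      using p pxw by (auto simp: mem_dproj_iff)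
    have "w - act (act b a) v = (w - act b v') + act b (v' - act a v)"
      by (simp add: act_diff act_act)
    also have "\<dots> \<in> vertical_space u x"
      using b(3) act_vertical[OF a(3), of b] b(2) by (intro subspace_add[OF subspace_vertical_space]) simp_all
    finally show "p \<in> dproj L u z v"
      using a b act_in_group_K[OF L b(1) a(1)] unfolding pxw mem_dproj_iff
      by (auto simp: act_act intro!: bexI[of _ "act b a"])
  qed
  obtain a where a: "a \<in> group_K L u" "z' = act a z" "v' - act a v \<in> vertical_space u z'"
    using assms(2) by (auto simp: mem_dproj_iff)
  obtain b where b: "b \<in> group_K L u" "act b a = 1" using group_K_inverse[OF L a(1)] .
  have "act b z' = z" using b a by (simp add: act_act)
  moreover have "v - act b v' = - act b (v' - act a v)"
    using b by (simp add: act_diff act_act)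
  moreover have "\<dots> \<in> vertical_space u (act b z')"
    by (intro subspace_neg[OF subspace_vertical_space] act_vertical a(3))
  ultimately have "(z, v) \<in> dproj L u z' v'"
    using b(1) by (auto simp: mem_dproj_iff intro!: bexI[of _ b])
  with sub[OF assms(2)] sub[of z v z' v'] show ?thesis by blast
qed

lemma mem_dproj_self: "full_lattice L \<Longrightarrow> (z, v) \<in> dproj L u z v"
  using one_in_group_K[of L u] subspace_0[OF subspace_vertical_space[of u z]]
  by (auto simp: mem_dproj_iff intro!: bexI[of _ 1])

lemma mem_dproj_same_point:
  assumes L: "full_lattice L" and v: "\<forall>j. z $ j = 0 \<longrightarrow> v $ j = 0"
  shows "(z, v') \<in> dproj L u z v \<longleftrightarrow> v' - v \<in> vertical_space u z"
proof
  assume "(z, v') \<in> dproj L u z v"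
  then obtain a where a: "z = act a z" "v' - act a v \<in> vertical_space u z"
    by (auto simp: mem_dproj_iff)
  then show "v' - v \<in> vertical_space u z"
    using act_stabilizer[OF v, of 1 a] by simp
qed (use one_in_group_K[OF L] in \<open>auto simp: mem_dproj_iff intro!: bexI[of _ 1]\<close>)

lemma dproj_eq_iff:
  assumes L: "full_lattice L" and v: "\<forall>j. z $ j = 0 \<longrightarrow> v $ j = 0"
  shows "dproj L u z v' = dproj L u z v \<longleftrightarrow> v' - v \<in> vertical_space u z"
  using dproj_eqI[OF L, of z v' u z v] mem_dproj_self[OF L, of z v' u] mem_dproj_same_point[OF L v, of v' u]
  by auto

lemma flat_form_eq_inner: "flat_form v w = of_real (2 * ((\<i> *s v) \<bullet> w))"
proof -
  have "\<i> * wedge (\<lambda>x. x $ j) (\<lambda>x. cnj (x $ j)) v w = of_real (2 * ((\<i> * v $ j) \<bullet> w $ j))" for j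
    by (simp add: wedge_def inner_complex_def complex_eq_iff)
  then show ?thesis
    unfolding flat_form_def sum_distrib_left inner_vec_def of_real_sum[symmetric] by simp
qed

lemma flat_form_add_left: "flat_form (v + v') w = flat_form v w + flat_form v' w"
  by (simp add: flat_form_eq_inner inner_add_left vector_add_ldistrib)

lemma flat_form_add_right: "flat_form v (w + w') = flat_form v w + flat_form v w'"
  by (simp add: flat_form_eq_inner inner_add_right)

lemma flat_form_commute: "flat_form v w = - flat_form w v"
  by (simp add: flat_form_def wedge_def sum_negf[symmetric] algebra_simps sum_distrib_left)

lemma flat_form_i: "flat_form (\<i> *s v) (\<i> *s w) = flat_form v w"
  by (simp add: flat_form_def wedge_def algebra_simps)

lemma flat_form_act:
  assumes "\<And>j. cmod (a $ j) = 1"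
  shows "flat_form (act a v) (act a w) = flat_form v w"
proof -
  have *: "a $ j * v $ j * (cnj (a $ j) * cnj (w $ j)) = v $ j * cnj (w $ j)" for j v w
  proof -
    have "a $ j * v $ j * (cnj (a $ j) * cnj (w $ j)) = (a $ j * cnj (a $ j)) * (v $ j * cnj (w $ j))" by simp
    then show ?thesis using assms[of j] by (simp add: complex_norm_square[symmetric])
  qed
  show ?thesis by (simp add: flat_form_def wedge_def *)
qed

text \<open>The defining property of the moment map: the tangent space of the level set is
  the symplectic complement of the orbit directions.\<close>

lemma flat_form_vertical:
  assumes lam: "\<forall>j\<in>I. lam j = 0" and z: "z \<in> Z_face u lam I"
    and y: "y \<in> vertical_space u z" and v: "v \<in> tangent_space (Z_face u lam I) z"
  shows "flat_form y v = 0"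
proof -
  have "\<forall>j\<in>I. z $ j = 0" using z by (simp add: Z_face_iff[OF lam])
  then obtain t where t: "t \<in> lie_kI u I" "\<And>j. y $ j = \<i> * of_real (t $ j) * z $ j"
    using y by (auto simp: vertical_space_iff[of I z])
  have "(\<i> *s y) \<bullet> v = - (\<Sum>j\<in>UNIV. (z $ j \<bullet> v $ j) * t $ j)"
    unfolding inner_vec_def sum_negf[symmetric]
    by (intro sum.cong refl) (simp add: t(2) inner_complex_def algebra_simps)
  also have "\<dots> = 0" using v t(1) by (simp add: tangent_Z_face_iff[OF lam z])
  finally show ?thesis by (simp add: flat_form_eq_inner)
qed

lemma vertical_subset_tangent:
  assumes lam: "\<forall>j\<in>I. lam j = 0" and z: "z \<in> Z_face u lam I"
  shows "vertical_space u z \<subseteq> tangent_space (Z_face u lam I) z"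
proof
  fix y assume y: "y \<in> vertical_space u z"
  have z0: "\<forall>j\<in>I. z $ j = 0" using z by (simp add: Z_face_iff[OF lam])
  then obtain t where t: "t \<in> lie_kI u I" "\<And>j. y $ j = \<i> * of_real (t $ j) * z $ j"
    using y by (auto simp: vertical_space_iff[of I z])
  have "z $ j \<bullet> y $ j = 0" for j by (simp add: t(2) inner_complex_def algebra_simps)
  then show "y \<in> tangent_space (Z_face u lam I) z"
    by (simp add: tangent_Z_face_iff[OF lam z] t(2) z0)
qed

lemma subspace_tangent:
  assumes lam: "\<forall>j\<in>I. lam j = 0" and z: "z \<in> Z_face u lam I"
  shows "subspace (tangent_space (Z_face u lam I) z)"
proof -
  have "tangent_space (Z_face u lam I) z =
      {v. (\<forall>j\<in>I. v $ j = 0) \<and> (\<forall>t\<in>lie_kI u I. (\<Sum>j\<in>UNIV. (z $ j \<bullet> v $ j) * t $ j) = 0)}"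
    using tangent_Z_face_iff[OF lam z] by blast
  then show ?thesis
    by (auto simp: subspace_def inner_add_right distrib_right sum.distrib mult.assoc sum_distrib_left[symmetric])
qed

lemma tangent_decomposition:
  assumes lam: "\<forall>j\<in>I. lam j = 0" and z: "z \<in> Z_face u lam I"
    and v: "v \<in> tangent_space (Z_face u lam I) z"
  obtains h y where "h \<in> horizontal_space u lam I z" "y \<in> vertical_space u z" "v = h + y"
proof -
  obtain y h where yh: "y \<in> span (vertical_space u z)" "\<And>w. w \<in> span (vertical_space u z) \<Longrightarrow> orthogonal h w"
    "v = y + h" by (rule orthogonal_subspace_decomp_exists[of "vertical_space u z" v]) auto
  have y: "y \<in> vertical_space u z" using yh(1) span_eq_iff[THEN iffD2, OF subspace_vertical_space[of u z]] by simp
  have "h = v - y" using yh(3) by simp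
  also have "\<dots> \<in> tangent_space (Z_face u lam I) z"
    using v y vertical_subset_tangent[OF lam z] by (intro subspace_diff[OF subspace_tangent[OF lam z]]) auto
  finally have "h \<in> horizontal_space u lam I z"
    using yh(2) span_superset by (fastforce simp: horizontal_space_def orthogonal_def)
  with y yh(3) that show ?thesis by (simp add: add.commute)
qed

text \<open>For vectors along the stratum, tangency is orthogonality to \<open>\<i> V\<close>, and horizontality is orthogonality to \<open>V\<close>; multiplication by \<open>\<i>\<close>
  exchanges the two conditions.\<close>

lemma horizontal_i:
  assumes lam: "\<forall>j\<in>I. lam j = 0" and z: "z \<in> Z_face u lam I"
    and h: "h \<in> horizontal_space u lam I z"
  shows "\<i> *s h \<in> horizontal_space u lam I z"
proof -
  have z0: "\<forall>j\<in>I. z $ j = 0" using z by (simp add: Z_face_iff[OF lam])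
  have hT: "h \<in> tangent_space (Z_face u lam I) z"
    and hV: "\<And>y. y \<in> vertical_space u z \<Longrightarrow> h \<bullet> y = 0"
    using h by (auto simp: horizontal_space_def)
  have "(\<Sum>j\<in>UNIV. (z $ j \<bullet> (\<i> *s h) $ j) * t $ j) = 0" if t: "t \<in> lie_kI u I" for t
  proof -
    define y where "y = (\<chi> j. \<i> * of_real (t $ j) * z $ j)"
    have "y \<in> vertical_space u z" using t z0 by (auto simp: vertical_space_iff[of I z] y_def)
    then have "h \<bullet> y = 0" by (rule hV)
    moreover have "(\<Sum>j\<in>UNIV. (z $ j \<bullet> (\<i> *s h) $ j) * t $ j) = - (h \<bullet> y)"
      unfolding inner_vec_def sum_negf[symmetric]
      by (intro sum.cong refl) (simp add: y_def inner_complex_def algebra_simps)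
    ultimately show ?thesis by simp
  qed
  then have "\<i> *s h \<in> tangent_space (Z_face u lam I) z"
    using hT by (simp add: tangent_Z_face_iff[OF lam z])
  moreover have "(\<i> *s h) \<bullet> y = 0" if y: "y \<in> vertical_space u z" for y
  proof -
    have "flat_form h y = 0" using flat_form_vertical[OF lam z y hT] flat_form_commute[of h y] by simp
    then show ?thesis by (simp add: flat_form_eq_inner)
  qed
  ultimately show ?thesis by (simp add: horizontal_space_def)
qed

lemma vertical_horizontal_zero:
  "h \<in> horizontal_space u lam I z \<Longrightarrow> h \<in> vertical_space u z \<Longrightarrow> h = 0"
  by (auto simp: horizontal_space_def)

lemma act_horizontal:
  assumes a: "a \<in> group_K L u" and L: "full_lattice L" and lam: "\<forall>j\<in>I. lam j = 0" and z: "z \<in> Z_face u lam I"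
    and h: "h \<in> horizontal_space u lam I z"
  shows "act a h \<in> horizontal_space u lam I (act a z)"
  unfolding horizontal_space_def
proof (intro CollectI conjI ballI)
  show "act a h \<in> tangent_space (Z_face u lam I) (act a z)"
    using h by (intro act_tangent[OF a lam z]) (auto simp: horizontal_space_def)
  fix y assume y: "y \<in> vertical_space u (act a z)"
  obtain b where b: "b \<in> group_K L u" "act b a = 1" using group_K_inverse[OF L a] .
  have "act b y \<in> vertical_space u z"
    using act_vertical[OF y, of b] b by (simp add: act_act)
  then have "h \<bullet> act b y = 0" using h by (auto simp: horizontal_space_def)
  moreover have "act a h \<bullet> y = act b (act a h) \<bullet> act b y"
    unfolding inner_vec_def by (intro sum.cong refl) (simp only: act_nth inner_mult_unit[OF group_K_norm[OF b(1)]])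
  ultimately show "act a h \<bullet> y = 0" using b(2) by (simp add: act_act)
qed

lemma tangent_vanishes:
  assumes lam: "\<forall>j\<in>I. lam j = 0" and z: "z \<in> Z_face u lam I"
    and v: "v \<in> tangent_space (Z_face u lam I) z"
  shows "\<forall>j. z $ j = 0 \<longrightarrow> v $ j = 0"
  using v z by (simp add: tangent_Z_face_iff[OF lam z]) (simp add: Z_face_iff[OF lam])

text \<open>The next two lemmas show that the definite descriptions do not depend on the representatives.\<close>

lemma reduced_form_dproj:
  assumes L: "full_lattice L" and lam: "\<forall>j\<in>I. lam j = 0" and z: "z \<in> Z_face u lam I"
    and v: "v \<in> tangent_space (Z_face u lam I) z" and w: "w \<in> tangent_space (Z_face u lam I) z"
  shows "reduced_form (dproj L u z v) (dproj L u z w) = flat_form v w"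
  unfolding reduced_form_def
proof (rule the_equality)
  show "\<exists>z' v' w'. (z', v') \<in> dproj L u z v \<and> (z', w') \<in> dproj L u z w \<and> flat_form v w = flat_form v' w'"
    using mem_dproj_self[OF L] by blast
  fix r assume "\<exists>z' v' w'. (z', v') \<in> dproj L u z v \<and> (z', w') \<in> dproj L u z w \<and> r = flat_form v' w'"
  then obtain z' v' w' a b where *: "r = flat_form v' w'"
    "a \<in> group_K L u" "z' = act a z" "v' - act a v \<in> vertical_space u z'"
    "b \<in> group_K L u" "z' = act b z" "w' - act b w \<in> vertical_space u z'"
    by (auto simp: mem_dproj_iff)
  have ba: "act b w = act a w"
    using *(3,6) by (intro act_stabilizer[OF tangent_vanishes[OF lam z w]]) simp
  have z': "z' \<in> Z_face u lam I" unfolding *(3) by (rule act_Z_face[OF *(2) lam z])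
  have T: "act a v \<in> tangent_space (Z_face u lam I) z'" "act a w \<in> tangent_space (Z_face u lam I) z'"
    unfolding *(3) by (auto intro: act_tangent[OF *(2) lam z] v w)
  have V: "flat_form y x = 0" "flat_form x y = 0"
    if "y \<in> vertical_space u z'" "x \<in> tangent_space (Z_face u lam I) z'" for x y
    using flat_form_vertical[OF lam z' that] flat_form_commute[of x y] by auto
  have "r = flat_form (act a v + (v' - act a v)) (act a w + (w' - act a w))" using * by simp
  also have "\<dots> = flat_form (act a v) (act a w)"
    using V *(4,7) T vertical_subset_tangent[OF lam z'] unfolding flat_form_add_left flat_form_add_right ba
    by (simp add: subset_eq)
  also have "\<dots> = flat_form v w" by (rule flat_form_act) (rule group_K_norm[OF *(2)])
  finally show "r = flat_form v w" .
qed

lemma reduced_J_dproj: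
  assumes L: "full_lattice L" and lam: "\<forall>j\<in>I. lam j = 0" and z: "z \<in> Z_face u lam I"
    and h: "h \<in> horizontal_space u lam I z" and y: "y \<in> vertical_space u z"
  shows "reduced_J L u lam I (dproj L u z (h + y)) = dproj L u z (\<i> *s h)"
  unfolding reduced_J_def
proof (rule the_equality)
  have hT: "h \<in> tangent_space (Z_face u lam I) z" using h by (simp add: horizontal_space_def)
  have "(z, h) \<in> dproj L u z (h + y)"
    using tangent_vanishes[OF lam z hT] vertical_vanishes[OF y] subspace_neg[OF subspace_vertical_space y]
    by (subst mem_dproj_same_point[OF L]) auto
  then show "\<exists>z' h'. (z', h') \<in> dproj L u z (h + y) \<and> h' \<in> horizontal_space u lam I z' \<and>
      dproj L u z (\<i> *s h) = dproj L u z' (\<i> *s h')"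
    using h by blast
  fix Y assume "\<exists>z' h'. (z', h') \<in> dproj L u z (h + y) \<and> h' \<in> horizontal_space u lam I z' \<and>
      Y = dproj L u z' (\<i> *s h')"
  then obtain z' h' a where *: "Y = dproj L u z' (\<i> *s h')" "h' \<in> horizontal_space u lam I z'"
    "a \<in> group_K L u" "z' = act a z" "h' - act a (h + y) \<in> vertical_space u z'"
    by (auto simp: mem_dproj_iff)
  have z': "z' \<in> Z_face u lam I" unfolding *(4) by (rule act_Z_face[OF *(3) lam z])
  have ah: "act a h \<in> horizontal_space u lam I z'"
    unfolding *(4) by (rule act_horizontal[OF *(3) L lam z h])
  have "h' - act a h = (h' - act a (h + y)) + act a y" by (simp add: act_add)
  also have "\<dots> \<in> vertical_space u z'"
    using *(4,5) act_vertical[OF y] by (intro subspace_add[OF subspace_vertical_space]) auto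
  finally have "h' - act a h \<in> vertical_space u z'" .
  moreover have "h' - act a h \<in> horizontal_space u lam I z'"
    using *(2) ah subspace_diff[OF subspace_tangent[OF lam z']]
    by (auto simp: horizontal_space_def inner_diff_left)
  ultimately have "h' = act a h" using vertical_horizontal_zero by fastforce
  then have "\<i> *s h' = act a (\<i> *s h)" by (simp add: vec_eq_iff)
  then have "(z', \<i> *s h') \<in> dproj L u z (\<i> *s h)"
    using *(3,4) subspace_0[OF subspace_vertical_space] by (auto simp: mem_dproj_iff intro!: bexI[of _ a])
  then show "Y = dproj L u z (\<i> *s h)" unfolding *(1) by (rule dproj_eqI[OF L])
qed

lemma quotient_tangentE:
  assumes L: "full_lattice L" and lam: "\<forall>j\<in>I. lam j = 0" and z: "z \<in> Z_face u lam I"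
    and X: "X \<in> quotient_tangent L u lam I (K_orbit L u z)"
  obtains v where "v \<in> tangent_space (Z_face u lam I) z" "X = dproj L u z v"
proof -
  obtain a v where a: "a \<in> group_K L u" and v: "X = dproj L u (act a z) v" "v \<in> tangent_space (Z_face u lam I) (act a z)"
    using X by (auto simp: quotient_tangent_def K_orbit_def)
  obtain b where b: "b \<in> group_K L u" "act b a = 1" using group_K_inverse[OF L a] .
  have z': "act a z \<in> Z_face u lam I" by (rule act_Z_face[OF a lam z])
  have "act b v \<in> tangent_space (Z_face u lam I) (act b (act a z))"
    by (rule act_tangent[OF b(1) lam z' v(2)])
  moreover have "(act b (act a z), act b v) \<in> X"
    unfolding v(1) using b subspace_0[OF subspace_vertical_space] by (auto simp: mem_dproj_iff intro!: bexI[of _ b])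
  ultimately show ?thesis
    using that b(2) dproj_eqI[OF L, of z "act b v" u "act a z" v] v(1) by (simp add: act_act)
qed

section \<open>The moment map on orbits\<close>

lemma sum_axis: "(\<Sum>i\<in>UNIV. c i * axis j (1::real) $ i) = c j"
  by (simp add: axis_def if_distrib cong: if_cong)

text \<open>On the level set the functional \<open>phi z + lam_vec lam\<close> annihilates the kernel of \<open>A\<close>, so that it factors through
  the surjection \<open>A\<close>; the factor is the value of the moment map.\<close>

lemma phi_P_orbit:
  fixes u :: "'n::finite \<Rightarrow> 'g::euclidean_space"
  assumes L: "full_lattice L" and span: "span (range u) = UNIV" and z: "z \<in> level_set u lam"
  shows "blinfun_apply (phi_P u lam (K_orbit L u z)) (u j) = (cmod (z $ j))\<^sup>2 + lam j"
proof -
  have A_axis: "blinfun_apply (A_map u) (axis j 1) = u j" for j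
    by (simp add: A_map_apply axis_def if_distrib[of "\<lambda>c. c *\<^sub>R _"] cong: if_cong)
  have lin: "linear (blinfun_apply (A_map u))" by (rule bounded_linear.linear[OF blinfun.bounded_linear_right])
  have "surj (blinfun_apply (A_map u))"
  proof -
    have "range u \<subseteq> range (blinfun_apply (A_map u))" by (metis A_axis image_subset_iff rangeI)
    moreover have "subspace (range (blinfun_apply (A_map u)))"
      using linear_subspace_image[OF lin subspace_UNIV] .
    ultimately show ?thesis using span span_minimal by blast
  qed
  then obtain R where R: "linear R" "\<And>x. A_map u (R x) = x"
    using linear_surjective_right_inverse[OF lin] by (metis comp_apply id_apply)
  have iota_apply: "blinfun_apply (iota u lam \<eta>) (axis j 1) = \<eta> (u j) - lam j" for \<eta> j
    by (simp add: iota_def A_dual_def blinfun.bilinear_simps A_axis lam_vec_apply sum_axis)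
  have inj: "inj (iota u lam)"
  proof (rule injI)
    fix \<eta> \<eta>' assume "iota u lam \<eta> = iota u lam \<eta>'"
    then have eq: "\<eta> (u j) = \<eta>' (u j)" for j using iota_apply[of \<eta> j] iota_apply[of \<eta>' j] by simp
    have "\<eta> x = \<eta>' x" for x
    proof (rule linear_eq_on_span[where B = "range u"])
      show "linear (blinfun_apply \<eta>)" "linear (blinfun_apply \<eta>')"
        by (auto intro!: bounded_linear.linear[OF blinfun.bounded_linear_right])
    qed (use eq span in auto)
    then show "\<eta> = \<eta>'" by (rule blinfun_eqI)
  qed
  define \<eta> where "\<eta> = Blinfun (\<lambda>x. blinfun_apply (phi z + lam_vec lam) (R x))"
  have \<eta>: "blinfun_apply \<eta> x = blinfun_apply (phi z + lam_vec lam) (R x)" for x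
    unfolding \<eta>_def using R(1)
    by (subst bounded_linear_Blinfun_apply)
      (auto intro!: bounded_linear_compose[OF blinfun.bounded_linear_right] simp: linear_conv_bounded_linear)
  have annihilates: "blinfun_apply (phi z + lam_vec lam) t = 0" if "t \<in> lie_k u" for t
    using z that unfolding level_set_iff
    by (simp add: plus_blinfun.rep_eq phi_apply lam_vec_apply distrib_right sum.distrib)
  have iota: "iota u lam \<eta> = phi z"
  proof (rule blinfun_eqI)
    fix t
    have "t - R (A_map u t) \<in> lie_k u"
      by (simp add: lie_k_def blinfun.bilinear_simps R)
    then have "blinfun_apply (phi z + lam_vec lam) (t - R (A_map u t)) = 0"
      by (rule annihilates)
    then have "blinfun_apply (phi z + lam_vec lam) (R (A_map u t)) = blinfun_apply (phi z + lam_vec lam) t"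
      by (simp add: blinfun.diff_right)
    then show "blinfun_apply (iota u lam \<eta>) t = blinfun_apply (phi z) t"
      by (simp add: iota_def A_dual_def blinfun.bilinear_simps \<eta>)
  qed
  have "phi ` K_orbit L u z = {phi z}"
  proof -
    have "phi (act a z) = phi z" if "a \<in> group_K L u" for a
      by (simp add: phi_def norm_mult group_K_norm[OF that])
    then show ?thesis using mem_K_orbit_self[OF L, of z u] by (auto simp: K_orbit_def)
  qed
  then have "phi_P u lam (K_orbit L u z) = \<eta>"
    using inj by (simp add: phi_P_def phi_bar_def iota[symmetric])
  then show ?thesis using iota_apply[of \<eta> j] by (simp add: iota phi_apply sum_axis)
qed

section \<open>Calculus on open subsets of coordinate subspaces\<close>

lemma subspace_coord_space: "subspace (coord_space B)"
  by (auto simp: subspace_def coord_space_def)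

lemma coord_space_i: "\<xi> \<in> coord_space B \<Longrightarrow> \<i> *s \<xi> \<in> coord_space B"
  by (auto simp: coord_space_def)

lemma axis_in_coord_space: "a \<in> B \<Longrightarrow> axis a c \<in> coord_space B"
  by (auto simp: coord_space_def axis_def)

text \<open>Directional derivatives at points of \<open>W\<close> only make sense along lines inside the coordinate subspace; the
  following facts relate them to derivatives within \<open>W\<close>, which is in general not open in \<open>\<complex>\<^sup>N\<close>.\<close>

lemma openin_coord_space_plane:
  assumes W: "openin (top_of_set (coord_space B)) W"
    and "w \<in> coord_space B" "\<xi> \<in> coord_space B" "\<zeta> \<in> coord_space B"
  shows "open {p :: real \<times> real. w + fst p *\<^sub>R \<xi> + snd p *\<^sub>R \<zeta> \<in> W}"
proof -
  obtain U where U: "open U" "W = coord_space B \<inter> U" using W by (auto simp: openin_open)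
  have "w + s *\<^sub>R \<xi> + t *\<^sub>R \<zeta> \<in> coord_space B" for s t
    using assms by (intro subspace_add[OF subspace_coord_space] subspace_scale[OF subspace_coord_space])
  then have "{p :: real \<times> real. w + fst p *\<^sub>R \<xi> + snd p *\<^sub>R \<zeta> \<in> W} = (\<lambda>p. w + fst p *\<^sub>R \<xi> + snd p *\<^sub>R \<zeta>) -` U"
    by (auto simp: U)
  moreover have "open \<dots>" by (intro open_vimage U continuous_intros)
  ultimately show ?thesis by simp
qed

lemma openin_coord_space_line:
  assumes W: "openin (top_of_set (coord_space B)) W"
    and "w \<in> coord_space B" "\<xi> \<in> coord_space B"
  shows "open {t :: real. w + t *\<^sub>R \<xi> \<in> W}"
proof -
  have "{t :: real. w + t *\<^sub>R \<xi> \<in> W} = (\<lambda>t. (t, 0)) -` {p :: real \<times> real. w + fst p *\<^sub>R \<xi> + snd p *\<^sub>R 0 \<in> W}"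
    by auto
  moreover have "open \<dots>"
    using subspace_0[OF subspace_coord_space, of B] assms
    by (intro open_vimage openin_coord_space_plane[OF W] continuous_intros)
  ultimately show ?thesis by simp
qed

lemma has_vector_derivative_along_line:
  assumes W: "openin (top_of_set (coord_space B)) W"
    and w: "w \<in> coord_space B" and \<xi>: "\<xi> \<in> coord_space B" and t: "w + t *\<^sub>R \<xi> \<in> W"
    and f: "(f has_derivative f') (at (w + t *\<^sub>R \<xi>) within W)"
  shows "((\<lambda>t. f (w + t *\<^sub>R \<xi>)) has_vector_derivative f' \<xi>) (at t)"
proof -
  define T where "T = {t :: real. w + t *\<^sub>R \<xi> \<in> W}"
  have T: "open T" "t \<in> T" using openin_coord_space_line[OF W w \<xi>] t by (auto simp: T_def)
  have "((\<lambda>t. w + t *\<^sub>R \<xi>) has_derivative (\<lambda>h. h *\<^sub>R \<xi>)) (at t within T)"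
    by (intro has_derivative_eq_rhs[OF has_derivative_add[OF has_derivative_const
          has_derivative_scaleR_left[OF has_derivative_ident]]]) simp
  moreover have "(\<lambda>t. w + t *\<^sub>R \<xi>) ` T \<subseteq> W" by (auto simp: T_def)
  note has_derivative_subset[OF f this]
  ultimately have "((\<lambda>t. f (w + t *\<^sub>R \<xi>)) has_derivative (\<lambda>h. f' (h *\<^sub>R \<xi>))) (at t within T)"
    by (rule has_derivative_in_compose)
  moreover have "f' (h *\<^sub>R \<xi>) = h *\<^sub>R f' \<xi>" for h
    by (rule linear_scale[OF has_derivative_linear[OF f]])
  ultimately show ?thesis
    unfolding has_vector_derivative_def at_within_open[OF T(2) T(1)] by simp
qed

lemma dir_deriv_eqI:
  assumes W: "openin (top_of_set (coord_space B)) W" and w: "w \<in> W" and \<xi>: "\<xi> \<in> coord_space B"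
    and f: "(f has_derivative f') (at w within W)" and eq: "\<And>x. x \<in> W \<Longrightarrow> g x = f x"
  shows "dir_deriv g w \<xi> = f' \<xi>"
proof -
  have wB: "w \<in> coord_space B" using W w openin_imp_subset by blast
  have "((\<lambda>t. f (w + t *\<^sub>R \<xi>)) has_vector_derivative f' \<xi>) (at 0)"
    using w f by (intro has_vector_derivative_along_line[OF W wB \<xi>]) simp_all
  then have "((\<lambda>t. g (w + t *\<^sub>R \<xi>)) has_vector_derivative f' \<xi>) (at 0)"
    by (rule has_vector_derivative_transform_within_open[OF _ openin_coord_space_line[OF W wB \<xi>]])
      (use w eq in auto)
  then show ?thesis unfolding dir_deriv_def by (rule vector_derivative_at)
qed

lemma second_derivative_symmetric:
  fixes f :: "complex^'n \<Rightarrow> 'b::euclidean_space" and D :: "complex^'n \<Rightarrow> (complex^'n) \<Rightarrow>\<^sub>L 'b"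
  assumes W: "openin (top_of_set (coord_space B)) W"
    and D: "\<And>x. x \<in> W \<Longrightarrow> (f has_derivative blinfun_apply (D x)) (at x within W)"
    and E: "\<And>x. x \<in> W \<Longrightarrow> (D has_derivative blinfun_apply (E x)) (at x within W)"
    and cE: "continuous_on W E"
    and w: "w \<in> W" and \<xi>: "\<xi> \<in> coord_space B" and \<zeta>: "\<zeta> \<in> coord_space B"
  shows "blinfun_apply (blinfun_apply (E w) \<zeta>) \<xi> = blinfun_apply (blinfun_apply (E w) \<xi>) \<zeta>"
proof (rule euclidean_eqI)
  fix b :: 'b
  have wB: "w \<in> coord_space B" using W w openin_imp_subset by blast
  define pt where "pt s t = w + s *\<^sub>R \<xi> + t *\<^sub>R \<zeta>" for s t
  define T where "T = {p :: real \<times> real. pt (fst p) (snd p) \<in> W}"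
  have T: "open T" using openin_coord_space_plane[OF W wB \<xi> \<zeta>] by (simp add: T_def pt_def)
  have ptB: "w + s *\<^sub>R \<xi> \<in> coord_space B" "w + t *\<^sub>R \<zeta> \<in> coord_space B" for s t
    using wB \<xi> \<zeta> by (auto intro!: subspace_add[OF subspace_coord_space] subspace_scale[OF subspace_coord_space])
  have dt: "((\<lambda>t. k (pt s t)) has_vector_derivative k' \<zeta>) (at t)"
    if "(k has_derivative k') (at (pt s t) within W)" "pt s t \<in> W" for k :: "_ \<Rightarrow> 'z::real_normed_vector" and k' s t
    using that unfolding pt_def by (intro has_vector_derivative_along_line[OF W ptB(1) \<zeta>])
  have ds: "((\<lambda>s. k (pt s t)) has_vector_derivative k' \<xi>) (at s)"
    if "(k has_derivative k') (at (pt s t) within W)" "pt s t \<in> W" for k :: "_ \<Rightarrow> 'z::real_normed_vector" and k' s t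
  proof -
    have "pt s t = (w + t *\<^sub>R \<zeta>) + s *\<^sub>R \<xi>" for s t by (simp add: pt_def)
    with that show ?thesis by simp (intro has_vector_derivative_along_line[OF W ptB(2) \<xi>])
  qed
  have inner: "((\<lambda>t. k t \<bullet> b) has_real_derivative k' \<bullet> b) (at t)"
    if "(k has_vector_derivative k') (at t)" for k :: "real \<Rightarrow> 'b" and k' t
    using bounded_linear.has_vector_derivative[OF bounded_linear_inner_left that]
    by (simp add: has_real_derivative_iff_has_vector_derivative)
  have app: "((\<lambda>t. blinfun_apply (k t) v) has_vector_derivative blinfun_apply k' v) (at t)"
    if "(k has_vector_derivative k') (at t)" for k :: "real \<Rightarrow> (complex^'n) \<Rightarrow>\<^sub>L 'b" and k' t v
    using bounded_linear.has_vector_derivative[OF blinfun.bounded_linear_left that] .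
  have "(0, 0) \<in> T" using w by (simp add: T_def pt_def)
  then obtain e where e: "e > 0" "ball (0, 0) e \<subseteq> T" using T open_contains_ball by blast
  have in_W: "pt s t \<in> W" if "\<bar>s\<bar> < e / 2" "\<bar>t\<bar> < e / 2" for s t
  proof -
    have "dist (0, 0) (s, t) \<le> \<bar>s\<bar> + \<bar>t\<bar>"
      by (simp add: dist_Pair_Pair dist_real_def sqrt_sum_squares_le_sum_abs)
    then have "(s, t) \<in> T" using that e(2) by (auto simp: subset_eq)
    then show ?thesis by (simp add: T_def)
  qed
  have cont: "isCont (\<lambda>p. blinfun_apply (blinfun_apply (E (pt (fst p) (snd p))) x) y \<bullet> b) (0, 0)" for x y
  proof -
    have cpt: "continuous_on T (\<lambda>p. pt (fst p) (snd p))" unfolding pt_def by (intro continuous_intros)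
    have "continuous_on T (\<lambda>p. E (pt (fst p) (snd p)))"
      by (rule continuous_on_compose2[OF cE cpt]) (auto simp: T_def)
    then have "continuous_on T (\<lambda>p. blinfun_apply (blinfun_apply (E (pt (fst p) (snd p))) x) y \<bullet> b)"
      by (intro continuous_intros)
    then show ?thesis using T \<open>(0, 0) \<in> T\<close> continuous_on_eq_continuous_at by blast
  qed
  have "blinfun_apply (blinfun_apply (E (pt 0 0)) \<zeta>) \<xi> \<bullet> b = blinfun_apply (blinfun_apply (E (pt 0 0)) \<xi>) \<zeta> \<bullet> b"
    by (rule mixed_partials_equal[of "e / 2" "\<lambda>s t. f (pt s t) \<bullet> b" "\<lambda>s t. blinfun_apply (D (pt s t)) \<xi> \<bullet> b"
          "\<lambda>s t. blinfun_apply (D (pt s t)) \<zeta> \<bullet> b"])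
      (use e(1) in \<open>auto intro!: inner app ds[OF D] ds[OF E] dt[OF D] dt[OF E] in_W cont\<close>)
  then show "blinfun_apply (blinfun_apply (E w) \<zeta>) \<xi> \<bullet> b = blinfun_apply (blinfun_apply (E w) \<xi>) \<zeta> \<bullet> b"
    by (simp add: pt_def)
qed

text \<open>The coordinate expression of \<open>\<partial>\<partial>bar\<close> involves only coordinate vectors; this expansion leads back to a
  form on arbitrary vectors, of which only sesquilinearity on \<open>\<complex>\<^sup>B\<close> is known.\<close>

lemma sesquilinear_expansion:
  fixes P :: "complex^'n::finite \<Rightarrow> complex^'n \<Rightarrow> complex"
  assumes l1: "\<And>y. linear (\<lambda>x. P x y)" and l2: "\<And>x. linear (P x)"
    and i1: "\<And>x y. x \<in> coord_space B \<Longrightarrow> y \<in> coord_space B \<Longrightarrow> P (\<i> *s x) y = \<i> * P x y"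
    and i2: "\<And>x y. x \<in> coord_space B \<Longrightarrow> y \<in> coord_space B \<Longrightarrow> P x (\<i> *s y) = - \<i> * P x y"
    and \<xi>: "\<xi> \<in> coord_space B" and \<eta>: "\<eta> \<in> coord_space B"
  shows "P \<xi> \<eta> = (\<Sum>a\<in>B. \<Sum>b\<in>B. P (axis a 1) (axis b 1) * (\<xi> $ a * cnj (\<eta> $ b)))"
proof -
  have expand: "x = (\<Sum>a\<in>B. Re (x $ a) *\<^sub>R axis a 1 + Im (x $ a) *\<^sub>R (\<i> *s axis a 1))"
    if "x \<in> coord_space B" for x :: "complex^'n"
  proof -
    have "Re (x $ a) *\<^sub>R axis a 1 + Im (x $ a) *\<^sub>R (\<i> *s axis a 1) = axis a (x $ a)" for a
      by (auto simp: vec_eq_iff axis_def complex_eq_iff)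
    moreover have "x = (\<Sum>a\<in>B. axis a (x $ a))"
      using that by (simp add: vec_eq_iff axis_def coord_space_def if_distrib cong: if_cong)
    ultimately show ?thesis by simp
  qed
  have scale: "P (Re c *\<^sub>R x + Im c *\<^sub>R (\<i> *s x)) y = c * P x y"
    if "x \<in> coord_space B" "y \<in> coord_space B" for c x y
    using linear_add[OF l1[of y]] linear_scale[OF l1[of y]] i1[OF that]
    by (simp add: complex_eq_iff)
  have scale': "P x (Re c *\<^sub>R y + Im c *\<^sub>R (\<i> *s y)) = cnj c * P x y"
    if "x \<in> coord_space B" "y \<in> coord_space B" for c x y
    using linear_add[OF l2[of x]] linear_scale[OF l2[of x]] i2[OF that]
    by (simp add: complex_eq_iff)
  have "P \<xi> \<eta> = (\<Sum>a\<in>B. P (Re (\<xi> $ a) *\<^sub>R axis a 1 + Im (\<xi> $ a) *\<^sub>R (\<i> *s axis a 1)) \<eta>)"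
    by (subst expand[OF \<xi>]) (rule linear_sum[OF l1])
  also have "\<dots> = (\<Sum>a\<in>B. \<xi> $ a * P (axis a 1) \<eta>)"
    using \<eta> by (intro sum.cong refl scale axis_in_coord_space)
  also have "\<dots> = (\<Sum>a\<in>B. \<xi> $ a * (\<Sum>b\<in>B. P (axis a 1) (Re (\<eta> $ b) *\<^sub>R axis b 1 + Im (\<eta> $ b) *\<^sub>R (\<i> *s axis b 1))))"
    by (subst expand[OF \<eta>]) (simp only: linear_sum[OF l2])
  also have "\<dots> = (\<Sum>a\<in>B. \<xi> $ a * (\<Sum>b\<in>B. cnj (\<eta> $ b) * P (axis a 1) (axis b 1)))"
    by (intro sum.cong refl arg_cong2[of _ _ _ _ "(*)"] scale' axis_in_coord_space)
  finally show ?thesis by (simp add: sum_distrib_left mult_ac)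
qed

section \<open>The operator \<open>\<partial>\<partial>bar\<close> in a holomorphic chart\<close>

text \<open>The coefficients \<open>q\<^sub>j\<close> of the holomorphic differential \<open>\<partial>F = \<Sum> q\<^sub>j dz\<^sub>j\<close> of
  \<open>F = \<Sum> (\<lambda>\<^sub>j log |z\<^sub>j|\<^sup>2 + |z\<^sub>j|\<^sup>2)\<close>.\<close>

definition dF_coeff :: "('n::finite \<Rightarrow> real) \<Rightarrow> complex^'n \<Rightarrow> 'n \<Rightarrow> complex" where
  "dF_coeff lam z j = cnj (z $ j) + of_real (lam j) / z $ j"

text \<open>On a vertical vector \<open>\<i> t\<^sub>j z\<^sub>j\<close> the differential is \<open>\<i> \<Sum> t\<^sub>j (|z\<^sub>j|\<^sup>2 + \<lambda>\<^sub>j)\<close>, and this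
  vanishes precisely by the equations of the level set.\<close>

lemma dF_vertical:
  assumes lam: "\<forall>j\<in>I. lam j = 0" and z: "z \<in> Z_face u lam I" and y: "y \<in> vertical_space u z"
  shows "(\<Sum>j\<in>-I. dF_coeff lam z j * y $ j) = 0"
proof -
  have z0: "z $ j = 0 \<longleftrightarrow> j \<in> I" for j using z by (simp add: Z_face_iff[OF lam])
  then obtain t where t: "t \<in> lie_kI u I" "\<And>j. y $ j = \<i> * of_real (t $ j) * z $ j"
    using y by (auto simp: vertical_space_iff[of I z])
  have "(\<Sum>j\<in>-I. dF_coeff lam z j * y $ j) = (\<Sum>j\<in>-I. \<i> * of_real (((cmod (z $ j))\<^sup>2 + lam j) * t $ j))"
  proof (rule sum.cong)
    fix j assume "j \<in> - I"
    then have "z $ j \<noteq> 0" using z0 by simp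
    moreover have "complex_of_real ((cmod (z $ j))\<^sup>2) = z $ j * cnj (z $ j)" by (rule complex_norm_square)
    ultimately show "dF_coeff lam z j * y $ j = \<i> * of_real (((cmod (z $ j))\<^sup>2 + lam j) * t $ j)"
      by (simp add: dF_coeff_def t(2) field_simps)
  qed simp
  also have "\<dots> = (\<Sum>j\<in>UNIV. \<i> * of_real (((cmod (z $ j))\<^sup>2 + lam j) * t $ j))"
    by (rule sum.mono_neutral_left) (use z0 lam in auto)
  also have "\<dots> = \<i> * of_real (\<Sum>j\<in>UNIV. ((cmod (z $ j))\<^sup>2 + lam j) * t $ j)"
    by (simp only: sum_distrib_left of_real_sum)
  also have "\<dots> = 0" using z t(1) by (simp add: Z_face_iff[OF lam])
  finally show ?thesis .
qed

locale face_chart =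
  fixes L :: "'g::euclidean_space set" and u :: "'n::finite \<Rightarrow> 'g" and lam :: "'n \<Rightarrow> real"
    and I B :: "'n set" and W :: "(complex^'n) set" and s :: "complex^'n \<Rightarrow> complex^'n"
    and D :: "complex^'n \<Rightarrow> (complex^'n) \<Rightarrow>\<^sub>L (complex^'n)" and E
  assumes L: "full_lattice L" and lam: "\<forall>j\<in>I. lam j = 0"
    and chart: "holomorphic_chart L u lam I B W s"
    and D: "\<And>x. x \<in> W \<Longrightarrow> (s has_derivative blinfun_apply (D x)) (at x within W)"
    and E: "\<And>x. x \<in> W \<Longrightarrow> (D has_derivative blinfun_apply (E x)) (at x within W)"
    and cE: "continuous_on W E"
begin

lemma openW: "openin (top_of_set (coord_space B)) W"
  and s_in_Z: "x \<in> W \<Longrightarrow> s x \<in> Z_face u lam I"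
  using chart by (auto simp: holomorphic_chart_def)

lemma s_zero_iff: "x \<in> W \<Longrightarrow> s x $ j = 0 \<longleftrightarrow> j \<in> I"
  using s_in_Z by (simp add: Z_face_iff[OF lam])

lemma dchart_eq:
  assumes x: "x \<in> W" and \<xi>: "\<xi> \<in> coord_space B"
  shows "dchart L u s x \<xi> = dproj L u (s x) (D x \<xi>)"
  unfolding dchart_def dir_deriv_eqI[OF openW x \<xi> D[OF x] refl] ..

text \<open>The differential of the chart takes values in tangent vectors of the quotient, and vertical vectors are
  themselves tangent.\<close>

lemma D_tangent:
  assumes x: "x \<in> W" and \<xi>: "\<xi> \<in> coord_space B"
  shows "D x \<xi> \<in> tangent_space (Z_face u lam I) (s x)"
proof -
  note z = s_in_Z[OF x]
  have "dchart L u s x \<xi> \<in> quotient_tangent L u lam I (K_orbit L u (s x))"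
    using chart x \<xi> by (auto simp: holomorphic_chart_def bij_betw_def)
  then obtain v where v: "v \<in> tangent_space (Z_face u lam I) (s x)"
    "dchart L u s x \<xi> = dproj L u (s x) v" by (rule quotient_tangentE[OF L lam z])
  then have "D x \<xi> - v \<in> vertical_space u (s x)"
    using dproj_eq_iff[OF L tangent_vanishes[OF lam z v(1)]] dchart_eq[OF x \<xi>] by simp
  then have "(D x \<xi> - v) + v \<in> tangent_space (Z_face u lam I) (s x)"
    using v(1) vertical_subset_tangent[OF lam z] by (intro subspace_add[OF subspace_tangent[OF lam z]]) auto
  then show ?thesis by simp
qed

text \<open>The lift \<open>s\<close> need not be holomorphic, but complex linearity for the reduced complex structure
  says that its differential is complex linear up to vertical vectors.\<close>

lemma D_i:
  assumes x: "x \<in> W" and \<xi>: "\<xi> \<in> coord_space B"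
  obtains h y y' where "h \<in> horizontal_space u lam I (s x)"
    "y \<in> vertical_space u (s x)" "y' \<in> vertical_space u (s x)"
    "D x \<xi> = h + y" "D x (\<i> *s \<xi>) = \<i> *s h + y'"
proof -
  note z = s_in_Z[OF x]
  obtain h y where hy: "h \<in> horizontal_space u lam I (s x)" "y \<in> vertical_space u (s x)" "D x \<xi> = h + y"
    using tangent_decomposition[OF lam z D_tangent[OF x \<xi>]] .
  have ih: "\<i> *s h \<in> tangent_space (Z_face u lam I) (s x)"
    using horizontal_i[OF lam z hy(1)] by (simp add: horizontal_space_def)
  have "dproj L u (s x) (D x (\<i> *s \<xi>)) = reduced_J L u lam I (dproj L u (s x) (D x \<xi>))"
    using chart x \<xi> by (simp add: holomorphic_chart_def dchart_eq[symmetric] coord_space_i)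
  also have "\<dots> = dproj L u (s x) (\<i> *s h)"
    unfolding hy(3) by (rule reduced_J_dproj[OF L lam z hy(1,2)])
  finally have "D x (\<i> *s \<xi>) - \<i> *s h \<in> vertical_space u (s x)"
    using dproj_eq_iff[OF L tangent_vanishes[OF lam z ih]] by simp
  with hy that[of h y "D x (\<i> *s \<xi>) - \<i> *s h"] show ?thesis by simp
qed

lemma flat_form_D_i:
  assumes x: "x \<in> W" and \<xi>: "\<xi> \<in> coord_space B" and \<eta>: "\<eta> \<in> coord_space B"
  shows "flat_form (D x (\<i> *s \<xi>)) (D x (\<i> *s \<eta>)) = flat_form (D x \<xi>) (D x \<eta>)"
proof -
  note z = s_in_Z[OF x]
  obtain h y y' where 1: "h \<in> horizontal_space u lam I (s x)"
    "y \<in> vertical_space u (s x)" "y' \<in> vertical_space u (s x)"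
    "D x \<xi> = h + y" "D x (\<i> *s \<xi>) = \<i> *s h + y'" using D_i[OF x \<xi>] .
  obtain k v v' where 2: "k \<in> horizontal_space u lam I (s x)"
    "v \<in> vertical_space u (s x)" "v' \<in> vertical_space u (s x)"
    "D x \<eta> = k + v" "D x (\<i> *s \<eta>) = \<i> *s k + v'" using D_i[OF x \<eta>] .
  have reduce: "flat_form (a + c) (b + d) = flat_form a b"
    if "a \<in> horizontal_space u lam I (s x)" "b \<in> horizontal_space u lam I (s x)"
      "c \<in> vertical_space u (s x)" "d \<in> vertical_space u (s x)" for a b c d
  proof -
    have T: "b \<in> tangent_space (Z_face u lam I) (s x)" "a \<in> tangent_space (Z_face u lam I) (s x)"
      "d \<in> tangent_space (Z_face u lam I) (s x)"
      using that vertical_subset_tangent[OF lam z] by (auto simp: horizontal_space_def)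
    show ?thesis
      using flat_form_vertical[OF lam z that(3) T(1)] flat_form_vertical[OF lam z that(3) T(3)]
        flat_form_vertical[OF lam z that(4) T(2)] flat_form_commute[of a d]
      by (simp add: flat_form_add_left flat_form_add_right)
  qed
  show ?thesis
    using reduce[OF 1(1) 2(1) 1(2) 2(2)]
      reduce[OF horizontal_i[OF lam z 1(1)] horizontal_i[OF lam z 2(1)] 1(3) 2(3)]
    by (simp add: 1(4,5) 2(4,5) flat_form_i)
qed

text \<open>The pullback \<open>s\<^sup>* \<partial>F\<close>.  It does not see vertical vectors, hence it is complex linear although the
  differential of \<open>s\<close> is not.\<close>

definition \<theta> :: "complex^'n \<Rightarrow> complex^'n \<Rightarrow> complex" where
  "\<theta> \<xi> x = (\<Sum>j\<in>-I. dF_coeff lam (s x) j * D x \<xi> $ j)"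

lemma theta_i:
  assumes x: "x \<in> W" and \<xi>: "\<xi> \<in> coord_space B"
  shows "\<theta> (\<i> *s \<xi>) x = \<i> * \<theta> \<xi> x"
proof -
  note z = s_in_Z[OF x]
  obtain h y y' where *: "h \<in> horizontal_space u lam I (s x)"
    "y \<in> vertical_space u (s x)" "y' \<in> vertical_space u (s x)"
    "D x \<xi> = h + y" "D x (\<i> *s \<xi>) = \<i> *s h + y'" using D_i[OF x \<xi>] .
  have 1: "\<theta> \<xi> x = (\<Sum>j\<in>-I. dF_coeff lam (s x) j * h $ j)"
    using dF_vertical[OF lam z *(2)] by (simp add: \<theta>_def *(4) distrib_left sum.distrib)
  have 2: "\<theta> (\<i> *s \<xi>) x = (\<Sum>j\<in>-I. dF_coeff lam (s x) j * (\<i> * h $ j))"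
    using dF_vertical[OF lam z *(3)] by (simp add: \<theta>_def *(5) distrib_left sum.distrib)
  show ?thesis unfolding 1 2 by (simp add: sum_distrib_left mult_ac)
qed

text \<open>The derivative of \<open>\<theta> \<xi>\<close> in direction \<open>\<zeta>\<close>.\<close>

definition \<beta> :: "complex^'n \<Rightarrow> complex^'n \<Rightarrow> complex^'n \<Rightarrow> complex" where
  "\<beta> x \<zeta> \<xi> = (\<Sum>j\<in>-I. (cnj (D x \<zeta> $ j) - of_real (lam j) * D x \<zeta> $ j / (s x $ j)\<^sup>2) * D x \<xi> $ j
      + dF_coeff lam (s x) j * E x \<zeta> \<xi> $ j)"

lemma theta_has_derivative:
  assumes x: "x \<in> W"
  shows "(\<theta> \<xi> has_derivative (\<lambda>\<zeta>. \<beta> x \<zeta> \<xi>)) (at x within W)"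
proof -
  have "((\<lambda>x. dF_coeff lam (s x) j * D x \<xi> $ j) has_derivative
      (\<lambda>\<zeta>. (cnj (D x \<zeta> $ j) - of_real (lam j) * D x \<zeta> $ j / (s x $ j)\<^sup>2) * D x \<xi> $ j
        + dF_coeff lam (s x) j * E x \<zeta> \<xi> $ j)) (at x within W)" if j: "j \<in> - I" for j
  proof -
    have sj: "((\<lambda>x. s x $ j) has_derivative (\<lambda>\<zeta>. D x \<zeta> $ j)) (at x within W)"
      by (rule bounded_linear.has_derivative[OF bounded_linear_vec_nth D[OF x]])
    have Dj: "((\<lambda>x. D x \<xi> $ j) has_derivative (\<lambda>\<zeta>. E x \<zeta> \<xi> $ j)) (at x within W)"
      by (rule bounded_linear.has_derivative[OF bounded_linear_vec_nth
            bounded_linear.has_derivative[OF blinfun.bounded_linear_left E[OF x]]])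
    have nz: "s x $ j \<noteq> 0" using s_zero_iff[OF x] j by simp
    show ?thesis unfolding dF_coeff_def
      by (rule has_derivative_eq_rhs[OF has_derivative_mult[OF has_derivative_add[OF
              bounded_linear.has_derivative[OF bounded_linear_cnj sj]
              has_derivative_divide[OF has_derivative_const sj nz]] Dj]])
        (simp add: fun_eq_iff power2_eq_square divide_inverse algebra_simps)
  qed
  then show ?thesis unfolding \<theta>_def[abs_def] \<beta>_def by (rule has_derivative_sum)
qed

lemma beta_i:
  assumes x: "x \<in> W" and \<xi>: "\<xi> \<in> coord_space B" and \<zeta>: "\<zeta> \<in> coord_space B"
  shows "\<beta> x \<zeta> (\<i> *s \<xi>) = \<i> * \<beta> x \<zeta> \<xi>"
proof -
  have "dir_deriv (\<theta> (\<i> *s \<xi>)) x \<zeta> = \<beta> x \<zeta> (\<i> *s \<xi>)"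
    by (rule dir_deriv_eqI[OF openW x \<zeta> theta_has_derivative[OF x] refl])
  moreover have "dir_deriv (\<theta> (\<i> *s \<xi>)) x \<zeta> = \<i> * \<beta> x \<zeta> \<xi>"
    by (rule dir_deriv_eqI[OF openW x \<zeta> has_derivative_mult_right[OF theta_has_derivative[OF x]]])
      (rule theta_i[OF _ \<xi>])
  ultimately show ?thesis by simp
qed

text \<open>The second derivatives of \<open>s\<close> are symmetric, so that only the metric term is left.\<close>

lemma beta_antisymmetrized:
  assumes x: "x \<in> W" and \<xi>: "\<xi> \<in> coord_space B" and \<zeta>: "\<zeta> \<in> coord_space B"
  shows "\<beta> x \<zeta> \<xi> - \<beta> x \<xi> \<zeta> = \<i> * flat_form (D x \<zeta>) (D x \<xi>)"
proof -
  have sym: "E x \<zeta> \<xi> = E x \<xi> \<zeta>"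
    by (rule second_derivative_symmetric[OF openW D E cE x \<xi> \<zeta>])
  have "\<beta> x \<zeta> \<xi> - \<beta> x \<xi> \<zeta> = - (\<Sum>j\<in>-I. wedge (\<lambda>x. x $ j) (\<lambda>x. cnj (x $ j)) (D x \<zeta>) (D x \<xi>))"
    unfolding \<beta>_def sum_subtractf[symmetric] sum_negf[symmetric]
    by (intro sum.cong refl) (simp add: sym wedge_def algebra_simps)
  also have "(\<Sum>j\<in>-I. wedge (\<lambda>x. x $ j) (\<lambda>x. cnj (x $ j)) (D x \<zeta>) (D x \<xi>))
    = (\<Sum>j\<in>UNIV. wedge (\<lambda>x. x $ j) (\<lambda>x. cnj (x $ j)) (D x \<zeta>) (D x \<xi>))"
    using D_tangent[OF x \<xi>] D_tangent[OF x \<zeta>]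
    by (intro sum.mono_neutral_left) (auto simp: wedge_def tangent_Z_face_iff[OF lam s_in_Z[OF x]])
  finally show ?thesis by (simp add: flat_form_def)
qed

text \<open>Here \<open>dg = 2 Re \<theta>\<close> with \<open>\<theta>\<close> complex linear, so \<open>\<partial>bar g = cnj \<theta>\<close> and \<open>\<partial>\<partial>bar g\<close> is the antisymmetrization of the
  complex linear part of \<open>cnj \<beta>\<close> in its first argument.  The antisymmetrization of all of \<open>cnj \<beta>\<close> is the pullback of
  the flat form up to a factor; as this pullback is invariant under \<open>\<i>\<close> (\<open>flat_form_D_i\<close>), the antilinear part
  contributes nothing.\<close>

lemma ddbar_coord_eq:
  assumes g: "\<And>x. x \<in> W \<Longrightarrow> g x = complex_of_real
      (\<Sum>j\<in>-I. lam j * ln ((cmod (s x $ j))\<^sup>2) + ((cmod (s x $ j))\<^sup>2 + lam j))"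
    and w: "w \<in> W" and \<xi>: "\<xi> \<in> coord_space B" and \<eta>: "\<eta> \<in> coord_space B"
  shows "ddbar_coord B g w \<xi> \<eta> = - \<i> * flat_form (D w \<xi>) (D w \<eta>)"
proof -
  have dg: "dir_deriv g x \<zeta> = of_real (2 * Re (\<theta> \<zeta> x))" if x: "x \<in> W" and \<zeta>: "\<zeta> \<in> coord_space B" for x \<zeta>
  proof -
    have dj: "((\<lambda>x. lam j * ln ((cmod (s x $ j))\<^sup>2) + ((cmod (s x $ j))\<^sup>2 + lam j)) has_derivative
        (\<lambda>\<zeta>. 2 * Re (dF_coeff lam (s x) j * D x \<zeta> $ j))) (at x within W)" if j: "j \<in> - I" for j
    proof -
      have sj: "((\<lambda>x. s x $ j) has_derivative (\<lambda>\<zeta>. D x \<zeta> $ j)) (at x within W)"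
        by (rule bounded_linear.has_derivative[OF bounded_linear_vec_nth D[OF x]])
      have nz: "s x $ j \<noteq> 0" using s_zero_iff[OF x] j by simp
      then have pos: "s x $ j \<bullet> s x $ j > 0" by simp
      have n: "((\<lambda>x. s x $ j \<bullet> s x $ j) has_derivative (\<lambda>\<zeta>. 2 * (s x $ j \<bullet> D x \<zeta> $ j))) (at x within W)"
        by (rule has_derivative_eq_rhs[OF has_derivative_inner[OF sj sj]]) (simp add: inner_commute)
      have Re: "2 * Re (dF_coeff lam (s x) j * v)
          = lam j * (2 * (s x $ j \<bullet> v) * inverse (s x $ j \<bullet> s x $ j)) + (2 * (s x $ j \<bullet> v) + 0)" for v
      proof -
        have "complex_of_real (lam j) / s x $ j * v = (of_real (lam j) * (v * cnj (s x $ j))) / of_real (s x $ j \<bullet> s x $ j)"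
          by (subst complex_div_cnj) (simp add: power2_norm_eq_inner of_real_power[symmetric] del: of_real_power)
        then have "Re (complex_of_real (lam j) / s x $ j * v) = lam j * Re (v * cnj (s x $ j)) / (s x $ j \<bullet> s x $ j)"
          by (simp only: Re_divide_of_real Re_complex_of_real times_complex.sel) simp
        moreover have "Re (v * cnj (s x $ j)) = s x $ j \<bullet> v" by (simp add: inner_complex_def)
        moreover have "Re (cnj (s x $ j) * v) = s x $ j \<bullet> v" by (simp add: inner_complex_def)
        ultimately show ?thesis
          by (simp only: dF_coeff_def distrib_right plus_complex.sel) (simp add: divide_inverse)
      qed
      show ?thesis unfolding power2_norm_eq_inner Re
        by (rule has_derivative_add[OF has_derivative_mult_right[OF has_derivative_ln[OF pos n]]
              has_derivative_add[OF n has_derivative_const]])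
    qed
    have "((\<lambda>x. complex_of_real (\<Sum>j\<in>-I. lam j * ln ((cmod (s x $ j))\<^sup>2) + ((cmod (s x $ j))\<^sup>2 + lam j)))
        has_derivative (\<lambda>\<zeta>. complex_of_real (\<Sum>j\<in>-I. 2 * Re (dF_coeff lam (s x) j * D x \<zeta> $ j)))) (at x within W)"
      by (rule has_derivative_of_real[OF has_derivative_sum[OF dj]])
    from dir_deriv_eqI[OF openW x \<zeta> this g]
    show ?thesis by (simp only: \<theta>_def Re_sum sum_distrib_left)
  qed
  have axis_i: "axis a \<i> = \<i> *s axis a 1" for a :: 'n by (simp add: vec_eq_iff axis_def)
  have wbar: "d_wbar b g x = cnj (\<theta> (axis b 1) x)" if x: "x \<in> W" and b: "b \<in> B" for x b
  proof -
    have bB: "axis b 1 \<in> coord_space B" using b by (rule axis_in_coord_space)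
    show ?thesis
      unfolding d_wbar_def axis_i dg[OF x bB] dg[OF x coord_space_i[OF bB]] theta_i[OF x bB]
      by (simp add: complex_eq_iff)
  qed
  define P where "P \<xi> \<eta> = (cnj (\<beta> w \<xi> \<eta>) - \<i> * cnj (\<beta> w (\<i> *s \<xi>) \<eta>)) / 2" for \<xi> \<eta>
  have P: "d_w a (d_wbar b g) w = P (axis a 1) (axis b 1)" if a: "a \<in> B" and b: "b \<in> B" for a b
  proof -
    have aB: "axis a 1 \<in> coord_space B" using a by (rule axis_in_coord_space)
    have dd: "dir_deriv (d_wbar b g) w \<zeta> = cnj (\<beta> w \<zeta> (axis b 1))" if "\<zeta> \<in> coord_space B" for \<zeta>
      by (rule dir_deriv_eqI[OF openW w that bounded_linear.has_derivative[OF bounded_linear_cnj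
              theta_has_derivative[OF w]]])
        (rule wbar[OF _ b])
    show ?thesis unfolding d_w_def axis_i dd[OF aB] dd[OF coord_space_i[OF aB]] P_def ..
  qed
  have b1: "\<beta> w (x + y) \<zeta> = \<beta> w x \<zeta> + \<beta> w y \<zeta>" "\<beta> w \<zeta> (x + y) = \<beta> w \<zeta> x + \<beta> w \<zeta> y" for x y \<zeta>
    unfolding \<beta>_def sum.distrib[symmetric]
    by (intro sum.cong refl; simp add: blinfun.bilinear_simps algebra_simps add_divide_distrib)+
  have b2: "\<beta> w (r *\<^sub>R x) \<zeta> = r *\<^sub>R \<beta> w x \<zeta>" "\<beta> w \<zeta> (r *\<^sub>R x) = r *\<^sub>R \<beta> w \<zeta> x" for r x \<zeta>
    unfolding \<beta>_def scaleR_sum_right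
    by (intro sum.cong refl; simp add: blinfun.bilinear_simps algebra_simps scaleR_conv_of_real[where 'a = complex])+
  have ii: "\<i> *s (\<i> *s x) = (-1) *\<^sub>R x" "\<i> *s (x + y) = \<i> *s x + \<i> *s y" "\<i> *s (r *\<^sub>R x) = r *\<^sub>R (\<i> *s x)"
    for x y :: "complex^'n" and r
    by (auto simp: vec_eq_iff algebra_simps)
  have exp: "P x y = (\<Sum>a\<in>B. \<Sum>b\<in>B. P (axis a 1) (axis b 1) * (x $ a * cnj (y $ b)))"
    if x: "x \<in> coord_space B" and y: "y \<in> coord_space B" for x y
  proof (rule sesquilinear_expansion[OF _ _ _ _ x y])
    show "linear (\<lambda>x. P x y)" for y
      by (rule linearI) (simp_all add: P_def b1 b2 ii algebra_simps add_divide_distrib scaleR_conv_of_real[where 'a = complex] diff_divide_distrib)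
    show "linear (P x)" for x
      by (rule linearI) (simp_all add: P_def b1 b2 ii algebra_simps add_divide_distrib scaleR_conv_of_real[where 'a = complex] diff_divide_distrib)
    show "P (\<i> *s x) y = \<i> * P x y" for x y
      unfolding P_def ii b2 by (simp add: algebra_simps diff_divide_distrib)
    show "P x (\<i> *s y) = - \<i> * P x y" if "x \<in> coord_space B" "y \<in> coord_space B" for x y
      unfolding P_def beta_i[OF w that(2,1)] beta_i[OF w that(2) coord_space_i[OF that(1)]]
      by (simp add: algebra_simps diff_divide_distrib)
  qed
  have "ddbar_coord B g w \<xi> \<eta> = P \<xi> \<eta> - P \<eta> \<xi>"
  proof -
    have "P \<eta> \<xi> = (\<Sum>a\<in>B. \<Sum>b\<in>B. P (axis a 1) (axis b 1) * (\<eta> $ a * cnj (\<xi> $ b)))"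
      by (rule exp[OF \<eta> \<xi>])
    then show ?thesis
      unfolding ddbar_coord_def exp[OF \<xi> \<eta>] wedge_def
      by (simp add: P right_diff_distrib sum_subtractf)
  qed
  also have "\<dots> = (cnj (\<beta> w \<xi> \<eta> - \<beta> w \<eta> \<xi>) + cnj (\<beta> w (\<i> *s \<xi>) (\<i> *s \<eta>) - \<beta> w (\<i> *s \<eta>) (\<i> *s \<xi>))) / 2"
    unfolding P_def beta_i[OF w \<eta> coord_space_i[OF \<xi>]] beta_i[OF w \<xi> coord_space_i[OF \<eta>]]
    by (simp add: algebra_simps diff_divide_distrib add_divide_distrib)
  also have "\<dots> = - \<i> * flat_form (D w \<xi>) (D w \<eta>)"
    unfolding beta_antisymmetrized[OF w \<eta> \<xi>] beta_antisymmetrized[OF w coord_space_i[OF \<eta>] coord_space_i[OF \<xi>]]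
      flat_form_D_i[OF w \<xi> \<eta>]
    by (simp add: flat_form_eq_inner)
  finally show ?thesis .
qed

end

section \<open>A nonlinear change of coordinates on \<open>\<real>\<^sup>N\<close>\<close>

definition supported :: "'n set \<Rightarrow> (real^'n) set" where
  "supported B = {x. \<forall>j. j \<notin> B \<longrightarrow> x $ j = 0}"

lemma subspace_supported: "subspace (supported B)"
  by (auto simp: subspace_def supported_def)

text \<open>Every subspace has a coordinate complement, by maximality of the index set among those whose
  coordinate space meets the subspace trivially; \<open>Q\<close> is the projection along the subspace.\<close>

lemma coordinate_complement:
  fixes S :: "(real^'n::finite) set"
  assumes S: "subspace S"
  obtains B Q where "linear Q" "\<And>v. Q v \<in> supported B" "\<And>v. v - Q v \<in> S"
    "\<And>v. Q v = 0 \<longleftrightarrow> v \<in> S" "\<And>x. x \<in> supported B \<Longrightarrow> Q x = x"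
proof -
  define \<B> where "\<B> = {B :: 'n set. supported B \<inter> S \<subseteq> {0}}"
  have "{} \<in> \<B>" by (auto simp: \<B>_def supported_def vec_eq_iff)
  then obtain B where B: "B \<in> \<B>" and max: "\<And>B'. B' \<in> \<B> \<Longrightarrow> B \<subseteq> B' \<Longrightarrow> B = B'"
    using finite_has_maximal[of \<B>] by auto
  have trivial: "x = 0" if "x \<in> supported B" "x \<in> S" for x
    using B that by (auto simp: \<B>_def)
  have "\<exists>q. q \<in> supported B \<and> axis j 1 - q \<in> S" for j
  proof (cases "j \<in> B")
    case True
    then show ?thesis using subspace_0[OF S]
      by (intro exI[of _ "axis j 1"]) (auto simp: supported_def axis_def)
  next
    case False
    then have "insert j B \<notin> \<B>" using max[of "insert j B"] by auto
    then obtain x where x: "x \<in> supported (insert j B)" "x \<in> S" "x \<noteq> 0" by (auto simp: \<B>_def)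
    have xj: "x $ j \<noteq> 0"
    proof
      assume "x $ j = 0"
      with x(1) have "x \<in> supported B" by (auto simp: supported_def)
      with x trivial show False by blast
    qed
    define q where "q = axis j 1 - (1 / x $ j) *\<^sub>R x"
    have "q \<in> supported B"
      using x(1) xj by (auto simp: q_def supported_def axis_def)
    moreover have "axis j 1 - q \<in> S" using subspace_scale[OF S x(2)] by (simp add: q_def)
    ultimately show ?thesis by blast
  qed
  then obtain q where q: "\<And>j. q j \<in> supported B" "\<And>j. axis j 1 - q j \<in> S" by metis
  define Q where "Q v = (\<Sum>j\<in>UNIV. v $ j *\<^sub>R q j)" for v :: "real^'n"
  have lin: "linear Q"
    by (rule linearI) (auto simp: Q_def scaleR_left_distrib sum.distrib scaleR_sum_right)
  have Qsupp: "Q v \<in> supported B" for v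
    unfolding Q_def using q(1) by (intro subspace_sum[OF subspace_supported] subspace_scale[OF subspace_supported])
  have QS: "v - Q v \<in> S" for v
  proof -
    have "v = (\<Sum>j\<in>UNIV. v $ j *\<^sub>R axis j 1)"
      by (simp add: vec_eq_iff axis_def if_distrib cong: if_cong)
    then have "v - Q v = (\<Sum>j\<in>UNIV. v $ j *\<^sub>R axis j 1) - Q v" by simp
    also have "\<dots> = (\<Sum>j\<in>UNIV. v $ j *\<^sub>R (axis j 1 - q j))"
      by (simp add: Q_def sum_subtractf scaleR_diff_right)
    also have "\<dots> \<in> S" using q(2) by (intro subspace_sum[OF S] subspace_scale[OF S])
    finally show ?thesis .
  qed
  have "Q v = 0 \<longleftrightarrow> v \<in> S" for v
  proof
    assume "Q v = 0" then show "v \<in> S" using QS[of v] by simp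
  next
    assume "v \<in> S"
    then have "v - (v - Q v) \<in> S" by (rule subspace_diff[OF S _ QS])
    then show "Q v = 0" using Qsupp trivial by simp
  qed
  moreover have "Q x = x" if "x \<in> supported B" for x
  proof -
    have "x - Q x = 0" using that Qsupp QS by (intro trivial subspace_diff[OF subspace_supported])
    then show ?thesis by simp
  qed
  ultimately show ?thesis using that lin Qsupp QS by blast
qed

lemma bounded_bilinear_vec_times:
  "bounded_bilinear (\<lambda>c v :: 'b::{real_normed_field,euclidean_space} ^ 'n. \<chi> j. c $ j * v $ j)"
  unfolding bilinear_conv_bounded_bilinear[symmetric] bilinear_def
  by (auto intro!: linearI simp: vec_eq_iff algebra_simps)

lemma vec_exp_has_derivative:
  fixes c :: "'b::{real_normed_field,banach,euclidean_space} ^ 'n"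
  shows "((\<lambda>y. \<chi> j. c $ j * exp (k * y $ j)) has_derivative
    (\<lambda>v. \<chi> j. k * (c $ j * exp (k * y $ j)) * v $ j)) (at y)"
proof (rule has_derivative_vecI)
  fix j
  have "((\<lambda>y :: 'b^'n. k * y $ j) has_derivative (\<lambda>v. k * v $ j)) (at y)"
    by (intro has_derivative_mult_right bounded_linear_imp_has_derivative bounded_linear_vec_nth)
  moreover have "((\<lambda>x. c $ j * exp x) has_derivative (\<lambda>h. c $ j * exp (k * y $ j) * h)) (at (k * y $ j))"
    using DERIV_cmult[OF DERIV_exp] by (simp add: has_field_derivative_def)
  ultimately have "((\<lambda>y. c $ j * exp (k * y $ j)) has_derivative (\<lambda>v. c $ j * exp (k * y $ j) * (k * v $ j))) (at y)"
    by (rule has_derivative_compose)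
  then show "((\<lambda>y. (\<chi> j. c $ j * exp (k * y $ j)) $ j) has_derivative
      (\<lambda>v. (\<chi> j. k * (c $ j * exp (k * y $ j)) * v $ j) $ j)) (at y)"
    by (simp add: mult_ac)
qed

lemma C2_on_vec_exp:
  fixes c :: "'b::{real_normed_field,banach,euclidean_space} ^ 'n"
  shows "C2_on W (\<lambda>y. \<chi> j. c $ j * exp (k * y $ j))"
proof -
  interpret p: bounded_bilinear "\<lambda>c v :: 'b^'n. \<chi> j. c $ j * v $ j" by (rule bounded_bilinear_vec_times)
  have k: "bounded_linear (\<lambda>c :: 'b^'n. \<chi> j. k * c $ j)"
    unfolding linear_conv_bounded_linear[symmetric] by (rule linearI) (auto simp: vec_eq_iff algebra_simps)
  show ?thesis
  proof (rule C2_on_linear_ode[where M = "\<lambda>c. p.prod_right (\<chi> j. k * c $ j)"])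
    show "bounded_linear (\<lambda>c. p.prod_right (\<chi> j. k * c $ j))"
      by (rule bounded_linear_compose[OF p.bounded_linear_prod_right k])
    show "((\<lambda>y. \<chi> j. c $ j * exp (k * y $ j)) has_derivative
        blinfun_apply (p.prod_right (\<chi> j. k * (\<chi> j. c $ j * exp (k * x $ j)) $ j))) (at x)" for x
      using vec_exp_has_derivative[of c k x] by (simp add: p.prod_right.rep_eq)
  qed
qed

text \<open>The map \<open>\<Phi>(y) = Q y + (1 - Q)\<^sup>T (r e\<^sup>2\<^sup>y + c)\<close>.  Its two summands are its coordinates in \<open>B\<close>
  and outside \<open>B\<close>, respectively.  The first one is \<open>y\<close> modulo \<open>S\<close>, the second one is the restriction to \<open>S\<close> of the
  functional \<open>r e\<^sup>2\<^sup>y + c\<close>.  So a solution of \<open>\<Phi> y = x\<close> for \<open>x \<in> \<real>\<^sup>B\<close> is a translate of \<open>x\<close> by an element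
  of \<open>S\<close> that satisfies the moment map equation; injectivity is the strict convexity
  of \<open>y \<mapsto> \<Sum> r\<^sub>j exp(2 y\<^sub>j)\<close>.\<close>

locale slice_map =
  fixes S :: "(real^'n::finite) set" and B :: "'n set" and Q :: "real^'n \<Rightarrow> real^'n"
    and r c :: "real^'n"
  assumes linQ: "linear Q" and Q_supp: "\<And>v. Q v \<in> supported B" and Q_diff: "\<And>v. v - Q v \<in> S"
    and Q_eq_0: "\<And>v. Q v = 0 \<longleftrightarrow> v \<in> S" and Q_id: "\<And>x. x \<in> supported B \<Longrightarrow> Q x = x"
    and r: "\<And>j. r $ j > 0"
begin

definition J :: "real^'n \<Rightarrow> real^'n" where
  "J = adjoint (\<lambda>v. v - Q v)"

definition ee :: "real^'n \<Rightarrow> real^'n" where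
  "ee y = (\<chi> j. r $ j * exp (2 * y $ j))"

definition \<Phi> :: "real^'n \<Rightarrow> real^'n" where
  "\<Phi> y = Q y + J (ee y + c)"

definition d\<Phi> :: "real^'n \<Rightarrow> real^'n \<Rightarrow> real^'n" where
  "d\<Phi> y v = Q v + J (\<chi> j. 2 * ee y $ j * v $ j)"

lemma lin_diff: "linear (\<lambda>v. v - Q v)"
  by (intro linear_compose_sub linear_ident linQ)

lemma linJ: "linear J"
  unfolding J_def by (rule adjoint_linear[OF lin_diff])

lemma J_inner: "v \<bullet> J e = (v - Q v) \<bullet> e"
  unfolding J_def by (rule adjoint_works[OF lin_diff])

lemma J_eq_0_iff: "J e = 0 \<longleftrightarrow> (\<forall>t\<in>S. t \<bullet> e = 0)"
proof
  assume "J e = 0"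
  then show "\<forall>t\<in>S. t \<bullet> e = 0" using J_inner[of _ e] Q_eq_0 by (metis diff_zero inner_zero_right)
next
  assume "\<forall>t\<in>S. t \<bullet> e = 0"
  then have "J e \<bullet> J e = 0" using J_inner[of "J e" e] Q_diff by simp
  then show "J e = 0" by simp
qed

lemma J_supp: "j \<in> B \<Longrightarrow> J e $ j = 0"
proof -
  assume "j \<in> B"
  then have "Q (axis j 1) = axis j 1" by (intro Q_id) (auto simp: supported_def axis_def)
  then show ?thesis using J_inner[of "axis j 1" e] by (simp add: inner_axis')
qed

text \<open>The summands have complementary supports.\<close>

lemma split_eq: "Q v + J e = Q v' + J e' \<longleftrightarrow> Q (v - v') = 0 \<and> J (e - e') = 0"
proof
  assume eq: "Q v + J e = Q v' + J e'"
  have "Q (v - v') $ j + J (e - e') $ j = 0" for j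
    using arg_cong[OF eq, of "\<lambda>x. x $ j"] by (simp add: linear_diff[OF linQ] linear_diff[OF linJ])
  moreover have "j \<notin> B \<Longrightarrow> Q (v - v') $ j = 0" for j using Q_supp by (auto simp: supported_def)
  ultimately have "Q (v - v') $ j = 0 \<and> J (e - e') $ j = 0" for j
    using J_supp[of j "e - e'"] by (cases "j \<in> B") (metis add.right_neutral add.left_neutral)+
  then show "Q (v - v') = 0 \<and> J (e - e') = 0" by (simp add: vec_eq_iff)
qed (simp add: linear_diff[OF linQ] linear_diff[OF linJ])

lemma d\<Phi>_eq_iff: "d\<Phi> y v = Q x \<longleftrightarrow> v - x \<in> S \<and> (\<forall>t\<in>S. (\<Sum>j\<in>UNIV. ee y $ j * v $ j * t $ j) = 0)"
proof -
  have "t \<bullet> (\<chi> j. 2 * ee y $ j * v $ j) = 2 * (\<Sum>j\<in>UNIV. ee y $ j * v $ j * t $ j)" for t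
    by (simp add: inner_vec_def sum_distrib_left mult_ac)
  then show ?thesis
    using split_eq[of v "\<chi> j. 2 * ee y $ j * v $ j" x 0]
    by (simp add: d\<Phi>_def linear_0[OF linJ] Q_eq_0 J_eq_0_iff)
qed

lemma \<Phi>_eq_iff: "\<Phi> y = Q x \<longleftrightarrow> y - x \<in> S \<and> (\<forall>t\<in>S. (\<Sum>j\<in>UNIV. (ee y $ j + c $ j) * t $ j) = 0)"
  using split_eq[of y "ee y + c" x 0]
  by (simp add: \<Phi>_def linear_0[OF linJ] Q_eq_0 J_eq_0_iff inner_vec_def mult.commute)

lemma d\<Phi>_eq_0: "d\<Phi> y v = 0 \<Longrightarrow> v = 0"
proof -
  assume "d\<Phi> y v = 0"
  then have "v \<in> S" "\<forall>t\<in>S. (\<Sum>j\<in>UNIV. ee y $ j * v $ j * t $ j) = 0"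
    using d\<Phi>_eq_iff[of y v 0] by (simp_all add: linear_0[OF linQ])
  then have "(\<Sum>j\<in>UNIV. ee y $ j * v $ j * v $ j) = 0" by blast
  moreover have "ee y $ j * v $ j * v $ j \<ge> 0" for j using r[of j] by (simp add: ee_def mult.assoc)
  ultimately have "ee y $ j * v $ j * v $ j = 0" for j by (simp add: sum_nonneg_eq_0_iff)
  then show "v = 0" using r by (simp add: ee_def vec_eq_iff less_imp_neq[symmetric])
qed

lemma inj_\<Phi>: "inj \<Phi>"
proof (rule injI)
  fix y y' assume "\<Phi> y = \<Phi> y'"
  then have "y - y' \<in> S" "J (ee y - ee y') = 0"
    using split_eq[of y "ee y + c" y' "ee y' + c"] by (auto simp: \<Phi>_def Q_eq_0)
  then have "(y - y') \<bullet> (ee y - ee y') = 0" by (simp add: J_eq_0_iff)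
  then have sum0: "(\<Sum>j\<in>UNIV. (y $ j - y' $ j) * (ee y $ j - ee y' $ j)) = 0"
    by (simp add: inner_vec_def)
  have eq: "(y $ j - y' $ j) * (ee y $ j - ee y' $ j) = r $ j * ((y $ j - y' $ j) * (exp (2 * y $ j) - exp (2 * y' $ j)))" for j
    by (simp add: ee_def algebra_simps)
  have mono: "(a - b) * (exp (2 * a) - exp (2 * b)) \<ge> 0" for a b :: real
    by (cases "a \<le> b") (auto intro: mult_nonpos_nonpos mult_nonneg_nonneg)
  have "(y $ j - y' $ j) * (ee y $ j - ee y' $ j) \<ge> 0" for j
    unfolding eq using r[of j] mono by simp
  then have "(y $ j - y' $ j) * (ee y $ j - ee y' $ j) = 0" for j
    using sum0 by (simp add: sum_nonneg_eq_0_iff)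
  moreover have "r $ j \<noteq> 0" for j using r[of j] by simp
  ultimately have "y $ j = y' $ j" for j
    unfolding eq by auto
  then show "y = y'" by (simp add: vec_eq_iff)
qed

lemma C2_\<Phi>: "C2_on UNIV \<Phi>"
proof -
  have bl: "bounded_linear Q" "bounded_linear J"
    using linQ linJ by (simp_all add: linear_conv_bounded_linear)
  have eq: "\<Phi> = (\<lambda>y. (Q y + J (ee y)) + J c)" by (simp add: \<Phi>_def linear_add[OF linJ] fun_eq_iff)
  have "C2_on UNIV ee" unfolding ee_def[abs_def] by (rule C2_on_vec_exp)
  then have "C2_on UNIV (\<lambda>y. J (ee y))"
    by (rule C2_on_compose[OF C2_on_bounded_linear[OF bl(2)] _ subset_UNIV])
  moreover have "C2_on UNIV (\<lambda>y :: real^'n. J c)"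
    by (rule C2_onI[where D = "\<lambda>_. 0" and E = "\<lambda>_. 0"]) (auto simp: zero_blinfun.rep_eq)
  ultimately show ?thesis
    unfolding eq by (intro C2_on_add C2_on_bounded_linear[OF bl(1)])
qed

lemma \<Phi>_has_derivative: "(\<Phi> has_derivative d\<Phi> y) (at y)"
proof -
  have e: "(ee has_derivative (\<lambda>v. \<chi> j. 2 * ee y $ j * v $ j)) (at y)"
    using vec_exp_has_derivative[of r 2 y] by (simp add: ee_def[abs_def])
  have Q: "bounded_linear Q" "bounded_linear J"
    using linQ linJ by (simp_all add: linear_conv_bounded_linear)
  have "((\<lambda>y. Q y + J (ee y + c)) has_derivative (\<lambda>v. Q v + J ((\<chi> j. 2 * ee y $ j * v $ j) + 0))) (at y)"
    by (intro has_derivative_add bounded_linear_imp_has_derivative Q(1) bounded_linear.has_derivative[OF Q(2)]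
        e has_derivative_const)
  then show ?thesis by (simp add: \<Phi>_def[abs_def] d\<Phi>_def[abs_def])
qed

end

section \<open>Lattice points near the span of a face\<close>

lemma full_lattice_scale_int:
  assumes L: "full_lattice L" and x: "x \<in> L"
  shows "real_of_int k *\<^sub>R x \<in> L"
proof -
  have nat: "real n *\<^sub>R x \<in> L" for n
    using x by (induction n) (auto simp: scaleR_left_distrib full_lattice_subgroup[OF L])
  show ?thesis
  proof (cases k)
    case (nonneg n)
    with nat[of n] show ?thesis by simp
  next
    case (neg n)
    then have "real_of_int k *\<^sub>R x = - (real (Suc n) *\<^sub>R x)"
      by (simp add: scaleR_left_diff_distrib scaleR_left_distrib)
    with full_lattice_subgroup(3)[OF L nat[of "Suc n"]] show ?thesis by simp
  qed
qed

lemma full_lattice_sum: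
  assumes L: "full_lattice L" and g: "\<And>j. g j \<in> L"
  shows "(\<Sum>j\<in>X. g j) \<in> L"
  by (induction X rule: infinite_finite_induct) (auto simp: g full_lattice_subgroup[OF L])

lemma finite_bounded_lattice:
  fixes L :: "'g::euclidean_space set"
  assumes "full_lattice L"
  shows "finite {l \<in> L. norm l \<le> K}"
proof -
  obtain b where b: "independent b" "L = range (\<lambda>c :: 'g \<Rightarrow> int. \<Sum>v\<in>b. real_of_int (c v) *\<^sub>R v)"
    using assms by (auto simp: full_lattice_def)
  have fin: "finite b" using b(1) by (rule independent_bound[THEN conjunct1])
  define f where "f v = (SOME g :: 'g \<Rightarrow> real. linear g \<and> (\<forall>x\<in>b. g x = (if x = v then 1 else 0)))" for v
  have f': "linear (f v) \<and> (\<forall>x\<in>b. f v x = (if x = v then 1 else 0))" for v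
    using linear_independent_extend[OF b(1), of "\<lambda>x. if x = v then 1 else (0::real)"]
    unfolding f_def by (rule someI_ex)
  then have f: "\<And>v. linear (f v)" "\<And>v x. x \<in> b \<Longrightarrow> f v x = (if x = v then 1 else 0)" by blast+
  have "\<exists>C. \<forall>x. norm (f v x) \<le> norm x * C" for v
    using bounded_linear.bounded[of "f v"] f(1) by (simp add: linear_conv_bounded_linear)
  then obtain C where C: "\<And>v x. norm (f v x) \<le> norm x * C v" by metis
  define M where "M v = \<lceil>\<bar>K\<bar> * \<bar>C v\<bar>\<rceil>" for v
  have "{l \<in> L. norm l \<le> K} \<subseteq> (\<lambda>c. \<Sum>v\<in>b. real_of_int (c v) *\<^sub>R v) ` (PiE b (\<lambda>v. {- M v .. M v}))"
  proof
    fix l assume l: "l \<in> {l \<in> L. norm l \<le> K}"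
    then obtain c where c: "l = (\<Sum>v\<in>b. real_of_int (c v) *\<^sub>R v)" by (auto simp: b(2))
    have "c v \<in> {- M v .. M v}" if v: "v \<in> b" for v
    proof -
      have "f v l = (\<Sum>x\<in>b. real_of_int (c x) * (if x = v then 1 else 0))"
        unfolding c by (simp add: linear_sum[OF f(1)] linear_scale[OF f(1)] f(2))
      also have "\<dots> = real_of_int (c v)" using v fin by (simp add: if_distrib cong: if_cong)
      finally have "\<bar>real_of_int (c v)\<bar> \<le> norm l * C v" using C[of v l] by simp
      also have "norm l * C v \<le> norm l * \<bar>C v\<bar>" by (rule mult_left_mono) simp_all
      also have "norm l * \<bar>C v\<bar> \<le> \<bar>K\<bar> * \<bar>C v\<bar>" using l by (intro mult_right_mono) auto
      also have "\<bar>K\<bar> * \<bar>C v\<bar> \<le> real_of_int (M v)" unfolding M_def by linarith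
      finally show ?thesis by auto
    qed
    then show "l \<in> (\<lambda>c. \<Sum>v\<in>b. real_of_int (c v) *\<^sub>R v) ` (PiE b (\<lambda>v. {- M v .. M v}))"
      by (intro image_eqI[of _ _ "restrict c b"]) (auto simp: c)
  qed
  then show ?thesis by (rule finite_subset) (intro finite_imageI finite_PiE fin finite_atLeastAtMost_int)
qed

text \<open>The lattice is discrete also modulo the span of the \<open>u\<^sub>j\<close> with \<open>j \<in> I\<close>, because these vectors belong to
  it: modulo integral combinations of them, only bounded lattice vectors have to be considered.\<close>

lemma lattice_discrete_mod_face:
  fixes u :: "'n::finite \<Rightarrow> 'g::euclidean_space"
  assumes L: "full_lattice L" and u: "\<And>j. u j \<in> L"
  obtains \<epsilon> where "\<epsilon> > 0"
    "\<And>\<delta> c. norm \<delta> < \<epsilon> \<Longrightarrow> c \<in> supported I \<Longrightarrow> A_map u (\<delta> - c) \<in> L \<Longrightarrow> \<delta> \<in> lie_kI u I"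
proof -
  define A where "A = blinfun_apply (A_map u)"
  have lin: "linear A" unfolding A_def by (rule bounded_linear.linear[OF blinfun.bounded_linear_right])
  define U where "U = A ` supported I"
  have U: "subspace U" unfolding U_def by (rule linear_subspace_image[OF lin subspace_supported])
  define K where "K = (\<Sum>j\<in>UNIV. norm (u j))"
  have K0: "K \<ge> 0" by (simp add: K_def sum_nonneg)
  have A_bound: "norm (A t) \<le> m * K" if "\<And>j. \<bar>t $ j\<bar> \<le> m" for t m
  proof -
    have "norm (A t) \<le> (\<Sum>j\<in>UNIV. norm (t $ j *\<^sub>R u j))" unfolding A_def A_map_apply by (rule norm_sum)
    also have "\<dots> \<le> (\<Sum>j\<in>UNIV. m * norm (u j))" using that by (intro sum_mono) (simp add: mult_right_mono)
    finally show ?thesis by (simp add: K_def sum_distrib_left)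
  qed
  \<comment> \<open>a lower bound for the distance from \<open>U\<close> of the bounded lattice vectors outside \<open>U\<close>; the \<open>1\<close> is for the case
    that there are none\<close>
  define d where "d = Min (insert 1 ((\<lambda>l. infdist l U) ` ({l \<in> L. norm l \<le> 2 * K} - U)))"
  have fin: "finite ({l \<in> L. norm l \<le> 2 * K} - U)" using finite_bounded_lattice[OF L] by blast
  have "0 < infdist l U" if "l \<notin> U" for l
    using that closed_subspace[OF U] subspace_0[OF U]
    by (metis empty_iff in_closed_iff_infdist_zero infdist_nonneg order_le_less)
  then have d0: "d > 0" using fin by (auto simp: d_def)
  define \<epsilon> where "\<epsilon> = min 1 (d / (K + 1))"
  show ?thesis
  proof (rule that)
    show "\<epsilon> > 0" using d0 K0 by (simp add: \<epsilon>_def)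
    fix \<delta> c assume \<delta>: "norm \<delta> < \<epsilon>" and c: "c \<in> supported I" and l: "blinfun_apply (A_map u) (\<delta> - c) \<in> L"
    \<comment> \<open>replacing \<open>c\<close> by its fractional parts changes \<open>A (\<delta> - c)\<close> by a lattice vector and makes it bounded\<close>
    define c' where "c' = (\<chi> j. frac (c $ j))"
    have c': "c' \<in> supported I" using c by (simp add: c'_def supported_def)
    have int: "A (c - c') \<in> L"
    proof -
      have "A (c - c') = (\<Sum>j\<in>UNIV. real_of_int \<lfloor>c $ j\<rfloor> *\<^sub>R u j)"
        by (simp add: A_def A_map_apply c'_def frac_def)
      also have "\<dots> \<in> L" using u by (intro full_lattice_sum[OF L] full_lattice_scale_int[OF L])
      finally show ?thesis .
    qed
    have "A (\<delta> - c) + A (c - c') \<in> L" using l int by (intro full_lattice_subgroup(2)[OF L]) (simp_all add: A_def)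
    then have lL: "A (\<delta> - c') \<in> L" by (simp add: linear_diff[OF lin])
    have \<delta>j: "\<bar>\<delta> $ j\<bar> \<le> norm \<delta>" for j using component_le_norm_cart[of \<delta> j] by simp
    have "A (\<delta> - c') \<in> U"
    proof (rule ccontr)
      assume nU: "A (\<delta> - c') \<notin> U"
      have "\<bar>(\<delta> - c') $ j\<bar> \<le> 2" for j
      proof -
        have "\<bar>\<delta> $ j\<bar> < 1" using \<delta>j[of j] \<delta> by (simp add: \<epsilon>_def)
        moreover have "0 \<le> frac (c $ j)" "frac (c $ j) < 1" by (simp_all add: frac_lt_1)
        ultimately have "\<bar>\<delta> $ j - frac (c $ j)\<bar> \<le> 2" by linarith
        then show ?thesis by (simp add: c'_def)
      qed
      then have "norm (A (\<delta> - c')) \<le> 2 * K" by (rule A_bound)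
      with lL nU fin have "d \<le> infdist (A (\<delta> - c')) U" by (auto simp: d_def intro!: Min_le)
      also have "\<dots> \<le> dist (A (\<delta> - c')) (A (- c'))"
        using c' subspace_neg[OF subspace_supported] by (intro infdist_le) (auto simp: U_def)
      also have "\<dots> = norm (A \<delta>)" by (simp add: dist_norm linear_diff[OF lin] linear_neg[OF lin])
      also have "\<dots> \<le> norm \<delta> * K" using \<delta>j by (rule A_bound)
      also have "\<dots> \<le> norm \<delta> * (K + 1)" by (simp add: mult_left_mono)
      also have "\<dots> < d" using \<delta> K0 by (simp add: \<epsilon>_def pos_less_divide_eq)
      finally show False by simp
    qed
    then obtain e where e: "e \<in> supported I" "A (\<delta> - c') = A e" by (auto simp: U_def)
    have "\<delta> - c' - e \<in> lie_k u"
      using e(2) by (simp add: lie_k_def A_def blinfun.bilinear_simps)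
    then show "\<delta> \<in> lie_kI u I"
      using c' e(1) by (auto simp: lie_kI_def supported_def intro!: bexI[of _ "\<delta> - c' - e"])
  qed
qed

section \<open>Holomorphic charts of the quotient\<close>

lemma vertical_vectorI:
  assumes lam: "\<forall>j\<in>I. lam j = 0" and z: "z \<in> Z_face u lam I" and t: "t \<in> lie_kI u I"
  shows "(\<chi> j. \<i> * of_real (t $ j) * z $ j) \<in> vertical_space u z"
proof -
  have "\<forall>j\<in>I. z $ j = 0" using z by (simp add: Z_face_iff[OF lam])
  then show ?thesis using t by (auto simp: vertical_space_iff)
qed

text \<open>The chart around the orbit of \<open>z\<close> has the lift \<open>s(w)\<^sub>j = z\<^sub>j exp(y\<^sub>j + \<i> Im w\<^sub>j)\<close>, where \<open>y\<close> is the
  solution of \<open>\<Phi> y = Re w\<close>.  For \<open>j \<in> I\<close>, where \<open>z\<^sub>j = 0\<close>, the coefficients \<open>r\<^sub>j = 1\<close> and \<open>c\<^sub>j = -1\<close> keep \<open>r\<close>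
  positive without changing anything on the stratum: since \<open>lie_kI\<close> contains \<open>\<real>\<^sup>I\<close>, they only force \<open>y\<^sub>j = 0\<close>.  The
  bound \<open>\<epsilon>\<close> on \<open>Im w\<close> makes the chart injective.\<close>

locale face_slice = slice_map "lie_kI u I" B Q r c
  for L :: "'g::euclidean_space set" and u :: "'n::finite \<Rightarrow> 'g" and lam :: "'n \<Rightarrow> real"
    and I B :: "'n set" and Q :: "real^'n \<Rightarrow> real^'n" and r c :: "real^'n"
    and z :: "complex^'n" and \<epsilon> :: real +
  assumes L: "full_lattice L" and uL: "\<And>j. u j \<in> L" and lam: "\<forall>j\<in>I. lam j = 0"
    and z: "z \<in> Z_face u lam I"
    and r_eq: "r = (\<chi> j. if j \<in> I then 1 else (cmod (z $ j))\<^sup>2)"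
    and c_eq: "c = (\<chi> j. if j \<in> I then -1 else lam j)"
    and \<epsilon>: "\<epsilon> > 0"
      "\<And>\<delta> k. norm \<delta> < \<epsilon> \<Longrightarrow> k \<in> supported I \<Longrightarrow> A_map u (\<delta> - k) \<in> L \<Longrightarrow> \<delta> \<in> lie_kI u I"
begin

definition Rv :: "complex^'n \<Rightarrow> real^'n" where "Rv w = (\<chi> j. Re (w $ j))"
definition Iv :: "complex^'n \<Rightarrow> real^'n" where "Iv w = (\<chi> j. Im (w $ j))"

definition expo :: "complex^'n \<Rightarrow> complex^'n" where
  "expo w = (\<chi> j. Complex (inv \<Phi> (Rv w) $ j) (Iv w $ j))"

definition s :: "complex^'n \<Rightarrow> complex^'n" where
  "s w = (\<chi> j. z $ j * exp (expo w $ j))"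

definition W :: "(complex^'n) set" where
  "W = coord_space B \<inter> {w. Rv w \<in> range \<Phi> \<and> norm (Iv w) < \<epsilon>}"

lemma z_zero_iff: "z $ j = 0 \<longleftrightarrow> j \<in> I"
  using z by (simp add: Z_face_iff[OF lam])

lemma Rv_linear: "bounded_linear Rv" and Iv_linear: "bounded_linear Iv"
  unfolding linear_conv_bounded_linear[symmetric]
  by (auto intro!: linearI simp: Rv_def Iv_def vec_eq_iff)

lemma coord_space_iff: "w \<in> coord_space B \<longleftrightarrow> Rv w \<in> supported B \<and> Iv w \<in> supported B"
  by (auto simp: coord_space_def supported_def Rv_def Iv_def complex_eq_iff)

lemma ee_nth: "ee y $ j = (if j \<in> I then 1 else (cmod (z $ j))\<^sup>2) * exp (2 * y $ j)"
  unfolding ee_def by (simp add: r_eq)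

lemma c_nth: "c $ j = (if j \<in> I then -1 else lam j)"
  by (simp add: c_eq)

lemma slice_solution:
  assumes w: "Rv w \<in> range \<Phi>" "Rv w \<in> supported B"
  defines "y \<equiv> inv \<Phi> (Rv w)"
  shows "\<Phi> y = Rv w" "j \<in> I \<Longrightarrow> y $ j = 0"
    "t \<in> lie_kI u I \<Longrightarrow> (\<Sum>j\<in>UNIV. ((cmod (z $ j))\<^sup>2 * exp (2 * y $ j) + lam j) * t $ j) = 0"
proof -
  show y: "\<Phi> y = Rv w" using w(1) by (simp add: y_def f_inv_into_f)
  have sol: "(\<Sum>j\<in>UNIV. (ee y $ j + c $ j) * t $ j) = 0" if "t \<in> lie_kI u I" for t
    using \<Phi>_eq_iff[of y "Rv w"] y Q_id[OF w(2)] that by simp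
  show y0: "y $ j = 0" if "j \<in> I" for j
    using sol[OF axis_in_lie_kI[OF that, of 1]] that by (simp add: sum_axis ee_nth c_nth)
  have "(ee y $ j + c $ j) = (cmod (z $ j))\<^sup>2 * exp (2 * y $ j) + lam j" for j
    using lam z_zero_iff y0[of j] by (auto simp: ee_nth c_nth)
  then show "(\<Sum>j\<in>UNIV. ((cmod (z $ j))\<^sup>2 * exp (2 * y $ j) + lam j) * t $ j) = 0" if "t \<in> lie_kI u I"
    using sol[OF that] by simp
qed

lemma norm_s: "(cmod (s w $ j))\<^sup>2 = (cmod (z $ j))\<^sup>2 * exp (2 * inv \<Phi> (Rv w) $ j)"
  by (simp add: s_def expo_def norm_mult power_mult_distrib exp_double[symmetric] mult.commute)

lemma s_in_Z:
  assumes "w \<in> W"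
  shows "s w \<in> Z_face u lam I"
  using assms slice_solution(3)[of w]
  unfolding Z_face_iff[OF lam] norm_s by (auto simp: W_def coord_space_iff s_def z_zero_iff)

lemma Phi_0: "\<Phi> 0 = 0"
proof -
  have "(\<Sum>j\<in>UNIV. (ee 0 $ j + c $ j) * t $ j) = 0" if t: "t \<in> lie_kI u I" for t
  proof -
    have "(\<Sum>j\<in>UNIV. (ee 0 $ j + c $ j) * t $ j) = (\<Sum>j\<in>UNIV. ((cmod (z $ j))\<^sup>2 + lam j) * t $ j)"
      using lam z_zero_iff by (intro sum.cong refl) (auto simp: ee_nth c_nth)
    then show ?thesis using z t by (simp add: Z_face_iff[OF lam])
  qed
  then have "\<Phi> 0 = Q 0" unfolding \<Phi>_eq_iff using subspace_0[OF subspace_lie_kI] by simp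
  then show ?thesis by (simp add: linear_0[OF linQ])
qed

lemma s_0: "0 \<in> W" "s 0 = z"
proof -
  have 0: "Rv 0 = 0" "Iv 0 = 0" by (simp_all add: Rv_def Iv_def vec_eq_iff)
  then show "0 \<in> W"
    using Phi_0 \<epsilon>(1) subspace_0[OF subspace_coord_space] by (auto simp: W_def intro: range_eqI[of _ _ 0])
  have "inv \<Phi> 0 = 0" using inv_f_f[OF inj_\<Phi>, of 0] Phi_0 by simp
  then show "s 0 = z" by (simp add: s_def expo_def 0 vec_eq_iff Complex_eq)
qed

text \<open>The moduli of the coordinates determine \<open>Re w\<close>.  If the points for \<open>w\<close> and \<open>w'\<close> are in one orbit, then
  \<open>A\<close> maps \<open>Im w' - Im w\<close>, in units of \<open>2\<pi>\<close>, into the lattice modulo the span of the \<open>u\<^sub>j\<close> with \<open>j \<in> I\<close>.  As it is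
  small, it belongs to \<open>lie_kI\<close>, and as it is supported in \<open>B\<close>, it is zero.\<close>

lemma inj_on_orbits: "inj_on (\<lambda>w. K_orbit L u (s w)) W"
proof (rule inj_onI)
  fix w w' assume w: "w \<in> W" "w' \<in> W" and eq: "K_orbit L u (s w) = K_orbit L u (s w')"
  have wB: "Rv w \<in> supported B" "Iv w \<in> supported B" "Rv w' \<in> supported B" "Iv w' \<in> supported B"
    "Rv w \<in> range \<Phi>" "Rv w' \<in> range \<Phi>"
    using w by (auto simp: W_def coord_space_iff)
  have "s w' \<in> K_orbit L u (s w)" using mem_K_orbit_self[OF L] eq by simp
  then obtain \<tau> where \<tau>: "A_map u \<tau> \<in> L" "s w' = act (torus_exp \<tau>) (s w)"
    by (auto simp: K_orbit_def group_K_def)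
  have comp: "z $ j * exp (expo w' $ j) = cis (2 * pi * \<tau> $ j) * (z $ j * exp (expo w $ j))" for j
    using arg_cong[OF \<tau>(2), of "\<lambda>x. x $ j"] by (simp add: s_def torus_exp_def)
  have "inv \<Phi> (Rv w') $ j = inv \<Phi> (Rv w) $ j" for j
  proof (cases "j \<in> I")
    case True
    then show ?thesis using slice_solution(2)[OF wB(5,1)] slice_solution(2)[OF wB(6,3)] by simp
  next
    case False
    then show ?thesis using arg_cong[OF comp[of j], of cmod] z_zero_iff[of j] by (simp add: norm_mult expo_def)
  qed
  then have y: "inv \<Phi> (Rv w') = inv \<Phi> (Rv w)" by (simp add: vec_eq_iff)
  then have R: "Rv w' = Rv w" using slice_solution(1)[OF wB(5,1)] slice_solution(1)[OF wB(6,3)] by simp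
  have "\<exists>n::int. Iv w' $ j - Iv w $ j = 2 * pi * (\<tau> $ j + real_of_int n)" if "j \<notin> I" for j
  proof -
    have "exp (expo w' $ j) = exp (\<i> * of_real (2 * pi * \<tau> $ j) + expo w $ j)"
      using comp[of j] z_zero_iff[of j] that by (simp add: exp_add cis_conv_exp)
    then obtain n :: int where "expo w' $ j = (\<i> * of_real (2 * pi * \<tau> $ j) + expo w $ j) + of_int (2 * n) * (of_real pi * \<i>)"
      unfolding exp_eq by auto
    from arg_cong[OF this, of Im] show ?thesis by (intro exI[of _ n]) (simp add: expo_def algebra_simps)
  qed
  then obtain n :: "'n \<Rightarrow> int" where n: "\<And>j. j \<notin> I \<Longrightarrow> Iv w' $ j - Iv w $ j = 2 * pi * (\<tau> $ j + real_of_int (n j))"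
    by metis
  define \<delta> where "\<delta> = (1 / (2 * pi)) *\<^sub>R (Iv w' - Iv w)"
  \<comment> \<open>such that \<open>\<delta> - k\<close> is \<open>\<tau>\<close> up to the integers \<open>m\<close>\<close>
  define k where "k = (\<chi> j. if j \<in> I then \<delta> $ j - \<tau> $ j else 0)"
  define m where "m = (\<chi> j. if j \<in> I then 0 else real_of_int (n j))"
  have "norm \<delta> < \<epsilon>"
  proof -
    have "norm (Iv w' - Iv w) \<le> norm (Iv w') + norm (Iv w)" by (rule norm_triangle_ineq4)
    also have "\<dots> < 2 * \<epsilon>" using w by (simp add: W_def)
    also have "\<dots> \<le> 2 * \<epsilon> * pi" using \<epsilon>(1) pi_gt3 by simp
    finally have "norm (Iv w' - Iv w) / (2 * pi) < \<epsilon>" by (simp add: pos_divide_less_eq mult_ac)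
    then show ?thesis by (simp only: \<delta>_def norm_scaleR) simp
  qed
  moreover have "k \<in> supported I" by (simp add: k_def supported_def)
  moreover have "A_map u (\<delta> - k) \<in> L"
  proof -
    have "\<delta> - k = \<tau> + m"
      using n by (auto simp: vec_eq_iff k_def m_def \<delta>_def)
    moreover have "A_map u m \<in> L"
    proof -
      have "A_map u m = (\<Sum>j\<in>UNIV. real_of_int (if j \<in> I then 0 else n j) *\<^sub>R u j)"
        unfolding A_map_apply by (intro sum.cong refl) (simp add: m_def)
      also have "\<dots> \<in> L" using uL by (intro full_lattice_sum[OF L] full_lattice_scale_int[OF L])
      finally show ?thesis .
    qed
    ultimately show ?thesis using \<tau>(1) by (simp add: blinfun.add_right full_lattice_subgroup[OF L])
  qed
  ultimately have "\<delta> \<in> lie_kI u I" by (rule \<epsilon>(2))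
  moreover have "\<delta> \<in> supported B"
    unfolding \<delta>_def using wB by (intro subspace_scale[OF subspace_supported] subspace_diff[OF subspace_supported])
  ultimately have "\<delta> = 0" using Q_id Q_eq_0 by metis
  then have "Iv w' = Iv w" by (simp add: \<delta>_def)
  with R show "w = w'" by (simp add: vec_eq_iff Rv_def Iv_def complex_eq_iff)
qed

text \<open>The differential of \<open>s\<close> at \<open>w\<close> multiplies \<open>s w\<close> by \<open>v + \<i> Im \<xi>\<close>, where \<open>v = H y (Re \<xi>)\<close> differs from
  \<open>Re \<xi>\<close> by an element of \<open>lie_kI\<close>.\<close>

definition H :: "real^'n \<Rightarrow> real^'n \<Rightarrow> real^'n" where
  "H = (SOME H. \<forall>y. (inv \<Phi> has_derivative H y) (at (\<Phi> y)) \<and> (\<forall>v. d\<Phi> y (H y v) = v))"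

lemma inverse_\<Phi>:
  shows "open (range \<Phi>)" "C2_on (range \<Phi>) (inv \<Phi>)"
    "(inv \<Phi> has_derivative H y) (at (\<Phi> y))" "d\<Phi> y (H y v) = v"
proof -
  have "open (range \<Phi>) \<and> C2_on (range \<Phi>) (inv \<Phi>) \<and>
      (\<exists>H. \<forall>y. (inv \<Phi> has_derivative H y) (at (\<Phi> y)) \<and> (\<forall>v. d\<Phi> y (H y v) = v))"
    by (rule inverse_of_injective_C2_map[OF C2_\<Phi> inj_\<Phi> \<Phi>_has_derivative d\<Phi>_eq_0]; blast)
  then show "open (range \<Phi>)" "C2_on (range \<Phi>) (inv \<Phi>)"
    "(inv \<Phi> has_derivative H y) (at (\<Phi> y))" "d\<Phi> y (H y v) = v"
    using someI_ex[of "\<lambda>H. \<forall>y. (inv \<Phi> has_derivative H y) (at (\<Phi> y)) \<and> (\<forall>v. d\<Phi> y (H y v) = v)", folded H_def]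
    by blast+
qed

definition dexpo :: "complex^'n \<Rightarrow> complex^'n \<Rightarrow> complex^'n" where
  "dexpo w \<xi> = (\<chi> j. Complex (H (inv \<Phi> (Rv w)) (Rv \<xi>) $ j) (Iv \<xi> $ j))"

definition ds :: "complex^'n \<Rightarrow> complex^'n \<Rightarrow> complex^'n" where
  "ds w \<xi> = (\<chi> j. s w $ j * dexpo w \<xi> $ j)"

lemma s_smooth:
  assumes w: "w \<in> W"
  shows "(s has_derivative ds w) (at w)" and "C2_on W s"
proof -
  have s_eq: "s = (\<lambda>w. \<chi> j. z $ j * exp (1 * expo w $ j))" by (simp add: s_def fun_eq_iff)
  define e1 e2 :: "real^'n \<Rightarrow> complex^'n" where "e1 y = (\<chi> j. of_real (y $ j))" and "e2 y = (\<chi> j. \<i> * of_real (y $ j))" for y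
  have bl: "bounded_linear e1" "bounded_linear e2"
    unfolding linear_conv_bounded_linear[symmetric] e1_def e2_def
    by (auto intro!: linearI simp: vec_eq_iff algebra_simps scaleR_conv_of_real[where 'a = complex])
  have expo_eq: "expo = (\<lambda>w. e1 (inv \<Phi> (Rv w)) + e2 (Iv w))"
    by (simp add: fun_eq_iff expo_def e1_def e2_def vec_eq_iff Complex_eq)
  have "\<Phi> (inv \<Phi> (Rv w)) = Rv w" using w by (auto simp: W_def f_inv_into_f)
  then have dinv: "(inv \<Phi> has_derivative H (inv \<Phi> (Rv w))) (at (Rv w))"
    using inverse_\<Phi>(3)[of "inv \<Phi> (Rv w)"] by simp
  have "((\<lambda>w. inv \<Phi> (Rv w)) has_derivative (\<lambda>\<xi>. H (inv \<Phi> (Rv w)) (Rv \<xi>))) (at w)"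
    by (rule has_derivative_compose[OF bounded_linear_imp_has_derivative[OF Rv_linear] dinv])
  then have "(expo has_derivative (\<lambda>\<xi>. e1 (H (inv \<Phi> (Rv w)) (Rv \<xi>)) + e2 (Iv \<xi>))) (at w)"
    unfolding expo_eq
    by (intro has_derivative_add bounded_linear.has_derivative[OF bl(1)] bounded_linear.has_derivative[OF bl(2)]
        bounded_linear_imp_has_derivative[OF Iv_linear])
  moreover have "(\<lambda>\<xi>. e1 (H (inv \<Phi> (Rv w)) (Rv \<xi>)) + e2 (Iv \<xi>)) = dexpo w"
    by (simp add: fun_eq_iff dexpo_def e1_def e2_def vec_eq_iff Complex_eq)
  ultimately have "(expo has_derivative dexpo w) (at w)" by simp
  from has_derivative_compose[OF this vec_exp_has_derivative[of z 1 "expo w"]]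
  show "(s has_derivative ds w) (at w)"
    unfolding s_eq by (rule has_derivative_eq_rhs) (simp add: fun_eq_iff ds_def s_def vec_eq_iff)
  have "C2_on W (\<lambda>w. inv \<Phi> (Rv w))"
    by (rule C2_on_compose[OF inverse_\<Phi>(2) C2_on_bounded_linear[OF Rv_linear]]) (auto simp: W_def)
  from C2_on_compose[OF C2_on_bounded_linear[OF bl(1)] this subset_UNIV]
    C2_on_compose[OF C2_on_bounded_linear[OF bl(2)] C2_on_bounded_linear[OF Iv_linear] subset_UNIV]
  have "C2_on W expo" unfolding expo_eq by (rule C2_on_add)
  from C2_on_compose[OF C2_on_vec_exp this subset_UNIV]
  show "C2_on W s" unfolding s_eq .
qed

lemma openin_W: "openin (top_of_set (coord_space B)) W"
proof -
  have "open (Rv -` range \<Phi>)"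
    by (rule open_vimage[OF inverse_\<Phi>(1) linear_continuous_on[OF Rv_linear]])
  moreover have "open {w. norm (Iv w) < \<epsilon>}"
    by (intro open_Collect_less continuous_intros linear_continuous_on[OF Iv_linear])
  ultimately have "open (Rv -` range \<Phi> \<inter> {w. norm (Iv w) < \<epsilon>})" by (rule open_Int)
  moreover have "W = coord_space B \<inter> (Rv -` range \<Phi> \<inter> {w. norm (Iv w) < \<epsilon>})"
    by (auto simp: W_def)
  ultimately show ?thesis by (auto simp: openin_open)
qed

text \<open>The linearized equations of the slice are the equations of the tangent space of \<open>Z\<close> for vectors that are
  real multiples of the coordinates of \<open>s w\<close>.\<close>

lemma slice_tangent_iff:
  assumes w: "w \<in> W"
  shows "(\<forall>t\<in>lie_kI u I. (\<Sum>j\<in>UNIV. ee (inv \<Phi> (Rv w)) $ j * a $ j * t $ j) = 0) \<longleftrightarrow>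
    (\<forall>j\<in>I. a $ j = 0) \<and> (\<forall>t\<in>lie_kI u I. (\<Sum>j\<in>UNIV. (cmod (s w $ j))\<^sup>2 * a $ j * t $ j) = 0)" (is "?l \<longleftrightarrow> ?r")
proof -
  have y0: "inv \<Phi> (Rv w) $ j = 0" if "j \<in> I" for j
    using slice_solution(2)[of w j] w that by (simp add: W_def coord_space_iff)
  have eq: "(\<Sum>j\<in>UNIV. ee (inv \<Phi> (Rv w)) $ j * a $ j * t $ j) = (\<Sum>j\<in>UNIV. (cmod (s w $ j))\<^sup>2 * a $ j * t $ j)"
    if "\<forall>j\<in>I. a $ j = 0" for t
    using that by (intro sum.cong refl) (auto simp: ee_nth norm_s)
  show ?thesis
  proof
    assume l: ?l
    have "a $ j = 0" if "j \<in> I" for j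
    proof -
      have "(\<Sum>i\<in>UNIV. (ee (inv \<Phi> (Rv w)) $ i * a $ i) * axis j 1 $ i) = 0"
        using l axis_in_lie_kI[OF that, of 1] by blast
      then show ?thesis using y0[OF that] that unfolding sum_axis by (simp add: ee_nth)
    qed
    then have "\<forall>j\<in>I. a $ j = 0" by blast
    with l eq show ?r by auto
  qed (use eq in auto)
qed

lemma inner_s: "s w $ j \<bullet> (s w $ j * Complex a b) = (cmod (s w $ j))\<^sup>2 * a"
  unfolding cmod_power2 by (simp add: inner_complex_def algebra_simps power2_eq_square)

lemma H_properties:
  assumes w: "w \<in> W" and \<rho>: "\<rho> \<in> supported B"
  defines "v \<equiv> H (inv \<Phi> (Rv w)) \<rho>"
  shows "v - \<rho> \<in> lie_kI u I"
    "(\<forall>j\<in>I. v $ j = 0) \<and> (\<forall>t\<in>lie_kI u I. (\<Sum>j\<in>UNIV. (cmod (s w $ j))\<^sup>2 * v $ j * t $ j) = 0)"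
proof -
  have "d\<Phi> (inv \<Phi> (Rv w)) v = Q \<rho>" unfolding v_def using inverse_\<Phi>(4) Q_id[OF \<rho>] by simp
  then show "v - \<rho> \<in> lie_kI u I"
    "(\<forall>j\<in>I. v $ j = 0) \<and> (\<forall>t\<in>lie_kI u I. (\<Sum>j\<in>UNIV. (cmod (s w $ j))\<^sup>2 * v $ j * t $ j) = 0)"
    unfolding d\<Phi>_eq_iff slice_tangent_iff[OF w] by blast+
qed

lemma H_Q:
  assumes w: "w \<in> W" and a: "\<forall>j\<in>I. a $ j = 0"
    "\<forall>t\<in>lie_kI u I. (\<Sum>j\<in>UNIV. (cmod (s w $ j))\<^sup>2 * a $ j * t $ j) = 0"
  shows "H (inv \<Phi> (Rv w)) (Q a) = a"
proof -
  define y where "y = inv \<Phi> (Rv w)"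
  have lin: "linear (d\<Phi> y)" using \<Phi>_has_derivative by (rule has_derivative_linear)
  have "d\<Phi> y a = Q a"
    unfolding d\<Phi>_eq_iff using slice_tangent_iff[OF w, of a] a subspace_0[OF subspace_lie_kI] by (simp add: y_def)
  then have "d\<Phi> y (H y (Q a) - a) = 0" using inverse_\<Phi>(4) by (simp add: linear_diff[OF lin])
  then have "H y (Q a) - a = 0" by (rule d\<Phi>_eq_0)
  then show ?thesis by (simp add: y_def)
qed

lemma ds_tangent:
  assumes w: "w \<in> W" and \<xi>: "\<xi> \<in> coord_space B"
  shows "ds w \<xi> \<in> tangent_space (Z_face u lam I) (s w)"
  using H_properties(2)[OF w, of "Rv \<xi>"] \<xi> z_zero_iff
  by (simp add: tangent_Z_face_iff[OF lam s_in_Z[OF w]] coord_space_iff ds_def dexpo_def inner_s) (simp add: s_def)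

lemma dchart_s:
  assumes w: "w \<in> W" and \<xi>: "\<xi> \<in> coord_space B"
  shows "dchart L u s w \<xi> = dproj L u (s w) (ds w \<xi>)"
  unfolding dchart_def dir_deriv_eqI[OF openin_W w \<xi> has_derivative_at_withinI[OF s_smooth(1)[OF w]] refl] ..

lemma s_zero_iff: "w \<in> W \<Longrightarrow> s w $ j = 0 \<longleftrightarrow> j \<in> I"
  by (simp add: s_def z_zero_iff)

text \<open>A tangent vector is \<open>s\<^sub>j (a\<^sub>j + \<i> b\<^sub>j)\<close>.  Here \<open>a\<close> is determined by \<open>Q a\<close>, and \<open>b\<close> is determined by \<open>Q b\<close> up to
  vertical vectors.\<close>

lemma bij_betw_dchart:
  assumes w: "w \<in> W"
  shows "bij_betw (dchart L u s w) (coord_space B) (quotient_tangent L u lam I (K_orbit L u (s w)))"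
  unfolding bij_betw_def
proof (intro conjI equalityI subsetI)
  note Z = s_in_Z[OF w]
  have trivial: "x = 0" if "x \<in> supported B" "x \<in> lie_kI u I" for x using that Q_id Q_eq_0 by metis
  show "inj_on (dchart L u s w) (coord_space B)"
  proof (rule inj_onI)
    fix \<xi> \<xi>' assume \<xi>: "\<xi> \<in> coord_space B" "\<xi>' \<in> coord_space B" and "dchart L u s w \<xi> = dchart L u s w \<xi>'"
    then have "ds w \<xi> - ds w \<xi>' \<in> vertical_space u (s w)"
      using dproj_eq_iff[OF L tangent_vanishes[OF lam Z ds_tangent[OF w \<xi>(2)]]] by (simp add: dchart_s[OF w])
    then obtain t where t: "t \<in> lie_kI u I" "\<And>j. (ds w \<xi> - ds w \<xi>') $ j = \<i> * of_real (t $ j) * s w $ j"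
      using s_zero_iff[OF w] vertical_space_iff[of I "s w"] by blast
    define v v' where "v = H (inv \<Phi> (Rv w)) (Rv \<xi>)" and "v' = H (inv \<Phi> (Rv w)) (Rv \<xi>')"
    have eq: "v $ j = v' $ j \<and> Iv \<xi> $ j - Iv \<xi>' $ j = t $ j" if "j \<notin> I" for j
    proof -
      have "s w $ j * (dexpo w \<xi> $ j - dexpo w \<xi>' $ j) = s w $ j * (\<i> * of_real (t $ j))"
        using t(2)[of j] by (simp add: ds_def algebra_simps)
      then have "dexpo w \<xi> $ j - dexpo w \<xi>' $ j = \<i> * of_real (t $ j)"
        using s_zero_iff[OF w] that by simp
      then show ?thesis by (simp add: dexpo_def complex_eq_iff v_def v'_def)
    qed
    have sB: "Rv \<xi> \<in> supported B" "Rv \<xi>' \<in> supported B" "Iv \<xi> \<in> supported B" "Iv \<xi>' \<in> supported B"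
      using \<xi> by (auto simp: coord_space_iff)
    have "v $ j = v' $ j" for j
      using eq[of j] H_properties(2)[OF w sB(1)] H_properties(2)[OF w sB(2)]
      by (cases "j \<in> I") (simp_all add: v_def v'_def)
    then have "v = v'" by (simp add: vec_eq_iff)
    then have "Rv \<xi> = Rv \<xi>'"
      using arg_cong[of v v' "d\<Phi> (inv \<Phi> (Rv w))"] unfolding v_def v'_def inverse_\<Phi>(4) by blast
    moreover have "Iv \<xi> - Iv \<xi>' \<in> lie_kI u I"
      using t(1) eq by (auto simp: lie_kI_def)
    then have "Iv \<xi> = Iv \<xi>'"
      using trivial subspace_diff[OF subspace_supported sB(3,4)] by fastforce
    ultimately show "\<xi> = \<xi>'" by (simp add: vec_eq_iff Rv_def Iv_def complex_eq_iff)
  qed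
  show "X \<in> quotient_tangent L u lam I (K_orbit L u (s w))" if "X \<in> dchart L u s w ` coord_space B" for X
  proof -
    from that obtain \<xi> where \<xi>: "\<xi> \<in> coord_space B" "X = dproj L u (s w) (ds w \<xi>)"
      by (auto simp: dchart_s[OF w])
    then show ?thesis
      unfolding quotient_tangent_def using ds_tangent[OF w \<xi>(1)] mem_K_orbit_self[OF L, of "s w" u] by blast
  qed
  fix X assume "X \<in> quotient_tangent L u lam I (K_orbit L u (s w))"
  then obtain v where v: "v \<in> tangent_space (Z_face u lam I) (s w)" "X = dproj L u (s w) v"
    by (rule quotient_tangentE[OF L lam Z])
  define a b :: "real^'n" where "a = (\<chi> j. Re (v $ j / s w $ j))" and "b = (\<chi> j. Im (v $ j / s w $ j))"
  have v_eq: "v $ j = s w $ j * Complex (a $ j) (b $ j)" for j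
    using tangent_vanishes[OF lam Z v(1)] by (cases "s w $ j = 0") (auto simp: a_def b_def complex_eq_iff[of "_ / _"] Complex_eq complex_eq[symmetric])
  have a: "\<forall>j\<in>I. a $ j = 0"
  proof
    fix j assume "j \<in> I"
    then have "s w $ j = 0" using s_zero_iff[OF w] by blast
    then show "a $ j = 0" by (simp add: a_def)
  qed
  have a': "\<forall>t\<in>lie_kI u I. (\<Sum>j\<in>UNIV. (cmod (s w $ j))\<^sup>2 * a $ j * t $ j) = 0"
    using v(1) unfolding tangent_Z_face_iff[OF lam Z] by (simp add: v_eq inner_s)
  define \<xi> :: "complex^'n" where "\<xi> = (\<chi> j. Complex (Q a $ j) (Q b $ j))"
  have RI: "Rv \<xi> = Q a" "Iv \<xi> = Q b" by (simp_all add: Rv_def Iv_def \<xi>_def vec_eq_iff)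
  have \<xi>B: "\<xi> \<in> coord_space B" by (simp add: coord_space_iff RI Q_supp)
  have "ds w \<xi> - v = (\<chi> j. \<i> * of_real ((Q b - b) $ j) * s w $ j)"
    by (simp add: vec_eq_iff ds_def dexpo_def RI H_Q[OF w a a'] v_eq Complex_eq algebra_simps)
  also have "\<dots> \<in> vertical_space u (s w)"
    using subspace_neg[OF subspace_lie_kI Q_diff[of b]] by (intro vertical_vectorI[OF lam Z]) simp
  finally have "dchart L u s w \<xi> = X"
    using dproj_eq_iff[OF L tangent_vanishes[OF lam Z v(1)]] by (simp add: dchart_s[OF w \<xi>B] v(2))
  then show "X \<in> dchart L u s w ` coord_space B" using \<xi>B by blast
qed

text \<open>The differential of \<open>s\<close> is complex linear up to \<open>V + \<i> V\<close>, by its formula.  The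
  deviation from \<open>\<i> h\<close> is tangent to \<open>Z\<close>, and tangent vectors are orthogonal to \<open>\<i> V\<close>, so that only a vertical vector is left.\<close>

lemma dchart_complex_linear:
  assumes w: "w \<in> W" and \<xi>: "\<xi> \<in> coord_space B"
  shows "dchart L u s w (\<i> *s \<xi>) = reduced_J L u lam I (dchart L u s w \<xi>)"
proof -
  note Z = s_in_Z[OF w]
  have \<xi>i: "\<i> *s \<xi> \<in> coord_space B" using \<xi> by (rule coord_space_i)
  obtain h y where hy: "h \<in> horizontal_space u lam I (s w)" "y \<in> vertical_space u (s w)" "ds w \<xi> = h + y"
    using tangent_decomposition[OF lam Z ds_tangent[OF w \<xi>]] .
  have ih: "\<i> *s h \<in> tangent_space (Z_face u lam I) (s w)"
    using horizontal_i[OF lam Z hy(1)] by (simp add: horizontal_space_def)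
  obtain t where t: "t \<in> lie_kI u I" "\<And>j. y $ j = \<i> * of_real (t $ j) * s w $ j"
    using hy(2) s_zero_iff[OF w] vertical_space_iff[of I "s w"] by blast
  have Ri: "Rv (\<i> *s \<xi>) = - Iv \<xi>" "Iv (\<i> *s \<xi>) = Rv \<xi>" by (simp_all add: Rv_def Iv_def vec_eq_iff)
  define v v' where "v = H (inv \<Phi> (Rv w)) (Rv \<xi>)" and "v' = H (inv \<Phi> (Rv w)) (- Iv \<xi>)"
  have sB: "Rv \<xi> \<in> supported B" "- Iv \<xi> \<in> supported B"
    using \<xi> subspace_neg[OF subspace_supported] by (auto simp: coord_space_iff)
  \<comment> \<open>\<open>ds w (\<i> \<xi>) - \<i> h\<close> has the part \<open>- \<i> \<kappa> s\<close>, which is vertical, and the part \<open>m s\<close>, which will turn out to vanish\<close>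
  define \<kappa> m where "\<kappa> = v - Rv \<xi>" and "m = (v' - - Iv \<xi>) - t"
  have \<kappa>m: "\<kappa> \<in> lie_kI u I" "m \<in> lie_kI u I"
    using H_properties(1)[OF w sB(1)] H_properties(1)[OF w sB(2)] t(1)
    by (auto simp: \<kappa>_def m_def v_def v'_def intro!: subspace_diff[OF subspace_lie_kI])
  define x where "x = (\<chi> j. \<i> * of_real (\<kappa> $ j) * s w $ j)"
  have x: "x \<in> vertical_space u (s w)" unfolding x_def by (rule vertical_vectorI[OF lam Z \<kappa>m(1)])
  have h_eq: "h $ j = s w $ j * dexpo w \<xi> $ j - \<i> * of_real (t $ j) * s w $ j" for j
    using arg_cong[OF hy(3), of "\<lambda>v. v $ j"] by (simp add: ds_def t(2))
  have e: "ds w (\<i> *s \<xi>) - \<i> *s h + x = (\<chi> j. s w $ j * of_real (m $ j))"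
    by (simp add: vec_eq_iff ds_def h_eq x_def dexpo_def Ri v_def[symmetric] v'_def[symmetric] \<kappa>_def m_def Complex_eq algebra_simps)
  have "ds w (\<i> *s \<xi>) - \<i> *s h + x \<in> tangent_space (Z_face u lam I) (s w)"
    using ds_tangent[OF w \<xi>i] ih x vertical_subset_tangent[OF lam Z]
    by (intro subspace_add[OF subspace_tangent[OF lam Z]] subspace_diff[OF subspace_tangent[OF lam Z]]) auto
  then have "(\<Sum>j\<in>UNIV. (s w $ j \<bullet> (s w $ j * of_real (m $ j))) * m $ j) = 0"
    unfolding e tangent_Z_face_iff[OF lam Z] using \<kappa>m(2) by simp
  then have "(\<Sum>j\<in>UNIV. (cmod (s w $ j) * m $ j)\<^sup>2) = 0"
    unfolding complex_of_real_def inner_s by (simp add: power_mult_distrib power2_eq_square mult_ac)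
  then have "(cmod (s w $ j) * m $ j)\<^sup>2 = 0" for j by (simp add: sum_nonneg_eq_0_iff)
  then have "s w $ j * of_real (m $ j) = 0" for j by auto
  then have "ds w (\<i> *s \<xi>) - \<i> *s h + x = 0" unfolding e by (simp add: vec_eq_iff)
  then have "ds w (\<i> *s \<xi>) - \<i> *s h = - x" by (simp only: eq_neg_iff_add_eq_0)
  also have "\<dots> \<in> vertical_space u (s w)" by (rule subspace_neg[OF subspace_vertical_space x])
  finally have "dproj L u (s w) (ds w (\<i> *s \<xi>)) = dproj L u (s w) (\<i> *s h)"
    using dproj_eq_iff[OF L tangent_vanishes[OF lam Z ih]] by simp
  then show ?thesis
    unfolding dchart_s[OF w \<xi>] dchart_s[OF w \<xi>i] hy(3) reduced_J_dproj[OF L lam Z hy(1,2)] .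
qed

lemma holomorphic_chart_s: "holomorphic_chart L u lam I B W s"
  unfolding holomorphic_chart_def
  using openin_W s_in_Z s_smooth(2)[OF s_0(1)] inj_on_orbits bij_betw_dchart dchart_complex_linear by blast


end

lemma holomorphic_chart_exists:
  fixes u :: "'n::finite \<Rightarrow> 'g::euclidean_space"
  assumes L: "full_lattice L" and uL: "\<And>j. u j \<in> L" and lam: "\<forall>j\<in>I. lam j = 0"
    and z: "z \<in> Z_face u lam I"
  obtains B W s w where "holomorphic_chart L u lam I B W s" "w \<in> W" "s w = z"
proof -
  obtain B Q where Q: "linear Q" "\<And>v. Q v \<in> supported B" "\<And>v. v - Q v \<in> lie_kI u I"
    "\<And>v. Q v = 0 \<longleftrightarrow> v \<in> lie_kI u I" "\<And>x. x \<in> supported B \<Longrightarrow> Q x = x"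
    by (rule coordinate_complement[OF subspace_lie_kI[of u I]]) blast
  obtain \<epsilon> where \<epsilon>: "\<epsilon> > 0"
    "\<And>\<delta> c. norm \<delta> < \<epsilon> \<Longrightarrow> c \<in> supported I \<Longrightarrow> A_map u (\<delta> - c) \<in> L \<Longrightarrow> \<delta> \<in> lie_kI u I"
    by (rule lattice_discrete_mod_face[where u = u and L = L and I = I, OF L uL]) blast
  interpret face_slice L u lam I B Q "\<chi> j. if j \<in> I then 1 else (cmod (z $ j))\<^sup>2"
    "\<chi> j. if j \<in> I then -1 else lam j" z \<epsilon>
  proof (intro face_slice.intro slice_map.intro face_slice_axioms.intro)
    show "0 < (\<chi> j. if j \<in> I then 1 else (cmod (z $ j))\<^sup>2) $ j" for j
      using z by (simp add: Z_face_iff[OF lam])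
  qed (fact Q \<epsilon> L uL lam z refl)+
  show ?thesis using that[OF holomorphic_chart_s s_0] .
qed

section \<open>The Kaehler form\<close>

theorem theorem5p1:
  fixes L :: "'g::euclidean_space set"
    and u :: "'n::finite \<Rightarrow> 'g"
    and lam :: "'n \<Rightarrow> real"
    and I :: "'n set"
    and F :: "('g \<Rightarrow>\<^sub>L real) set"
  assumes "full_lattice L"
    and "\<And>j. primitive_vector L (u j)"
    and "span (range u) = UNIV"
    and "interior (moment_polyhedron u lam) \<noteq> {}"
    and "\<And>i. moment_polyhedron u lam
              \<subset> {\<eta>. \<forall>j. j \<noteq> i \<longrightarrow> blinfun_apply \<eta> (u j) - lam j \<ge> 0}"
    and "F face_of moment_polyhedron u lam"
    and "rel_interior F = open_face u lam I"
    and "I \<noteq> {}"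
    and "0 \<in> open_face u lam I"
  shows "\<forall>p \<in> M_face L u lam I.
           \<forall>X \<in> quotient_tangent L u lam I p. \<forall>Y \<in> quotient_tangent L u lam I p.
             reduced_form X Y =
               \<i> * ddbar L u lam I
                     (\<lambda>q. complex_of_real
                        ((\<lambda>\<eta>. \<Sum>j\<in>-I. (lam j * ln (blinfun_apply \<eta> (u j) - lam j)
                                       + blinfun_apply \<eta> (u j))) (phi_P u lam q)))
                     X Y"
proof (intro ballI)
  fix p X Y
  assume p: "p \<in> M_face L u lam I" and X: "X \<in> quotient_tangent L u lam I p" and Y: "Y \<in> quotient_tangent L u lam I p"
  note L = assms(1) and span = assms(3)
  have uL: "u j \<in> L" for j using assms(2) by (simp add: primitive_vector_def)
  have lam: "\<forall>j\<in>I. lam j = 0" using assms(9) by (simp add: open_face_def)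
  obtain z where z: "z \<in> level_set u lam" "p = K_orbit L u z" "phi_P u lam p \<in> open_face u lam I"
    using p by (auto simp: M_face_def M_P_def)
  have "z \<in> stratum I"
    using z(3) unfolding z(2) open_face_def by (auto simp: stratum_def phi_P_orbit[OF L span z(1)])
  with z(1) have zZ: "z \<in> Z_face u lam I" by (simp add: Z_face_def)
  obtain B0 W0 s0 w0 where chart0: "holomorphic_chart L u lam I B0 W0 s0" "w0 \<in> W0" "s0 w0 = z"
    by (rule holomorphic_chart_exists[OF L uL lam zZ])
  define f where "f q = complex_of_real (\<Sum>j\<in>-I. lam j * ln (blinfun_apply (phi_P u lam q) (u j) - lam j)
      + blinfun_apply (phi_P u lam q) (u j))" for q
  have chart_value: "\<i> * ddbar_coord B (\<lambda>x. f (K_orbit L u (s x))) w \<xi> \<eta> = reduced_form X Y"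
    if chart: "holomorphic_chart L u lam I B W s" and w: "w \<in> W" and \<xi>: "\<xi> \<in> coord_space B" and \<eta>: "\<eta> \<in> coord_space B"
      and XY: "dchart L u s w \<xi> = X" "dchart L u s w \<eta> = Y" for B W s w \<xi> \<eta>
  proof -
    have "C2_on W s" using chart by (simp add: holomorphic_chart_def)
    then obtain D E where "face_chart L u lam I B W s D E"
      by (rule C2_onE) (rule that, rule face_chart.intro[OF L lam chart])
    then interpret face_chart L u lam I B W s D E .
    have "f (K_orbit L u (s x)) = complex_of_real
        (\<Sum>j\<in>-I. lam j * ln ((cmod (s x $ j))\<^sup>2) + ((cmod (s x $ j))\<^sup>2 + lam j))" if "x \<in> W" for x
    proof -
      have "s x \<in> level_set u lam" using s_in_Z[OF that] by (simp add: Z_face_def)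
      then show ?thesis unfolding f_def by (simp add: phi_P_orbit[OF L span])
    qed
    from ddbar_coord_eq[OF this w \<xi> \<eta>]
    show ?thesis
      unfolding XY[symmetric] dchart_eq[OF w \<xi>] dchart_eq[OF w \<eta>]
        reduced_form_dproj[OF L lam s_in_Z[OF w] D_tangent[OF w \<xi>] D_tangent[OF w \<eta>]]
      by simp
  qed
  have "X \<in> dchart L u s0 w0 ` coord_space B0" "Y \<in> dchart L u s0 w0 ` coord_space B0"
    using X Y chart0 unfolding z(2) by (auto simp: holomorphic_chart_def bij_betw_def)
  then obtain \<xi> \<eta> where \<xi>\<eta>: "\<xi> \<in> coord_space B0" "\<eta> \<in> coord_space B0" "dchart L u s0 w0 \<xi> = X" "dchart L u s0 w0 \<eta> = Y"
    by blast
  have "ddbar L u lam I f X Y = ddbar_coord B0 (\<lambda>x. f (K_orbit L u (s0 x))) w0 \<xi> \<eta>"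
    unfolding ddbar_def
  proof (rule the_equality)
    show "\<exists>B W s w \<xi>' \<eta>'. holomorphic_chart L u lam I B W s \<and> w \<in> W \<and> \<xi>' \<in> coord_space B \<and> \<eta>' \<in> coord_space B \<and>
        dchart L u s w \<xi>' = X \<and> dchart L u s w \<eta>' = Y \<and>
        ddbar_coord B0 (\<lambda>x. f (K_orbit L u (s0 x))) w0 \<xi> \<eta> = ddbar_coord B (\<lambda>x. f (K_orbit L u (s x))) w \<xi>' \<eta>'"
      using chart0 \<xi>\<eta> by blast
    fix r
    assume "\<exists>B W s w \<xi> \<eta>. holomorphic_chart L u lam I B W s \<and> w \<in> W \<and> \<xi> \<in> coord_space B \<and> \<eta> \<in> coord_space B \<and>
        dchart L u s w \<xi> = X \<and> dchart L u s w \<eta> = Y \<and> r = ddbar_coord B (\<lambda>x. f (K_orbit L u (s x))) w \<xi> \<eta>"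
    then have "\<i> * r = reduced_form X Y" using chart_value by blast
    also have "\<dots> = \<i> * ddbar_coord B0 (\<lambda>x. f (K_orbit L u (s0 x))) w0 \<xi> \<eta>"
      using chart_value[OF chart0(1,2) \<xi>\<eta>] by simp
    finally show "r = ddbar_coord B0 (\<lambda>x. f (K_orbit L u (s0 x))) w0 \<xi> \<eta>" by simp
  qed
  then have "reduced_form X Y = \<i> * ddbar L u lam I f X Y"
    using chart_value[OF chart0(1,2) \<xi>\<eta>] by simp
  then show "reduced_form X Y = \<i> * ddbar L u lam I (\<lambda>q. complex_of_real
      ((\<lambda>\<eta>. \<Sum>j\<in>-I. (lam j * ln (blinfun_apply \<eta> (u j) - lam j) + blinfun_apply \<eta> (u j))) (phi_P u lam q))) X Y"
    by (simp add: f_def[abs_def])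
qed

end
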